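(* For the two-user symmetric Gaussian interference channel with feedback model $(1000)$, every rate pair $(R_1,R_2)$ in the capacity region satisfies $$2R_1+R_2\le \sup_{0\le|\rho|\le1}\Bigg\{\log\left(1+\frac{(1-|\rho|^2)\,\mathsf{SNR}}{1+(1-|\rho|^2)\,\mathsf{INR}}\right)+\log\left(1+\mathsf{SNR}+\mathsf{INR}+2|\rho|\sqrt{\mathsf{SNR}\cdot\mathsf{INR}}\right)$$ $$\qquad\qquad+\log\left(1+\mathsf{INR}+\frac{\mathsf{SNR}-(1+|\rho|^2)\,\mathsf{INR}+2|\rho|\sqrt{\mathsf{SNR}\cdot\mathsf{INR}}}{1+\mathsf{INR}}\right)\Bigg\}.$$
   Context: Symmetric Gaussian interference channel: at time $j$, transmitter $\mathsf{T}_u$ ($u\in\{1,2\}$) sends $X_{uj}\in\mathbb{C}$ and receivers $\mathsf{D}_1,\mathsf{D}_2$ receive $$Y_{1j}=g_dX_{1j}+g_cX_{2j}+Z_{1j},\qquad Y_{2j}=g_dX_{2j}+g_cX_{1j}+Z_{2j},$$ where $g_d,g_c\in\mathbb{C}$ are fixed gains and all noises $Z_{uj}\sim\mathcal{CN}(0,1)$ are independent of each other and of the messages. Power constraint: $\mathbb{E}|X_{uj}|^2\le P$. Define $\mathsf{SNR}=|g_d|^2P$, $\mathsf{INR}=|g_c|^2P$. Logarithms are base 2. Feedback model $(1000)$: there is a noiseless, strictly causal feedback link from receiver $\mathsf{D}_1$ to transmitter $\mathsf{T}_1$ only. Codes: for block length $N$, $W_u$ is uniform on $\{1,\dots,2^{NR_u}\}$,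 with $W_1,W_2$ independent. The encoders are $X_{1j}=f_{1j}(W_1,Y_1^{j-1})$ and $X_{2j}=f_{2j}(W_2)$, $j=1,\dots,N$, where $Y_1^{j-1}=(Y_{11},\dots,Y_{1,j-1})$. The decoder of $\mathsf{D}_u$ is a function $\widehat W_u=h_u(Y_u^N)$. A rate pair is achievable if there are codes with $\Pr(\widehat W_u\neq W_u)\to0$ as $N\to\infty$ for $u=1,2$. The capacity region is the closure of the set of achievable rate pairs. *)

theory Defs
  imports "HOL-Probability.Probability"
begin

text \<open>The circularly symmetric law \<open>CN(0,1)\<close>: total variance 1, i.e. variance 1/2 for each of
  the independent real and imaginary parts.\<close>

definition cgauss :: "complex measure" where
  "cgauss = density lborel (\<lambda>z. ennreal (exp (- (cmod z)\<^sup>2) / pi))"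

lemma sets_cgauss [simp, measurable_cong]: "sets cgauss = sets borel"
  by (simp add: cgauss_def)

lemma space_cgauss [simp]: "space cgauss = UNIV"
  by (simp add: cgauss_def)

lemma measurable_Complex_pair:
  "(\<lambda>(x::real, y). Complex x y) \<in> borel_measurable (lborel \<Otimes>\<^sub>M lborel)"
proof -
  have "(\<lambda>p::real \<times> real. of_real (fst p) + \<i> * of_real (snd p) :: complex) \<in> borel_measurable borel"
    by (intro borel_measurable_continuous_onI continuous_intros)
  then show ?thesis
    by (simp add: lborel_prod Complex_eq case_prod_beta')
qed

lemma lborel_complex_eq_distr:
  "(lborel :: complex measure) = distr (lborel \<Otimes>\<^sub>M lborel) borel (\<lambda>(x, y). Complex x y)"
proof (rule lborel_eqI)
  fix l u :: complex
  assume le: "\<And>b. b \<in> Basis \<Longrightarrow> l \<bullet> b \<le> u \<bullet> b"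
  have le': "Re l \<le> Re u" "Im l \<le> Im u"
    using le[of 1] le[of \<i>] by (auto simp: Basis_complex_def)
  have vim: "(\<lambda>(x, y). Complex x y) -` box l u \<inter> space (lborel \<Otimes>\<^sub>M lborel)
      = {Re l<..<Re u} \<times> {Im l<..<Im u}"
    by (auto simp: box_def Basis_complex_def space_pair_measure)
  have "emeasure (distr (lborel \<Otimes>\<^sub>M lborel) borel (\<lambda>(x, y). Complex x y)) (box l u)
      = emeasure (lborel \<Otimes>\<^sub>M lborel) ({Re l<..<Re u} \<times> {Im l<..<Im u})"
    using measurable_Complex_pair by (subst emeasure_distr) (simp_all add: vim)
  also have "\<dots> = ennreal (Re u - Re l) * ennreal (Im u - Im l)"
    using le' by (subst lborel.emeasure_pair_measure_Times) simp_all
  also have "\<dots> = ennreal (\<Prod>b\<in>Basis. (u - l) \<bullet> b)"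
    using le' by (simp add: Basis_complex_def ennreal_mult)
  finally show "emeasure (distr (lborel \<Otimes>\<^sub>M lborel) borel (\<lambda>(x, y). Complex x y)) (box l u)
      = ennreal (\<Prod>b\<in>Basis. (u - l) \<bullet> b)" .
qed simp

lemma prob_space_cgauss: "prob_space cgauss"
proof
  let ?f = "normal_density 0 (sqrt (1/2))"
  have f: "?f x = exp (- x\<^sup>2) / sqrt pi" for x
    by (simp add: normal_density_def)
  have dens: "exp (- (cmod (Complex x y))\<^sup>2) / pi = ?f x * ?f y" for x y
    by (simp add: f cmod_def exp_add[symmetric] flip: times_divide_times_eq)
  interpret N: prob_space "density lborel ?f"
    by (rule prob_space_normal_density) simp
  have one: "(\<integral>\<^sup>+x. ennreal (?f x) \<partial>lborel) = 1"
    using N.emeasure_space_1 by (simp add: emeasure_density)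
  have "emeasure cgauss (space cgauss)
      = (\<integral>\<^sup>+z. ennreal (exp (- (cmod z)\<^sup>2) / pi) \<partial>lborel)"
    by (simp add: cgauss_def emeasure_density)
  also have "\<dots> = (\<integral>\<^sup>+p. ennreal (?f (fst p) * ?f (snd p)) \<partial>(lborel \<Otimes>\<^sub>M lborel))"
    using measurable_Complex_pair
    by (subst lborel_complex_eq_distr, subst nn_integral_distr)
       (auto simp: case_prod_beta' dens)
  also have "\<dots> = (\<integral>\<^sup>+x. \<integral>\<^sup>+y. ennreal (?f x) * ennreal (?f y) \<partial>lborel \<partial>lborel)"
    by (subst lborel.nn_integral_fst[symmetric]) (auto simp: ennreal_mult)
  also have "\<dots> = 1"
    by (simp add: nn_integral_cmult one)
  finally show "emeasure cgauss (space cgauss) = 1" .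
qed

definition msgs :: "nat \<Rightarrow> real \<Rightarrow> nat set" where
  "msgs N R = {1..nat \<lceil>2 powr (real N * R)\<rceil>}"

text \<open>Sample points are \<open>(w1, w2, z1, z2)\<close>: the two messages and the two noise sequences, all
  independent; time runs over \<open>{1..N}\<close>.\<close>

type_synonym outcome = "nat \<times> nat \<times> (nat \<Rightarrow> complex) \<times> (nat \<Rightarrow> complex)"

definition chan_space :: "nat \<Rightarrow> real \<Rightarrow> real \<Rightarrow> outcome measure" where
  "chan_space N R1 R2 =
     measure_pmf (pmf_of_set (msgs N R1)) \<Otimes>\<^sub>M measure_pmf (pmf_of_set (msgs N R2)) \<Otimes>\<^sub>M
     (\<Pi>\<^sub>M j\<in>{1..N}. cgauss) \<Otimes>\<^sub>M (\<Pi>\<^sub>M j\<in>{1..N}. cgauss)"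

text \<open>\<open>enc1 C j w y\<close> is \<open>f\<^sub>1\<^sub>j(w, y)\<close> and is only ever applied to a past \<open>y\<close> that is restricted
  to \<open>{1..<j}\<close>; \<open>enc2 C j w\<close> is \<open>f\<^sub>2\<^sub>j(w)\<close>.\<close>

record fb_code =
  enc1 :: "nat \<Rightarrow> nat \<Rightarrow> (nat \<Rightarrow> complex) \<Rightarrow> complex"
  enc2 :: "nat \<Rightarrow> nat \<Rightarrow> complex"
  dec1 :: "(nat \<Rightarrow> complex) \<Rightarrow> nat"
  dec2 :: "(nat \<Rightarrow> complex) \<Rightarrow> nat"

lemma restrict_fundef_cong [fundef_cong]:
  "A = B \<Longrightarrow> (\<And>x. x \<in> B \<Longrightarrow> f x = g x) \<Longrightarrow> restrict f A = restrict g B"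
  by auto

function Y1 :: "complex \<Rightarrow> complex \<Rightarrow> fb_code \<Rightarrow> outcome \<Rightarrow> nat \<Rightarrow> complex" where
  "Y1 gd gc C (w1, w2, z1, z2) j =
     gd * enc1 C j w1 (\<lambda>i\<in>{1..<j}. Y1 gd gc C (w1, w2, z1, z2) i) + gc * enc2 C j w2 + z1 j"
  by pat_completeness auto
termination
  by (relation "Wellfounded.measure (\<lambda>(_, _, _, _, j). j)") auto

declare Y1.simps [simp del]

fun X1 :: "complex \<Rightarrow> complex \<Rightarrow> fb_code \<Rightarrow> outcome \<Rightarrow> nat \<Rightarrow> complex" where
  "X1 gd gc C (w1, w2, z1, z2) j = enc1 C j w1 (\<lambda>i\<in>{1..<j}. Y1 gd gc C (w1, w2, z1, z2) i)"

fun X2 :: "fb_code \<Rightarrow> outcome \<Rightarrow> nat \<Rightarrow> complex" where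
  "X2 C (w1, w2, z1, z2) j = enc2 C j w2"

fun Y2 :: "complex \<Rightarrow> complex \<Rightarrow> fb_code \<Rightarrow> outcome \<Rightarrow> nat \<Rightarrow> complex" where
  "Y2 gd gc C (w1, w2, z1, z2) j =
     gd * X2 C (w1, w2, z1, z2) j + gc * X1 gd gc C (w1, w2, z1, z2) j + z2 j"

lemma Y1_eq:
  "Y1 gd gc C (w1, w2, z1, z2) j =
     gd * X1 gd gc C (w1, w2, z1, z2) j + gc * X2 C (w1, w2, z1, z2) j + z1 j"
  by (subst Y1.simps) simp

text \<open>The encoders must be measurable for every \<open>w\<close>, not only for \<open>w \<in> msgs N R1\<close>: the message
  space of \<open>chan_space\<close> is all of \<open>nat\<close>, so otherwise the error events could be non-measurable
  and have \<open>measure\<close> 0. The power is a nonnegative integral rather than a Bochner integral, so that an input of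
  infinite power does not count as having power 0.\<close>

definition valid_code ::
  "complex \<Rightarrow> complex \<Rightarrow> real \<Rightarrow> nat \<Rightarrow> real \<Rightarrow> real \<Rightarrow> fb_code \<Rightarrow> bool" where
  "valid_code gd gc P N R1 R2 C \<longleftrightarrow>
     (\<forall>j\<in>{1..N}. \<forall>w. enc1 C j w \<in> borel_measurable (\<Pi>\<^sub>M i\<in>{1..<j}. borel)) \<and>
     dec1 C \<in> measurable (\<Pi>\<^sub>M i\<in>{1..N}. borel) (count_space UNIV) \<and>
     dec2 C \<in> measurable (\<Pi>\<^sub>M i\<in>{1..N}. borel) (count_space UNIV) \<and>
     (\<forall>j\<in>{1..N}.
        (\<integral>\<^sup>+\<omega>. ennreal ((cmod (X1 gd gc C \<omega> j))\<^sup>2) \<partial>chan_space N R1 R2) \<le> ennreal P \<and>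
        (\<integral>\<^sup>+\<omega>. ennreal ((cmod (X2 C \<omega> j))\<^sup>2) \<partial>chan_space N R1 R2) \<le> ennreal P)"

definition err1 :: "complex \<Rightarrow> complex \<Rightarrow> nat \<Rightarrow> real \<Rightarrow> real \<Rightarrow> fb_code \<Rightarrow> real" where
  "err1 gd gc N R1 R2 C = measure (chan_space N R1 R2)
     {\<omega> \<in> space (chan_space N R1 R2). dec1 C (\<lambda>j\<in>{1..N}. Y1 gd gc C \<omega> j) \<noteq> fst \<omega>}"

definition err2 :: "complex \<Rightarrow> complex \<Rightarrow> nat \<Rightarrow> real \<Rightarrow> real \<Rightarrow> fb_code \<Rightarrow> real" where
  "err2 gd gc N R1 R2 C = measure (chan_space N R1 R2)
     {\<omega> \<in> space (chan_space N R1 R2). dec2 C (\<lambda>j\<in>{1..N}. Y2 gd gc C \<omega> j) \<noteq> fst (snd \<omega>)}"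

definition achievable :: "complex \<Rightarrow> complex \<Rightarrow> real \<Rightarrow> real \<Rightarrow> real \<Rightarrow> bool" where
  "achievable gd gc P R1 R2 \<longleftrightarrow> 0 \<le> R1 \<and> 0 \<le> R2 \<and>
     (\<exists>C :: nat \<Rightarrow> fb_code.
        (\<forall>N. valid_code gd gc P N R1 R2 (C N)) \<and>
        (\<lambda>N. err1 gd gc N R1 R2 (C N)) \<longlonglongrightarrow> 0 \<and>
        (\<lambda>N. err2 gd gc N R1 R2 (C N)) \<longlonglongrightarrow> 0)"

definition capacity_region :: "complex \<Rightarrow> complex \<Rightarrow> real \<Rightarrow> (real \<times> real) set" where
  "capacity_region gd gc P = closure {(R1, R2). achievable gd gc P R1 R2}"

definition snr :: "complex \<Rightarrow> real \<Rightarrow> real" where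
  "snr gd P = (cmod gd)\<^sup>2 * P"

definition inr :: "complex \<Rightarrow> real \<Rightarrow> real" where
  "inr gc P = (cmod gc)\<^sup>2 * P"

lemma prob_space_chan_space: "prob_space (chan_space N R1 R2)"
proof -
  have "prob_space (\<Pi>\<^sub>M j\<in>{1..N}. cgauss)"
    by (intro prob_space_PiM prob_space_cgauss)
  then show ?thesis
    unfolding chan_space_def
    by (intro prob_space_pair prob_space_measure_pmf)
qed

lemma measurable_Y1:
  assumes "valid_code gd gc P N R1 R2 C" and "j \<in> {1..N}"
  shows "(\<lambda>\<omega>. Y1 gd gc C \<omega> j) \<in> borel_measurable (chan_space N R1 R2)"
  using assms(2)
proof (induction j rule: less_induct)
  case (less j)
  let ?M = "chan_space N R1 R2"
  have enc: "enc1 C j w \<in> borel_measurable (\<Pi>\<^sub>M i\<in>{1..<j}. borel)" for w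
    using assms(1) less.prems by (auto simp: valid_code_def)
  have past: "(\<lambda>\<omega>. \<lambda>i\<in>{1..<j}. Y1 gd gc C \<omega> i) \<in> measurable ?M (\<Pi>\<^sub>M i\<in>{1..<j}. borel)"
    using less by (intro measurable_restrict) auto
  have w1: "fst \<in> measurable ?M (count_space UNIV)"
    and w2: "(\<lambda>\<omega>. fst (snd \<omega>)) \<in> measurable ?M (count_space UNIV)"
    and z1: "(\<lambda>\<omega>. fst (snd (snd \<omega>)) j) \<in> borel_measurable ?M"
    using less.prems unfolding chan_space_def by measurable
  have x1: "(\<lambda>\<omega>. enc1 C j (fst \<omega>) (\<lambda>i\<in>{1..<j}. Y1 gd gc C \<omega> i)) \<in> borel_measurable ?M"
    by (rule measurable_compose_countable[OF measurable_compose[OF past enc] w1])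
  have x2: "(\<lambda>\<omega>. enc2 C j (fst (snd \<omega>))) \<in> borel_measurable ?M"
    by (rule measurable_compose[OF w2]) simp
  have "(\<lambda>\<omega>. Y1 gd gc C \<omega> j) = (\<lambda>\<omega>. gd * enc1 C j (fst \<omega>) (\<lambda>i\<in>{1..<j}. Y1 gd gc C \<omega> i)
      + gc * enc2 C j (fst (snd \<omega>)) + fst (snd (snd \<omega>)) j)"
    by (rule ext, case_tac \<omega>) (simp add: Y1.simps[of _ _ _ _ _ _ _ j])
  then show ?case
    using x1 x2 z1 by simp
qed

lemma measurable_X1:
  assumes "valid_code gd gc P N R1 R2 C" and "j \<in> {1..N}"
  shows "(\<lambda>\<omega>. X1 gd gc C \<omega> j) \<in> borel_measurable (chan_space N R1 R2)"
proof -
  let ?M = "chan_space N R1 R2"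
  have enc: "enc1 C j w \<in> borel_measurable (\<Pi>\<^sub>M i\<in>{1..<j}. borel)" for w
    using assms by (auto simp: valid_code_def)
  have past: "(\<lambda>\<omega>. \<lambda>i\<in>{1..<j}. Y1 gd gc C \<omega> i) \<in> measurable ?M (\<Pi>\<^sub>M i\<in>{1..<j}. borel)"
    using assms by (intro measurable_restrict measurable_Y1) auto
  have w1: "fst \<in> measurable ?M (count_space UNIV)"
    unfolding chan_space_def by measurable
  have "(\<lambda>\<omega>. enc1 C j (fst \<omega>) (\<lambda>i\<in>{1..<j}. Y1 gd gc C \<omega> i)) \<in> borel_measurable ?M"
    by (rule measurable_compose_countable[OF measurable_compose[OF past enc] w1])
  moreover have "(\<lambda>\<omega>. X1 gd gc C \<omega> j) =
      (\<lambda>\<omega>. enc1 C j (fst \<omega>) (\<lambda>i\<in>{1..<j}. Y1 gd gc C \<omega> i))"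
    by (rule ext, case_tac \<omega>) simp
  ultimately show ?thesis by simp
qed

lemma measurable_X2:
  "(\<lambda>\<omega>. X2 C \<omega> j) \<in> borel_measurable (chan_space N R1 R2)"
proof -
  have w2: "(\<lambda>\<omega>. fst (snd \<omega>)) \<in> measurable (chan_space N R1 R2) (count_space UNIV)"
    unfolding chan_space_def by measurable
  have "(\<lambda>\<omega>. enc2 C j (fst (snd \<omega>))) \<in> borel_measurable (chan_space N R1 R2)"
    by (rule measurable_compose[OF w2]) simp
  moreover have "(\<lambda>\<omega>. X2 C \<omega> j) = (\<lambda>\<omega>. enc2 C j (fst (snd \<omega>)))"
    by (rule ext, case_tac \<omega>) simp
  ultimately show ?thesis by simp
qed

lemma measurable_Y2:
  assumes "valid_code gd gc P N R1 R2 C" and "j \<in> {1..N}"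
  shows "(\<lambda>\<omega>. Y2 gd gc C \<omega> j) \<in> borel_measurable (chan_space N R1 R2)"
proof -
  have z2: "(\<lambda>\<omega>. snd (snd (snd \<omega>)) j) \<in> borel_measurable (chan_space N R1 R2)"
    using assms(2) unfolding chan_space_def by measurable
  have "(\<lambda>\<omega>. Y2 gd gc C \<omega> j) =
      (\<lambda>\<omega>. gd * X2 C \<omega> j + gc * X1 gd gc C \<omega> j + snd (snd (snd \<omega>)) j)"
    by (rule ext, case_tac \<omega>) simp
  then show ?thesis
    using z2 measurable_X1[OF assms] measurable_X2[of C j N R1 R2] by simp
qed

lemma sets_neq_nat:
  fixes f g :: "'a \<Rightarrow> nat"
  assumes f: "f \<in> measurable M (count_space UNIV)" and g: "g \<in> measurable M (count_space UNIV)"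
  shows "{x \<in> space M. f x \<noteq> g x} \<in> sets M"
proof -
  have "{x \<in> space M. f x \<noteq> g x} = (\<Union>n. (f -` {n} \<inter> space M) \<inter> (g -` (- {n}) \<inter> space M))"
    by auto
  then show ?thesis
    using measurable_sets[OF f] measurable_sets[OF g] by auto
qed

lemma sets_err_events:
  assumes "valid_code gd gc P N R1 R2 C"
  defines "M \<equiv> chan_space N R1 R2"
  shows "{\<omega> \<in> space M. dec1 C (\<lambda>j\<in>{1..N}. Y1 gd gc C \<omega> j) \<noteq> fst \<omega>} \<in> sets M"
    and "{\<omega> \<in> space M. dec2 C (\<lambda>j\<in>{1..N}. Y2 gd gc C \<omega> j) \<noteq> fst (snd \<omega>)} \<in> sets M"
proof -
  have w: "fst \<in> measurable M (count_space UNIV)"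
    "(\<lambda>\<omega>. fst (snd \<omega>)) \<in> measurable M (count_space UNIV)"
    unfolding M_def chan_space_def by measurable
  have d: "dec1 C \<in> measurable (\<Pi>\<^sub>M i\<in>{1..N}. borel) (count_space UNIV)"
    "dec2 C \<in> measurable (\<Pi>\<^sub>M i\<in>{1..N}. borel) (count_space UNIV)"
    using assms(1) by (auto simp: valid_code_def)
  have y: "(\<lambda>\<omega>. \<lambda>j\<in>{1..N}. Y1 gd gc C \<omega> j) \<in> measurable M (\<Pi>\<^sub>M i\<in>{1..N}. borel)"
    "(\<lambda>\<omega>. \<lambda>j\<in>{1..N}. Y2 gd gc C \<omega> j) \<in> measurable M (\<Pi>\<^sub>M i\<in>{1..N}. borel)"
    unfolding M_def using assms(1)
    by (auto intro!: measurable_restrict measurable_Y1 measurable_Y2)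
  show "{\<omega> \<in> space M. dec1 C (\<lambda>j\<in>{1..N}. Y1 gd gc C \<omega> j) \<noteq> fst \<omega>} \<in> sets M"
    by (rule sets_neq_nat[OF measurable_compose[OF y(1) d(1)] w(1)])
  show "{\<omega> \<in> space M. dec2 C (\<lambda>j\<in>{1..N}. Y2 gd gc C \<omega> j) \<noteq> fst (snd \<omega>)} \<in> sets M"
    by (rule sets_neq_nat[OF measurable_compose[OF y(2) d(2)] w(2)])
qed

end

(* Write X1, X2, Y1, Y2 for inputs and outputs and let S = gc X2 + Z1 be what the first receiver sees
   besides its own input; the past of Y1 is a function of W1 and the past of S. Three outer bounds on
   2 R1 + R2 hold for one and the same correlation coefficient r = |E X1 cnj X2| / P:
     direct  R1 <= I(W1; Y1 | W2) twice and R2 <= I(W2; Y1, Y2 | W1),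
     sum     R1 <= I(W1; Y1 | W2), R1 <= I(W1; Y1, Q | W2) and R2 <= I(W2; Y2) with Q = gc X1 + Z2,
     genie   R1 <= I(W1; Y1), R1 <= I(W1; Y1, Q | W2) and R2 <= I(W2; Y2, St), where St is a copy of S
             with fresh noise Zt, Q = gc X1 + b V and Z2 = al Zt + b V, |al| <= sqrt (SNR / INR), |al| < 1.
   Instead of entropies each bound uses three positive functions of noise and messages, namely
   likelihood ratios of the channel laws against Gaussian references times the decoding gain, whose
   mean is at most 1. Since ln x <= x - 1, the mean of the sum of their logarithms is at most 0; the
   laws of Q and of S, St cancel in that sum, and only second moments remain.
   None of the three bounds gives the claim alone: for each (SNR, INR, r) one of them, for a suitable
   al, is below the right-hand side at r, at 0, at 3/5 or at sqrt (INR / SNR). These polynomial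
   inequalities are certified by substitutions after which all coefficients are nonnegative. *)

theory Submission
  imports Defs
begin

text \<open>The claimed third factor is in general smaller than what the plain genie gives. With
  \<open>al = 0\<close>, \<open>genie_bound\<close> has the claimed first two factors, but its last
  one exceeds the claimed one by \<open>INR * (1 + r^2 - r^2 * INR) / (1 + INR)\<close>. Correlating
  the noise of Y2 with the noise of the copy lowers it: for \<open>al = i / s\<close>, where
  \<open>i\<close> and \<open>s\<close> are the roots of INR and SNR, the excess tends to
  \<open>INR * r^2 * (1 - INR) / (1 + INR)\<close> as SNR grows. Where this does not settle a point,
  the correlation is moved: the right-hand side is a supremum, so its argument may differ from the
  correlation of the code. Feedback does little harm: for a fixed first message, Y1 arises from S by
  a causal map in which the noise has unit gain. Such a map preserves volume, so densities transform
  as without feedback. The Gaussian references have the same variances at all times and for all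
  messages, with means linear in the signals, so only total powers and the total correlation enter.
  One complex number of modulus at most 1 then describes the code, and no concavity argument over
  time is made.\<close>

subsection \<open>Certificates for polynomial inequalities\<close>

text \<open>\<open>Hor p q\<close> stands for \<open>p + x * q\<close>, where \<open>x\<close> is the first variable and \<open>p\<close> is a polynomial in the
  remaining ones.\<close>

datatype mpoly = Cst int | Hor mpoly mpoly

fun ev :: "mpoly \<Rightarrow> real list \<Rightarrow> real" where
  "ev (Cst a) vs = of_int a"
| "ev (Hor p q) vs = ev p (tl vs) + hd vs * ev q vs"

fun is_zero :: "mpoly \<Rightarrow> bool" where
  "is_zero (Cst a) \<longleftrightarrow> a = 0"
| "is_zero (Hor p q) \<longleftrightarrow> False"

lemma ev_is_zero: "is_zero p \<Longrightarrow> ev p vs = 0"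
  by (cases p) auto

fun padd :: "mpoly \<Rightarrow> mpoly \<Rightarrow> mpoly" where
  "padd (Cst a) (Cst b) = Cst (a + b)"
| "padd (Cst a) (Hor p q) = (if a = 0 then Hor p q else Hor (padd (Cst a) p) q)"
| "padd (Hor p q) (Cst a) = (if a = 0 then Hor p q else Hor (padd p (Cst a)) q)"
| "padd (Hor p q) (Hor r s) = Hor (padd p r) (padd q s)"

fun psmult :: "int \<Rightarrow> mpoly \<Rightarrow> mpoly" where
  "psmult a (Cst b) = Cst (a * b)"
| "psmult a (Hor p q) = (if a = 0 then Cst 0 else Hor (psmult a p) (psmult a q))"

text \<open>Two products calling each other: in \<open>pscale p q\<close> the left factor is a
  Horner coefficient, hence free of the first variable, while \<open>pmul\<close> multiplies two
  polynomials in the same variables. The test for a zero tail keeps degrees from growing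
  artificially.\<close>

fun pmul :: "mpoly \<Rightarrow> mpoly \<Rightarrow> mpoly" and pscale :: "mpoly \<Rightarrow> mpoly \<Rightarrow> mpoly" where
  "pmul (Cst a) r = psmult a r"
| "pmul (Hor p q) r = (if is_zero q then pscale p r else padd (pscale p r) (Hor (Cst 0) (pmul q r)))"
| "pscale p (Cst b) = (if b = 0 then Cst 0 else Hor (psmult b p) (Cst 0))"
| "pscale p (Hor r s) = Hor (pmul p r) (pscale p s)"

lemma ev_padd: "ev (padd p q) vs = ev p vs + ev q vs"
  by (induction p q arbitrary: vs rule: padd.induct) (auto simp: algebra_simps)

lemma ev_psmult: "ev (psmult a p) vs = of_int a * ev p vs"
  by (induction p arbitrary: vs) (auto simp: algebra_simps)

lemma ev_pmul: "ev (pmul p q) vs = ev p vs * ev q vs"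
  and ev_pscale: "ev (pscale p q) vs = ev p (tl vs) * ev q vs"
  by (induction p q and p q arbitrary: vs and vs rule: pmul_pscale.induct)
    (auto simp: algebra_simps ev_padd ev_psmult ev_is_zero)

text \<open>\<open>((m, n), d, e)\<close> stands for the substitution \<open>v = (m + n * y) / (d + e * y)\<close> with \<open>y \<ge> 0\<close>. It maps
  \<open>y \<ge> 0\<close> onto \<open>m / d \<le> v < n / e\<close>; \<open>psubst\<close> returns the numerator and the cleared denominator.\<close>

type_synonym subst_range = "(int \<times> int) \<times> int \<times> int"

fun psubst :: "subst_range \<Rightarrow> mpoly \<Rightarrow> mpoly \<times> mpoly" where
  "psubst b (Cst a) = (Cst a, Cst 1)"
| "psubst b (Hor p q) = (if is_zero q then (Hor p q, Cst 1) else let (r, w) = psubst b q; ((m, n), d, e) = b;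
      w' = pmul (Hor (Cst d) (Cst e)) w
    in (padd (pscale p w') (pmul (Hor (Cst m) (Cst n)) r), w'))"

fun coeffs_all :: "(mpoly \<Rightarrow> bool) \<Rightarrow> mpoly \<Rightarrow> bool" where
  "coeffs_all P (Cst a) \<longleftrightarrow> P (Cst a)"
| "coeffs_all P (Hor p q) \<longleftrightarrow> P p \<and> coeffs_all P q"

text \<open>After substitution the current variable runs over all nonnegative reals, so it is enough
  that each of its coefficients is nonnegative; these are polynomials in the remaining variables and
  are certified in turn. The test is sufficient only, which is why the regions below are cut into
  boxes.\<close>

fun nonneg_cert :: "subst_range list \<Rightarrow> mpoly \<Rightarrow> bool" where
  "nonneg_cert bs (Cst a) \<longleftrightarrow> 0 \<le> a"
| "nonneg_cert [] (Hor p q) \<longleftrightarrow> False"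
| "nonneg_cert (b # bs) p \<longleftrightarrow> coeffs_all (nonneg_cert bs) (fst (psubst b p))"

definition in_range :: "subst_range \<Rightarrow> real \<Rightarrow> bool" where
  "in_range b v = (case b of ((m, n), d, e) \<Rightarrow>
     (\<exists>y\<ge>0. v * (of_int d + of_int e * y) = of_int m + of_int n * y \<and> 0 < d \<and> 0 \<le> e))"

lemma in_range_bounded:
  assumes "0 < d" "of_int m \<le> v * of_int d" "v * of_int d < of_int n"
  shows "in_range ((m, n), d, d) v"
proof -
  let ?y = "(v * of_int d - of_int m) / (of_int n - v * of_int d)"
  have "0 \<le> ?y" using assms by simp
  moreover have "v * (of_int d + of_int d * ?y) = of_int m + of_int n * ?y"
  proof -
    have "of_int n - v * of_int d \<noteq> 0" using assms by simp
    then show ?thesis by (simp add: divide_simps) (simp add: algebra_simps)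
  qed
  ultimately show ?thesis using assms(1) unfolding in_range_def by auto
qed

lemma in_range_unbounded:
  assumes "0 < d" "of_int m \<le> v * of_int d"
  shows "in_range ((m, d), d, 0) v"
proof -
  have "v * (of_int d + of_int 0 * (v - m / d)) = of_int m + of_int d * (v - m / d)" "0 \<le> v - m / d"
    using assms by (auto simp: field_simps)
  then show ?thesis using assms(1) unfolding in_range_def by blast
qed

text \<open>The second component is a power of \<open>d + e * y\<close>, positive on the range, so
  the computed numerator has the sign of the original polynomial.\<close>

lemma psubst_sound:
  assumes "v * (of_int d + of_int e * y) = of_int m + of_int n * y" "0 < d" "0 \<le> e" "0 \<le> y"
  shows "ev (fst (psubst ((m, n), d, e) p)) (y # vs) =
      ev (snd (psubst ((m, n), d, e) p)) (y # vs) * ev p (v # vs)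
    \<and> 0 < ev (snd (psubst ((m, n), d, e) p)) (y # vs)"
proof (induction p)
  case (Hor p q)
  let ?N = "Hor (Cst m) (Cst n)" and ?D = "Hor (Cst d) (Cst e)"
  obtain r w where rw: "psubst ((m, n), d, e) q = (r, w)" by fastforce
  have pos: "0 < of_int d + of_int e * y" using assms by (simp add: add_pos_nonneg)
  have IH: "ev r (y # vs) = ev w (y # vs) * ev q (v # vs)" "0 < ev w (y # vs)"
    using Hor(2) rw by auto
  let ?k = "real_of_int d + of_int e * y"
  have w': "ev (pmul ?D w) (y # vs) = ?k * ev w (y # vs)"
    by (simp add: ev_pmul algebra_simps del: pmul.simps)
  have "(of_int m + of_int n * y) * ev r (y # vs) = v * ?k * (ev w (y # vs) * ev q (v # vs))"
    using IH assms(1) by simp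
  then have r': "ev (pmul ?N r) (y # vs) = v * ?k * (ev w (y # vs) * ev q (v # vs))"
    by (simp add: ev_pmul algebra_simps del: pmul.simps)
  have "ev (padd (pscale p (pmul ?D w)) (pmul ?N r)) (y # vs) =
      ev (pmul ?D w) (y # vs) * ev (Hor p q) (v # vs)"
    unfolding ev_padd[of "pscale p (pmul ?D w)"] r' ev_pscale w' by (simp add: algebra_simps)
  moreover have "0 < ev (pmul ?D w) (y # vs)"
    unfolding w' using pos IH by simp
  ultimately show ?case
    by (auto simp: rw Let_def ev_is_zero simp del: pmul.simps)
qed auto

lemma coeffs_all_nonneg:
  assumes "coeffs_all P p" "\<And>q. P q \<Longrightarrow> 0 \<le> ev q vs" "\<And>a. P (Cst a) \<Longrightarrow> 0 \<le> a" "0 \<le> y"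
  shows "0 \<le> ev p (y # vs)"
  using assms(1) by (induction p) (use assms(2-) in auto)

lemma nonneg_cert_sound:
  assumes "nonneg_cert bs p" "list_all2 in_range bs vs"
  shows "0 \<le> ev p vs"
  using assms
proof (induction bs p arbitrary: vs rule: nonneg_cert.induct)
  case (3 b bs p q)
  obtain v vs' where vs: "vs = v # vs'" "in_range b v" "list_all2 in_range bs vs'"
    using 3(3) by (auto simp: list_all2_Cons1)
  obtain m n d e where b: "b = ((m, n), d, e)" by (metis surj_pair)
  obtain y where y: "y \<ge> 0" "v * (of_int d + of_int e * y) = of_int m + of_int n * y" "0 < d" "0 \<le> e"
    using vs(2) by (auto simp: in_range_def b)
  note s = psubst_sound[OF y(2,3,4,1), of "Hor p q" vs']
  have "0 \<le> ev (fst (psubst ((m, n), d, e) (Hor p q))) (y # vs')"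
  proof (rule coeffs_all_nonneg[of "nonneg_cert bs"])
    show "coeffs_all (nonneg_cert bs) (fst (psubst ((m, n), d, e) (Hor p q)))"
      using 3(2) b by simp
    show "0 \<le> ev q vs'" if "nonneg_cert bs q" for q
      using 3(1)[of q vs'] that vs(3) by auto
  qed (use y(1) in auto)
  then show ?case using s vs(1) by (simp add: zero_le_mult_iff)
qed auto

text \<open>Only the syntax of arithmetic: Horner forms are not unique, so the ring laws hold for
  the values under \<open>ev\<close> and not for the terms themselves.\<close>

instantiation mpoly :: "{plus, minus, times}"
begin

definition "p + q = padd p q"
definition "p - q = padd p (psmult (- 1) q)"
definition "p * q = pmul p q"

instance ..

end

lemma ev_arith [simp]:
  "ev (p + q) vs = ev p vs + ev q vs"
  "ev (p - q) vs = ev p vs - ev q vs"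
  "ev (p * q) vs = ev p vs * ev q vs"
  by (simp_all add: plus_mpoly_def minus_mpoly_def times_mpoly_def ev_padd ev_psmult ev_pmul)

definition "pX = Hor (Cst 0) (Cst 1)"
definition "pY = Hor pX (Cst 0)"
definition "pZ = Hor pY (Cst 0)"

lemma ev_var [simp]: "ev pX [x, y, z] = x" "ev pY [x, y, z] = y" "ev pZ [x, y, z] = z"
  by (auto simp: pX_def pY_def pZ_def)

lemma nonneg_certI:
  assumes "nonneg_cert [b, c, d] p" "in_range b x" "in_range c y" "in_range d z"
  shows "0 \<le> ev p [x, y, z]"
  using nonneg_cert_sound[OF assms(1), of "[x, y, z]"] assms(2-) by simp

lemmas in_range_intros = in_range_bounded in_range_unbounded

subsection \<open>Comparison of the three bounds with the right-hand side\<close>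

text \<open>Here \<open>i\<close> and \<open>s\<close> are the square roots of \<open>INR\<close> and \<open>SNR\<close>.\<close>

definition rhs_term :: "real \<Rightarrow> real \<Rightarrow> real \<Rightarrow> real" where
  "rhs_term i s r =
     (1 + (1 - r\<^sup>2) * s\<^sup>2 / (1 + (1 - r\<^sup>2) * i\<^sup>2)) * (1 + s\<^sup>2 + i\<^sup>2 + 2 * r * (s * i)) *
     (1 + i\<^sup>2 + (s\<^sup>2 - (1 + r\<^sup>2) * i\<^sup>2 + 2 * r * (s * i)) / (1 + i\<^sup>2))"

text \<open>The exponential of the bound per channel use, as for the next two. Two factors
  \<open>1 + SNR\<close> come from \<open>I(W1; Y1 | W2)\<close>; the last factor is that of a
  single input seen by both receivers through the gains gd and gc.\<close>

definition direct_bound :: "real \<Rightarrow> real \<Rightarrow> real" where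
  "direct_bound i s = (1 + s\<^sup>2)\<^sup>2 * (1 + s\<^sup>2 + i\<^sup>2)"

definition sum_bound :: "real \<Rightarrow> real \<Rightarrow> real \<Rightarrow> real" where
  "sum_bound i s r = (1 + (1 - r\<^sup>2) * s\<^sup>2) *
     (1 + (1 - r\<^sup>2) * s\<^sup>2 / (1 + (1 - r\<^sup>2) * i\<^sup>2)) * (1 + s\<^sup>2 + i\<^sup>2 + 2 * r * (s * i))"

text \<open>The last numerator over \<open>1 + i^2\<close> is the error of estimating Y2 linearly
  from the copy St, and \<open>1 - al^2\<close> is the variance of the part of Z2 that is
  independent of the noise of St.\<close>

definition genie_bound :: "real \<Rightarrow> real \<Rightarrow> real \<Rightarrow> real \<Rightarrow> real" where
  "genie_bound i s al r = (1 + s\<^sup>2 + i\<^sup>2 + 2 * r * (s * i)) *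
     (1 + (1 - r\<^sup>2) * (1 - al\<^sup>2) * s\<^sup>2 / ((1 - al\<^sup>2) + (1 - r\<^sup>2) * i\<^sup>2)) *
     (((1 + s\<^sup>2 + i\<^sup>2 + 2 * r * (s * i)) * (1 + i\<^sup>2) - (s * i + r * i\<^sup>2 + al)\<^sup>2)
       / ((1 + i\<^sup>2) * (1 - al\<^sup>2)))"

lemma one_plus_div: "(d::real) \<noteq> 0 \<Longrightarrow> 1 + x / d = (d + x) / d"
  by (simp add: add_divide_distrib)

lemma frac_leI: "0 < b \<Longrightarrow> 0 < d \<Longrightarrow> a * d \<le> c * b \<Longrightarrow> a / b \<le> c / (d::real)"
  by (simp add: field_simps)

lemma one_plus_mult_square_pos: "0 \<le> a \<Longrightarrow> 0 < 1 + a * (i::real)\<^sup>2"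
  by (smt (verit) mult_nonneg_nonneg zero_le_power2)

lemma rhs_term_eq:
  fixes i s r :: real
  assumes "\<bar>r\<bar> \<le> 1"
  defines "a \<equiv> 1 - r * r" and "I \<equiv> i * i" and "S \<equiv> s * s" and "q \<equiv> i * s"
  shows "rhs_term i s r = (1 + a * I + a * S) * (1 + S + I + 2 * (r * q)) *
     ((1 + I) * (1 + I) + S - (1 + r * r) * I + 2 * (r * q)) / ((1 + a * I) * (1 + I))"
proof -
  have "0 \<le> a" using assms by (simp add: a_def abs_square_le_1 flip: power2_eq_square)
  then have nz: "1 + a * I \<noteq> 0" "1 + I \<noteq> 0"
    using one_plus_mult_square_pos[of a i] one_plus_mult_square_pos[of 1 i] by (auto simp: I_def power2_eq_square)
  have e: "1 + I + (S - (1 + r * r) * I + 2 * (r * q)) / (1 + I) =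
      ((1 + I) * (1 + I) + S - (1 + r * r) * I + 2 * (r * q)) / (1 + I)"
    using nz by (simp add: add_divide_distrib diff_divide_distrib)
  have "rhs_term i s r = (1 + a * S / (1 + a * I)) * (1 + S + I + 2 * (r * q)) *
     (1 + I + (S - (1 + r * r) * I + 2 * (r * q)) / (1 + I))"
    unfolding rhs_term_def a_def I_def S_def q_def by (simp add: power2_eq_square algebra_simps)
  then show ?thesis
    unfolding e one_plus_div[OF nz(1)] by simp
qed

lemma sum_bound_eq:
  fixes i s r :: real
  assumes "\<bar>r\<bar> \<le> 1"
  defines "a \<equiv> 1 - r * r" and "I \<equiv> i * i" and "S \<equiv> s * s" and "q \<equiv> i * s"
  shows "sum_bound i s r = (1 + a * I + a * S) * (1 + S + I + 2 * (r * q)) * (1 + a * S) / (1 + a * I)"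
proof -
  have "0 \<le> a" using assms by (simp add: a_def abs_square_le_1 flip: power2_eq_square)
  then have nz: "1 + a * I \<noteq> 0"
    using one_plus_mult_square_pos[of a i] by (auto simp: I_def power2_eq_square)
  have "sum_bound i s r = (1 + a * S) * (1 + a * S / (1 + a * I)) * (1 + S + I + 2 * (r * q))"
    unfolding sum_bound_def a_def I_def S_def q_def by (simp add: power2_eq_square algebra_simps)
  then show ?thesis
    unfolding one_plus_div[OF nz(1)] by simp
qed

lemma genie_bound_eq:
  fixes i s al r :: real
  assumes "\<bar>r\<bar> \<le> 1" "\<bar>al\<bar> < 1"
  defines "a \<equiv> 1 - r * r" and "b \<equiv> 1 - al * al" and "I \<equiv> i * i" and "S \<equiv> s * s" and "q \<equiv> i * s"
  shows "genie_bound i s al r = (1 + S + I + 2 * (r * q)) * (b + a * I + a * b * S) *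
     ((1 + S + I + 2 * (r * q)) * (1 + I) - (q + r * I + al) * (q + r * I + al)) /
     ((b + a * I) * (1 + I) * b)"
proof -
  have "0 \<le> a" "0 < b"
    using assms by (simp_all add: a_def b_def abs_square_le_1 abs_square_less_1 flip: power2_eq_square)
  then have nz: "b + a * I \<noteq> 0"
    by (smt (verit) I_def mult_nonneg_nonneg zero_le_square)
  have "genie_bound i s al r = (1 + S + I + 2 * (r * q)) * (1 + a * b * S / (b + a * I)) *
     (((1 + S + I + 2 * (r * q)) * (1 + I) - (q + r * I + al) * (q + r * I + al)) / ((1 + I) * b))"
    unfolding genie_bound_def a_def b_def I_def S_def q_def by (simp add: power2_eq_square algebra_simps)
  then show ?thesis
    unfolding one_plus_div[OF nz(1)] by simp
qed

section \<open>Polynomial inequalities, region by region\<close>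

text \<open>The premise of \<open>genie_bound_le_rhs_term\<close> with \<open>r = x * i\<close> and
  the common factor \<open>I\<close> cancelled. The scaling makes the region a box, since
  \<open>r < i\<close> becomes \<open>x < 1\<close>, and lets \<open>I\<close> go down to 0.\<close>

lemma cert_pointwise1:
  fixes I s x :: real
  assumes "(0 \<le> x \<and> x < 2/5 \<and> 0 \<le> I \<and> I < 3/10 \<and> 7/5 \<le> s) \<or>
    (0 \<le> x \<and> x < 1/2 \<and> 3/10 \<le> I \<and> I < 2/5 \<and> 3/2 \<le> s) \<or>
    (0 \<le> x \<and> x < 1/2 \<and> 2/5 \<le> I \<and> I < 1/2 \<and> 20/13 \<le> s) \<or>
    (0 \<le> x \<and> x < 3/5 \<and> 1/2 \<le> I \<and> I < 4/5 \<and> 11/6 \<le> s)"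
  defines "S \<equiv> s * s" and "a \<equiv> 1 - x * x * I"
  defines "F \<equiv> (1 + I) * (1 + I) + S - I - x * x * I * I + 2 * (x * I * s)"
  shows "(x * x * S * (1 - I) + I + a) * (S - I + a * S * S) * (1 + a * I) \<le> a * a * F * S * (S - I)"
proof -
  let ?p = "let x = pX; I = pY; s = pZ; S = s * s; xx = x * x; a = Cst 1 - xx * I;
      F = (Cst 1 + I) * (Cst 1 + I) + S - I - xx * I * I + Cst 2 * (x * I * s) in
     a * a * F * S * (S - I) - (xx * S * (Cst 1 - I) + I + a) * (S - I + a * S * S) * (Cst 1 + a * I)"
  have c1: "nonneg_cert [((0,2),5,5), ((0,3),10,10), ((7,5),5,0)] ?p"
    by code_simp
  have c2: "nonneg_cert [((0,1),2,2), ((3,4),10,10), ((3,2),2,0)] ?p"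
    by code_simp
  have c3: "nonneg_cert [((0,1),2,2), ((4,5),10,10), ((20,13),13,0)] ?p"
    by code_simp
  have c4: "nonneg_cert [((0,3),5,5), ((5,8),10,10), ((11,6),6,0)] ?p"
    by code_simp
  have "0 \<le> ev ?p [x, I, s]"
    using assms(1)
    apply (elim disjE)
    subgoal by (rule nonneg_certI[OF c1]) (auto intro!: in_range_intros)
    subgoal by (rule nonneg_certI[OF c2]) (auto intro!: in_range_intros)
    subgoal by (rule nonneg_certI[OF c3]) (auto intro!: in_range_intros)
    subgoal by (rule nonneg_certI[OF c4]) (auto intro!: in_range_intros)
    done
  then show ?thesis
    by (simp add: Let_def S_def a_def F_def)
qed

text \<open>The variant of \<open>cert_pointwise1\<close> for larger \<open>x\<close>: both sides
  are multiplied by \<open>1 + I\<close>, and \<open>x * x * S * (1 + I)\<close> is replaced by the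
  upper bound that the failure of the pointwise sum comparison provides (\<open>U\<close> in
  \<open>genie_pointwise_small\<close>).\<close>

lemma cert_pointwise0:
  fixes I s x :: real
  assumes "(2/5 \<le> x \<and> x < 1 \<and> 0 \<le> I \<and> I < 3/10 \<and> 7/5 \<le> s) \<or>
    (1/2 \<le> x \<and> x < 1 \<and> 3/10 \<le> I \<and> I < 1/2 \<and> 3/2 \<le> s) \<or>
    (3/5 \<le> x \<and> x < 5/6 \<and> 1/2 \<le> I \<and> I < 4/5 \<and> 11/6 \<le> s)"
  defines "S \<equiv> s * s" and "a \<equiv> 1 - x * x * I"
  defines "F \<equiv> (1 + I) * (1 + I) + S - I - x * x * I * I + 2 * (x * I * s)"
  shows "((1 - I) * (S - I + x * x * I - 2 * (x * s)) + (1 + I) * (I + a)) * (S - I + a * S * S) * (1 + a * I)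
    \<le> a * a * F * S * (S - I) * (1 + I)"
proof -
  let ?p = "let x = pX; I = pY; s = pZ; S = s * s; xx = x * x; a = Cst 1 - xx * I;
      F = (Cst 1 + I) * (Cst 1 + I) + S - I - xx * I * I + Cst 2 * (x * I * s) in
     a * a * F * S * (S - I) * (Cst 1 + I) -
     ((Cst 1 - I) * (S - I + xx * I - Cst 2 * (x * s)) + (Cst 1 + I) * (I + a)) *
     (S - I + a * S * S) * (Cst 1 + a * I)"
  have c1: "nonneg_cert [((2,5),5,5), ((0,3),10,10), ((7,5),5,0)] ?p"
    by code_simp
  have c2: "nonneg_cert [((1,2),2,2), ((3,5),10,10), ((3,2),2,0)] ?p"
    by code_simp
  \<comment> \<open>Common denominator for the range of \<open>x\<close>: \<open>18/30 = 3/5\<close>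
    and \<open>25/30 = 5/6\<close>.\<close>
  have c3: "nonneg_cert [((18,25),30,30), ((5,8),10,10), ((11,6),6,0)] ?p"
    by code_simp
  have "0 \<le> ev ?p [x, I, s]"
    using assms(1)
    apply (elim disjE)
    subgoal by (rule nonneg_certI[OF c1]) (auto intro!: in_range_intros)
    subgoal by (rule nonneg_certI[OF c2]) (auto intro!: in_range_intros)
    subgoal by (rule nonneg_certI[OF c3]) (auto intro!: in_range_intros)
    done
  then show ?thesis
    by (simp add: Let_def S_def a_def F_def)
qed

text \<open>Here \<open>t = r^2 * (1 + I) / I\<close>, so that \<open>t < 1\<close> says
  \<open>r^2 * (1 + I) < I\<close>, and \<open>A = (1 + I) * (1 - r^2)\<close>. The nonnegative term
  \<open>2 * r * q\<close> of the right-hand side is dropped; no square root is left and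
  \<open>S\<close> itself can be a variable.\<close>

lemma cert_pointwise_medium:
  fixes I S t :: real
  assumes "(4/5 \<le> I \<and> I < 201/100 \<and> 9 \<le> S) \<or> (2 \<le> I \<and> (1 + I) * (1 + I) \<le> S)" "0 \<le> t" "t < 1"
  defines "u \<equiv> 1 + I"
  defines "A \<equiv> u - I * t"
  shows "(t * S * (1 - I) + I * u + A) * (u * (S - I) + A * S * S) * (u + A * I) \<le>
    A * A * S * (u * (u * u + S - I) - I * I * t) * (S - I)"
proof -
  let ?p = "\<lambda>S. let I = pX; t = pZ; u = Cst 1 + I; A = u - I * t in
     A * A * S * (u * (u * u + S - I) - I * I * t) * (S - I) -
     (t * S * (Cst 1 - I) + I * u + A) * (u * (S - I) + A * S * S) * (u + A * I)"
  have c1: "nonneg_cert [((80, 201), 100, 100), ((9, 1), 1, 0), ((0, 1), 1, 1)] (?p pY)"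
    by code_simp
  \<comment> \<open>The variable is \<open>S - (1 + I)^2\<close>, which turns the second region into
    a product of intervals.\<close>
  have c2: "nonneg_cert [((2, 1), 1, 0), ((0, 1), 1, 0), ((0, 1), 1, 1)]
      (?p (pY + (Cst 1 + pX) * (Cst 1 + pX)))"
    by code_simp
  from assms(1) show ?thesis
  proof
    assume *: "4/5 \<le> I \<and> I < 201/100 \<and> 9 \<le> S"
    have "0 \<le> ev (?p pY) [I, S, t]"
      by (rule nonneg_certI[OF c1]) (use * assms(2,3) in \<open>auto intro!: in_range_intros\<close>)
    then show ?thesis by (simp add: Let_def u_def A_def)
  next
    assume *: "2 \<le> I \<and> (1 + I) * (1 + I) \<le> S"
    have "0 \<le> ev (?p (pY + (Cst 1 + pX) * (Cst 1 + pX))) [I, S - (1 + I) * (1 + I), t]"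
      by (rule nonneg_certI[OF c2]) (use * assms(2,3) in \<open>auto intro!: in_range_intros\<close>)
    then show ?thesis by (simp add: Let_def u_def A_def)
  qed
qed

lemma cert_sum_small:
  fixes I D :: real
  assumes "0 \<le> I" "I < 1/2" "0 \<le> D" "D < 2"
  defines "S \<equiv> I + D"
  defines "M \<equiv> 1 + S + I"
  shows "(1 + S) * (M * M + I * (1 + S)) * S * (S + D * I) \<le>
    (S + D * I + D * S) * (M + 2 * I) * (S * ((1 + I) * (1 + I) + S + I) - I * I)"
proof -
  have "nonneg_cert [((0, 1), 2, 2), ((0, 2), 1, 1), ((0, 1), 1, 1)]
    (let I = pX; D = pY; S = I + D; M = Cst 1 + S + I in
     (S + D * I + D * S) * (M + Cst 2 * I) * (S * ((Cst 1 + I) * (Cst 1 + I) + S + I) - I * I) -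
     (Cst 1 + S) * (M * M + I * (Cst 1 + S)) * S * (S + D * I))"
    by code_simp
  \<comment> \<open>Certificates have three slots; the value 0 fills the third one for a polynomial
    in two variables.\<close>
  from nonneg_certI[OF this, of I D 0] show ?thesis
    using assms by (simp add: in_range_intros Let_def)
qed

text \<open>The variable \<open>m = s / i\<close> turns conditions on the ratio into a box. The
  terms \<open>5 * M + 2 * q\<close> and its like are five times their values at
  \<open>r = 1/5\<close>, the largest \<open>r\<close> for which this is used.\<close>

lemma cert_crude:
  fixes i m :: real
  assumes "7/10 \<le> i" "i < 3/2" "6/5 \<le> m" "m < 14/5"
  defines "s \<equiv> i * m"
  defines "I \<equiv> i * i" and "S \<equiv> s * s" and "q \<equiv> i * s"
  defines "M \<equiv> 1 + S + I"
  shows "5 * (M * (5 * M + 2 * q) * (5 * ((1 + I) * (1 + I) + S) + 2 * q) * (25 + 16 * I)) \<le>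
    (25 + 16 * (I + S)) * (5 * M + 6 * q) * (25 * ((1 + I) * (1 + I) + S) - 34 * I + 30 * q) * (1 + I)"
proof -
  have "nonneg_cert [((7, 15), 10, 10), ((6, 14), 5, 5), ((0, 1), 1, 1)]
    (let i = pX; s = i * pY; I = i * i; S = s * s; q = i * s; M = Cst 1 + S + I in
     (Cst 25 + Cst 16 * (I + S)) * (Cst 5 * M + Cst 6 * q) *
       (Cst 25 * ((Cst 1 + I) * (Cst 1 + I) + S) - Cst 34 * I + Cst 30 * q) * (Cst 1 + I) -
     Cst 5 * (M * (Cst 5 * M + Cst 2 * q) * (Cst 5 * ((Cst 1 + I) * (Cst 1 + I) + S) + Cst 2 * q) *
       (Cst 25 + Cst 16 * I)))"
    by code_simp
  from nonneg_certI[OF this, of i m 0] show ?thesis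
    using assms by (simp add: in_range_intros Let_def)
qed

lemma cert_sum_medium:
  fixes i s r :: real
  assumes "7/10 \<le> i" "i < 3/2"
    and "(i \<le> s \<and> s < 13/10 * i \<and> 0 \<le> r \<and> r < 1/2) \<or> (2/3 \<le> s \<and> s < 11/6 \<and> 1/5 \<le> r \<and> r < 1/2)"
  defines "I \<equiv> i * i" and "S \<equiv> s * s" and "q \<equiv> i * s" and "a \<equiv> 1 - r * r"
  defines "M \<equiv> 1 + S + I"
  shows "125 * ((1 + a * I + a * S) * (M + 2 * (r * q)) * (1 + a * S) * (1 + I) * (25 + 16 * I)) \<le>
    (25 + 16 * (I + S)) * (5 * M + 6 * q) * (25 * ((1 + I) * (1 + I) + S) - 34 * I + 30 * q) * (1 + a * I)"
proof -
  let ?p = "\<lambda>s. let i = pX; r = pZ; I = i * i; S = s * s; q = i * s; M = Cst 1 + S + I; a = Cst 1 - r * r in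
     (Cst 25 + Cst 16 * (I + S)) * (Cst 5 * M + Cst 6 * q) *
       (Cst 25 * ((Cst 1 + I) * (Cst 1 + I) + S) - Cst 34 * I + Cst 30 * q) * (Cst 1 + a * I) -
     Cst 125 * ((Cst 1 + a * I + a * S) * (M + Cst 2 * (r * q)) * (Cst 1 + a * S) * (Cst 1 + I) *
       (Cst 25 + Cst 16 * I))"
  \<comment> \<open>The first region bounds the ratio \<open>s / i\<close>, so \<open>s\<close> is
    entered as \<open>pX * pY\<close>.\<close>
  have c1: "nonneg_cert [((7, 15), 10, 10), ((10, 13), 10, 10), ((0, 1), 2, 2)] (?p (pX * pY))"
    by code_simp
  have c2: "nonneg_cert [((7, 15), 10, 10), ((4, 11), 6, 6), ((2, 5), 10, 10)] (?p pY)"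
    by code_simp
  from assms(3) show ?thesis
  proof
    assume *: "i \<le> s \<and> s < 13/10 * i \<and> 0 \<le> r \<and> r < 1/2"
    have "0 \<le> ev (?p (pX * pY)) [i, s / i, r]"
      by (rule nonneg_certI[OF c1]) (use * assms(1,2) in \<open>auto intro!: in_range_intros simp: field_simps\<close>)
    moreover have "i * (s / i) = s" using assms(1) by simp
    ultimately show ?thesis by (simp add: Let_def I_def S_def q_def a_def M_def del: times_divide_eq_right)
  next
    assume *: "2/3 \<le> s \<and> s < 11/6 \<and> 1/5 \<le> r \<and> r < 1/2"
    have "0 \<le> ev (?p pY) [i, s, r]"
      by (rule nonneg_certI[OF c2]) (use * assms(1,2) in \<open>auto intro!: in_range_intros\<close>)
    then show ?thesis by (simp add: Let_def I_def S_def q_def a_def M_def)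
  qed
qed

text \<open>The premise of \<open>sum_bound_le_rhs_term\<close>. It is used contrapositively: where
  that premise fails, \<open>r\<close> must lie below 1/2 in the first box and below 3/5 in the
  second.\<close>

lemma cert_pointwise_sum:
  fixes i s r :: real
  assumes "(7/10 \<le> i \<and> i < 3/2 \<and> 2/3 \<le> s \<and> s < 11/6 \<and> 1/2 \<le> r \<and> r < 1) \<or>
    (8/9 \<le> i \<and> i < 13/9 \<and> 11/6 \<le> s \<and> s < 3 \<and> 3/5 \<le> r \<and> r < 1)"
  shows "(s * s - i * i) * (i * i - r * r) \<le> 2 * (r * (i * s)) + r * r * (s * s) * (i * i)"
proof -
  let ?p = "let i = pX; s = pY; r = pZ in
    Cst 2 * (r * (i * s)) + r * r * (s * s) * (i * i) - (s * s - i * i) * (i * i - r * r)"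
  have c1: "nonneg_cert [((7, 15), 10, 10), ((4, 11), 6, 6), ((1, 2), 2, 2)] ?p"
    by code_simp
  have c2: "nonneg_cert [((8, 13), 9, 9), ((11, 18), 6, 6), ((3, 5), 5, 5)] ?p"
    by code_simp
  have "0 \<le> ev ?p [i, s, r]"
    using assms
    apply (elim disjE)
    subgoal by (rule nonneg_certI[OF c1]) (auto intro!: in_range_intros)
    subgoal by (rule nonneg_certI[OF c2]) (auto intro!: in_range_intros)
    done
  then show ?thesis by (simp add: Let_def)
qed

text \<open>The numbers belong to \<open>al = 2/5\<close> and to the right-hand side at 3/5, cleared
  of denominators: \<open>1 - (2/5)^2 = 21/25\<close>, \<open>1 - (3/5)^2 = 16/25\<close> and
  \<open>1 + (3/5)^2 = 34/25\<close>.\<close>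

lemma cert_genie:
  fixes i s r :: real
  assumes "(8/9 \<le> i \<and> i < 13/9 \<and> 11/6 \<le> s \<and> s < 3 \<and> 0 \<le> r \<and> r < 3/5) \<or>
    (7/5 \<le> i \<and> i \<le> s \<and> s < 1 + i * i \<and> 0 \<le> r \<and> r < 1)"
  defines "I \<equiv> i * i" and "S \<equiv> s * s" and "q \<equiv> i * s" and "a \<equiv> 1 - r * r"
  defines "M \<equiv> 1 + S + I"
  shows "125 * ((M + 2 * (r * q)) * (21 + 25 * (a * I) + 21 * (a * S)) *
      (25 * ((M + 2 * (r * q)) * (1 + I)) - (5 * (q + r * I) + 2) * (5 * (q + r * I) + 2)) * (25 + 16 * I)) \<le>
    (25 + 16 * (I + S)) * (5 * M + 6 * q) * (25 * ((1 + I) * (1 + I) + S) - 34 * I + 30 * q) *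
      ((21 + 25 * (a * I)) * 21)"
proof -
  let ?p = "\<lambda>s. let i = pX; r = pZ; I = i * i; S = s * s; q = i * s; M = Cst 1 + S + I; a = Cst 1 - r * r;
      T = M + Cst 2 * (r * q); v = Cst 5 * (q + r * I) + Cst 2; d = Cst 25 + Cst 16 * I in
     (Cst 25 + Cst 16 * (I + S)) * (Cst 5 * M + Cst 6 * q) *
       (Cst 25 * ((Cst 1 + I) * (Cst 1 + I) + S) - Cst 34 * I + Cst 30 * q) *
       ((Cst 21 + Cst 25 * (a * I)) * Cst 21) -
     Cst 125 * (T * (Cst 21 + Cst 25 * (a * I) + Cst 21 * (a * S)) * (Cst 25 * (T * (Cst 1 + I)) - v * v) * d)"
  \<comment> \<open>The interval from \<open>i\<close> to \<open>1 + i * i\<close> is parametrized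
    by a number in \<open>[0, 1)\<close>.\<close>
  let ?s = "pX + (Cst 1 + pX * pX - pX) * pY"
  have c1: "nonneg_cert [((8, 13), 9, 9), ((11, 15), 6, 6), ((0, 3), 5, 5)] (?p pY)"
    by code_simp
  have c2: "nonneg_cert [((8, 13), 9, 9), ((5, 6), 2, 2), ((0, 2), 5, 5)] (?p pY)"
    by code_simp
  have c3: "nonneg_cert [((8, 13), 9, 9), ((5, 6), 2, 2), ((2, 3), 5, 5)] (?p pY)"
    by code_simp
  have c4: "nonneg_cert [((7, 5), 5, 0), ((0, 1), 1, 1), ((0, 3), 5, 5)] (?p ?s)"
    by code_simp
  have c5: "nonneg_cert [((7, 5), 5, 0), ((0, 1), 1, 1), ((3, 5), 5, 5)] (?p ?s)"
    by code_simp
  from assms(1) show ?thesis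
  proof
    assume *: "8/9 \<le> i \<and> i < 13/9 \<and> 11/6 \<le> s \<and> s < 3 \<and> 0 \<le> r \<and> r < 3/5"
    have "0 \<le> ev (?p pY) [i, s, r]"
    proof (cases "s < 5/2")
      case True
      show ?thesis
        by (rule nonneg_certI[OF c1]) (use * True in \<open>auto intro!: in_range_intros\<close>)
    next
      case False
      show ?thesis
      proof (cases "r < 2/5")
        case True
        show ?thesis
          by (rule nonneg_certI[OF c2]) (use * True False in \<open>auto intro!: in_range_intros\<close>)
      next
        case r: False
        show ?thesis
          by (rule nonneg_certI[OF c3]) (use * r False in \<open>auto intro!: in_range_intros\<close>)
      qed
    qed
    then show ?thesis by (simp add: Let_def I_def S_def q_def a_def M_def)
  next
    assume *: "7/5 \<le> i \<and> i \<le> s \<and> s < 1 + i * i \<and> 0 \<le> r \<and> r < 1"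
    define z where "z = (s - i) / (1 + i * i - i)"
    have pos: "0 < 1 + i * i - i" using * by linarith
    have z: "0 \<le> z" "z < 1" and s: "i + (1 + i * i - i) * z = s"
      using * pos by (auto simp: z_def field_simps)
    have "0 \<le> ev (?p ?s) [i, z, r]"
    proof (cases "r < 3/5")
      case True
      show ?thesis
        by (rule nonneg_certI[OF c4]) (use * z True in \<open>auto intro!: in_range_intros\<close>)
    next
      case False
      show ?thesis
        by (rule nonneg_certI[OF c5]) (use * z False in \<open>auto intro!: in_range_intros\<close>)
    qed
    then show ?thesis by (simp add: Let_def I_def S_def q_def a_def M_def s)
  qed
qed

section \<open>From polynomial inequalities to comparisons of the bounds\<close>

lemma le_if_diff_eq: "x - y = p - q \<Longrightarrow> q \<le> p \<Longrightarrow> y \<le> (x::real)"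
  by linarith

lemma one_minus_square_nonneg: "\<bar>r\<bar> \<le> 1 \<Longrightarrow> 0 \<le> 1 - r * (r::real)"
  by (simp add: abs_square_le_1 flip: power2_eq_square)

text \<open>Two of the three factors agree, so \<open>1 + (1 - r^2) * S\<close> has to be compared
  with the third factor of the claim; after multiplication by \<open>1 + I\<close> this is exactly
  the last premise.\<close>

lemma sum_bound_le_rhs_term:
  fixes i s r :: real
  assumes "0 \<le> i" "0 \<le> s" "0 \<le> r" "r \<le> 1"
    and "(s * s - i * i) * (i * i - r * r) \<le> 2 * (r * (i * s)) + r * r * (s * s) * (i * i)"
  shows "sum_bound i s r \<le> rhs_term i s r"
proof -
  define I S a q where d: "I = i * i" "S = s * s" "a = 1 - r * r" "q = i * s"
  have a: "0 \<le> a" using one_minus_square_nonneg[of r] assms by (simp add: d)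
  have nn: "0 \<le> I" "0 \<le> S" "0 \<le> q" using assms by (auto simp: d)
  have "(1 + a * S) * (1 + I) \<le> (1 + I) * (1 + I) + S - (1 + r * r) * I + 2 * (r * q)"
    using assms(5) by (simp add: d algebra_simps)
  then have "(1 + a * I + a * S) * (1 + S + I + 2 * (r * q)) * ((1 + a * S) * (1 + I)) \<le>
    (1 + a * I + a * S) * (1 + S + I + 2 * (r * q)) *
      ((1 + I) * (1 + I) + S - (1 + r * r) * I + 2 * (r * q))"
    using a nn assms by (intro mult_left_mono) auto
  from mult_right_mono[OF this, of "1 + a * I"]
  have "(1 + a * I + a * S) * (1 + S + I + 2 * (r * q)) * (1 + a * S) * ((1 + a * I) * (1 + I)) \<le>
    (1 + a * I + a * S) * (1 + S + I + 2 * (r * q)) *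
      ((1 + I) * (1 + I) + S - (1 + r * r) * I + 2 * (r * q)) * (1 + a * I)"
    using a nn by (simp add: mult_ac)
  moreover have "\<bar>r\<bar> \<le> 1" using assms by auto
  ultimately show ?thesis
    using a nn unfolding sum_bound_eq[OF \<open>\<bar>r\<bar> \<le> 1\<close>] rhs_term_eq[OF \<open>\<bar>r\<bar> \<le> 1\<close>] d
    by (intro frac_leI) (auto intro!: mult_pos_pos add_pos_nonneg)
qed

text \<open>The factor \<open>1 + S + I + 2 * r * q\<close> is common to both sides. The choice
  \<open>al = i / s\<close> gives \<open>s * al = i\<close> and
  \<open>S * (1 - al^2) = S - I\<close>, so multiplication by \<open>S\<close> makes everything
  polynomial in \<open>i\<close>, \<open>s\<close> and \<open>r\<close>.\<close>

lemma genie_bound_le_rhs_term: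
  fixes i s r :: real
  assumes "0 < i" "i < s" "0 \<le> r" "r \<le> 1"
  defines "I \<equiv> i * i" and "S \<equiv> s * s" and "a \<equiv> 1 - r * r" and "q \<equiv> i * s"
  assumes le: "(r * r * S * (1 - I) + I * (I + a)) * ((S - I + a * S * S) * (1 + a * I)) \<le>
    a * a * I * ((1 + I) * (1 + I) + S - (1 + r * r) * I + 2 * (r * q)) * S * (S - I)"
  shows "genie_bound i s (i / s) r \<le> rhs_term i s r"
proof -
  have a: "0 \<le> a" using one_minus_square_nonneg[of r] assms by (simp add: a_def)
  have nn: "0 < I" "0 < S" "0 < q" "I < S"
    using assms by (auto simp: I_def S_def q_def intro!: mult_strict_mono)
  define al where "al = i / s"
  define b where "b = 1 - al * al"
  have al: "\<bar>al\<bar> < 1" using assms(1,2) by (simp add: al_def)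
  have sal: "s * al = i" using assms by (simp add: al_def)
  have Sb: "S * b = S - I"
  proof -
    have "S * (al * al) = (s * al) * (s * al)" by (simp add: S_def)
    then have "S * (al * al) = I" by (simp only: sal I_def)
    then show ?thesis by (simp add: b_def right_diff_distrib)
  qed
  then have b: "0 < b" using nn by (metis diff_gt_0_iff_gt zero_less_mult_pos)
  define T where "T = 1 + S + I + 2 * (r * q)"
  define F where "F = (1 + I) * (1 + I) + S - (1 + r * r) * I + 2 * (r * q)"
  define n where "n = T * (1 + I) - (q + r * I + al) * (q + r * I + al)"
  define V where "V = r * r * S * (1 - I) + I * (I + a)"
  have T: "0 \<le> T" using nn assms by (simp add: T_def)
  have "S * ((q + r * I + al) * (q + r * I + al)) = (s * (q + r * I) + s * al) * (s * (q + r * I) + s * al)"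
    by (simp add: S_def algebra_simps)
  also have "\<dots> = (s * (q + r * I) + i) * (s * (q + r * I) + i)" by (simp add: sal)
  \<comment> \<open>\<open>F\<close> is the claimed third factor times \<open>1 + I\<close>. Hence
    \<open>n / b = F + I * V / (S - I)\<close>, and this excess has to be covered by what the middle
    factor gains.\<close>
  finally have Sn: "S * n = (S - I) * F + I * V"
    unfolding n_def right_diff_distrib T_def F_def V_def
    unfolding S_def I_def q_def a_def by algebra
  have "(S - I + a * S * S) * (1 + a * I) * (S * n) \<le> (1 + a * I + a * S) * (S - I + a * I * S) * ((S - I) * F)"
  proof -
    have "I * (V * ((S - I + a * S * S) * (1 + a * I))) \<le> I * (a * a * I * F * S * (S - I))"
      using le nn unfolding V_def F_def by (intro mult_left_mono) auto
    show ?thesis unfolding Sn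
    \<comment> \<open>That gain is explicit:
      \<open>(1 + a * I + a * S) * (S - I + a * I * S)\<close> exceeds
      \<open>(S - I + a * S * S) * (1 + a * I)\<close> by exactly
      \<open>a * a * I * I * S\<close>.\<close>
    proof (rule le_if_diff_eq)
      show "(1 + a * I + a * S) * (S - I + a * I * S) * ((S - I) * F) -
        (S - I + a * S * S) * (1 + a * I) * ((S - I) * F + I * V) =
      I * (a * a * I * F * S * (S - I)) - I * (V * ((S - I + a * S * S) * (1 + a * I)))"
      by algebra
    qed fact
  qed
  moreover have "S * (b + a * I + a * b * S) = S - I + a * S * S"
    "S * (b + a * I) = S - I + a * I * S"
    using Sb by algebra+
  ultimately have "(S * (b + a * I + a * b * S)) * (1 + a * I) * (S * n) \<le>
      (1 + a * I + a * S) * (S * (b + a * I)) * ((S * b) * F)"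
    by (simp add: Sb)
  then have "(S * S) * ((b + a * I + a * b * S) * (1 + a * I) * n) \<le>
      (S * S) * ((1 + a * I + a * S) * (b + a * I) * (b * F))"
    by (simp add: mult_ac)
  then have "(b + a * I + a * b * S) * (1 + a * I) * n \<le> (1 + a * I + a * S) * (b + a * I) * (b * F)"
    using nn by (simp only: mult_le_cancel_left_pos mult_pos_pos)
  then have "T * (1 + I) * ((b + a * I + a * b * S) * (1 + a * I) * n) \<le>
      T * (1 + I) * ((1 + a * I + a * S) * (b + a * I) * (b * F))"
    using T nn by (intro mult_left_mono) auto
  then have "T * (b + a * I + a * b * S) * n * ((1 + a * I) * (1 + I)) \<le>
      (1 + a * I + a * S) * T * F * ((b + a * I) * (1 + I) * b)"
    by (simp add: mult_ac)
  then have "T * (b + a * I + a * b * S) * n / ((b + a * I) * (1 + I) * b) \<le>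
      (1 + a * I + a * S) * T * F / ((1 + a * I) * (1 + I))"
    using a nn b by (intro frac_leI) (auto intro!: mult_pos_pos add_pos_nonneg)
  moreover have "\<bar>r\<bar> \<le> 1" using assms by auto
  ultimately show ?thesis
    using genie_bound_eq[OF \<open>\<bar>r\<bar> \<le> 1\<close> al, of i s] rhs_term_eq[OF \<open>\<bar>r\<bar> \<le> 1\<close>, of i s]
    unfolding al_def[symmetric] T_def F_def n_def b_def a_def I_def S_def q_def by simp
qed

text \<open>With \<open>I * t = r * r * u\<close> and \<open>A = u * a\<close>, the certified
  inequality times \<open>I\<close> is the premise of \<open>genie_bound_le_rhs_term\<close> times
  \<open>u^3\<close>, except for the dropped term \<open>2 * r * q\<close>.\<close>

lemma genie_pointwise_medium:
  fixes i s r :: real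
  assumes "(4/5 \<le> i * i \<and> i * i < 201/100 \<and> 9 \<le> s * s) \<or> (2 \<le> i * i \<and> (1 + i * i) * (1 + i * i) \<le> s * s)"
    and "0 < i" "i < s" "0 \<le> r" "r \<le> 1" "r * r * (1 + i * i) < i * i"
  shows "genie_bound i s (i / s) r \<le> rhs_term i s r"
proof -
  define I S a q where d: "I = i * i" "S = s * s" "a = 1 - r * r" "q = i * s"
  define u where "u = 1 + I"
  define t where "t = r * r * u / I"
  have nn: "0 < I" "0 < S" "0 < q" "I < S" "0 < u"
    using assms by (auto simp: d u_def intro!: mult_strict_mono add_pos_pos)
  have It: "I * t = r * r * u" using nn by (simp add: t_def)
  have "0 \<le> r * r * u" "r * r * u < I"
    using nn assms(6) unfolding u_def d by simp_all
  then have t: "0 \<le> t" "t < 1" using nn by (simp_all add: t_def)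
  have reg: "(4/5 \<le> I \<and> I < 201/100 \<and> 9 \<le> S) \<or> (2 \<le> I \<and> (1 + I) * (1 + I) \<le> S)"
    using assms(1) unfolding d .
  define A where "A = u - I * t"
  have A: "A = u * a" unfolding A_def It d(3) by algebra
  define F where "F = u * u + S - I - r * r * I"
  define V where "V = r * r * S * (1 - I) + I * (I + a)"
  have "(t * S * (1 - I) + I * u + A) * (u * (S - I) + A * S * S) * (u + A * I) \<le>
    A * A * S * (u * (u * u + S - I) - I * I * t) * (S - I)"
    unfolding A_def u_def by (rule cert_pointwise_medium[OF reg t])
  then have "I * ((t * S * (1 - I) + I * u + A) * (u * (S - I) + A * S * S) * (u + A * I)) \<le>
    I * (A * A * S * (u * (u * u + S - I) - I * I * t) * (S - I))"
    using nn by (intro mult_left_mono) auto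
  moreover have "I * ((t * S * (1 - I) + I * u + A) * (u * (S - I) + A * S * S) * (u + A * I)) =
     (I * t * S * (1 - I) + I * I * u + I * A) * (u * (S - I) + A * S * S) * (u + A * I)"
    by algebra
  moreover have "\<dots> = u * u * u * (V * ((S - I + a * S * S) * (1 + a * I)))"
    unfolding It A V_def u_def by algebra
  moreover have "I * (A * A * S * (u * (u * u + S - I) - I * I * t) * (S - I)) =
     u * u * u * (a * a * I * F * S * (S - I))"
    unfolding It mult.assoc[of I I t] A F_def by algebra
  ultimately have "u * u * u * (V * ((S - I + a * S * S) * (1 + a * I))) \<le>
     u * u * u * (a * a * I * F * S * (S - I))"
    by simp
  moreover have "0 < u * u * u" using nn by simp
  ultimately have "V * ((S - I + a * S * S) * (1 + a * I)) \<le> a * a * I * F * S * (S - I)"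
    using mult_le_cancel_left_pos by blast
  also have "\<dots> \<le> a * a * I * ((1 + I) * (1 + I) + S - (1 + r * r) * I + 2 * (r * q)) * S * (S - I)"
    using nn assms by (intro mult_right_mono mult_left_mono) (auto simp: F_def u_def algebra_simps)
  finally show ?thesis
    using assms by (intro genie_bound_le_rhs_term) (auto simp: V_def d)
qed

text \<open>The hypothesis \<open>h\<close> confines \<open>r\<close>: this is the part of the
  parameter range in which the sum bound does not already give the claim pointwise. For small
  \<open>x = r / i\<close> the plain certificate is enough, for larger \<open>x\<close> the
  restriction enters through \<open>U\<close>.\<close>

lemma genie_pointwise_small:
  fixes i s r :: real
  assumes reg: "(0 \<le> i * i \<and> i * i < 3/10 \<and> 7/5 \<le> s) \<or> (3/10 \<le> i * i \<and> i * i < 2/5 \<and> 3/2 \<le> s) \<or>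
      (2/5 \<le> i * i \<and> i * i < 1/2 \<and> 20/13 \<le> s) \<or> (1/2 \<le> i * i \<and> i * i < 4/5 \<and> 11/6 \<le> s)"
    and "0 < i" "i < s" "0 \<le> r" "r \<le> 1" "r < i"
    and h: "2 * (r * (i * s)) + r * r * (s * s) * (i * i) \<le> (s * s - i * i) * (i * i - r * r)"
  shows "genie_bound i s (i / s) r \<le> rhs_term i s r"
proof -
  define x where "x = r / i"
  have r: "r = x * i" using assms by (simp add: x_def)
  have x: "0 \<le> x" "x < 1" using assms by (auto simp: x_def)
  define I S where d: "I = i * i" "S = s * s"
  define a where "a = 1 - x * x * I"
  define F where "F = (1 + I) * (1 + I) + S - I - x * x * I * I + 2 * (x * I * s)"
  define W where "W = (S - I + a * S * S) * (1 + a * I)"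
  have nn: "0 < I" "0 < S" "I < S"
    using assms by (auto simp: d intro!: mult_strict_mono)
  have a: "a = 1 - r * r" by (simp add: a_def r d algebra_simps)
  have "0 \<le> a" using one_minus_square_nonneg[of r] assms by (simp add: a)
  then have W: "0 \<le> W" using nn by (simp add: W_def)
  \<comment> \<open>This is \<open>h\<close> rewritten in \<open>x\<close>, with a factor
    \<open>I\<close> on both sides.\<close>
  have "I * (x * x * S * (1 + I)) \<le> I * (S - I + x * x * I - 2 * (x * s))"
    using h unfolding r d by (simp add: algebra_simps)
  then have U: "x * x * S * (1 + I) \<le> S - I + x * x * I - 2 * (x * s)"
    using nn by simp
  have I1: "I < 1" using reg by (auto simp: d)
  \<comment> \<open>Otherwise \<open>x^2 * (1 + I)\<close> is at least
    \<open>25/36 * 3/2 > 1\<close>, and \<open>U\<close> would bound \<open>S\<close> by something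
    smaller than \<open>S\<close>.\<close>
  have x56: "x < 5/6" if "1/2 \<le> I"
  proof (rule ccontr)
    assume "\<not> x < 5/6"
    then have "25/36 \<le> x * x" using mult_mono[of "5/6" x "5/6" x] by simp
    then have "25/36 * (3/2) \<le> x * x * (1 + I)" using that by (intro mult_mono) auto
    then have "S * 1 \<le> S * (x * x * (1 + I))" using nn by (intro mult_left_mono) auto
    then have "S \<le> S - I + x * x * I - 2 * (x * s)" using U by (simp add: mult_ac)
    moreover have "x * x * I \<le> 1 * I" using x nn by (intro mult_right_mono) (auto intro: mult_le_one)
    moreover have "0 < x * s" using \<open>\<not> x < 5/6\<close> assms(2,3) by simp
    ultimately show False by simp
  qed
  have "(x * x * S * (1 - I) + I + a) * W \<le> a * a * F * S * (S - I)"
    (is ?P)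
  proof -
    have P1: ?P if "(0 \<le> x \<and> x < 2/5 \<and> 0 \<le> I \<and> I < 3/10 \<and> 7/5 \<le> s) \<or>
      (0 \<le> x \<and> x < 1/2 \<and> 3/10 \<le> I \<and> I < 2/5 \<and> 3/2 \<le> s) \<or>
      (0 \<le> x \<and> x < 1/2 \<and> 2/5 \<le> I \<and> I < 1/2 \<and> 20/13 \<le> s) \<or>
      (0 \<le> x \<and> x < 3/5 \<and> 1/2 \<le> I \<and> I < 4/5 \<and> 11/6 \<le> s)"
      using cert_pointwise1[OF that] unfolding W_def a_def F_def d(2) by (simp only: mult.assoc)
    have P0: ?P if "(2/5 \<le> x \<and> x < 1 \<and> 0 \<le> I \<and> I < 3/10 \<and> 7/5 \<le> s) \<or>
      (1/2 \<le> x \<and> x < 1 \<and> 3/10 \<le> I \<and> I < 1/2 \<and> 3/2 \<le> s) \<or>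
      (3/5 \<le> x \<and> x < 5/6 \<and> 1/2 \<le> I \<and> I < 4/5 \<and> 11/6 \<le> s)"
    proof -
      have "((x * x * S * (1 - I) + I + a) * W) * (1 + I) =
          ((1 - I) * (x * x * S * (1 + I)) + (1 + I) * (I + a)) * W"
        by (simp add: algebra_simps)
      also have "\<dots> \<le> ((1 - I) * (S - I + x * x * I - 2 * (x * s)) + (1 + I) * (I + a)) * W"
        using W I1 U by (intro mult_right_mono add_right_mono mult_left_mono) auto
      also have "\<dots> \<le> a * a * F * S * (S - I) * (1 + I)"
        using cert_pointwise0[OF that] unfolding W_def a_def F_def d(2) by (simp only: mult.assoc)
      finally have "((x * x * S * (1 - I) + I + a) * W) * (1 + I) \<le> a * a * F * S * (S - I) * (1 + I)" .
      then show ?thesis using nn mult_le_cancel_right_pos[of "1 + I"] by auto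
    qed
    from reg consider "0 \<le> I" "I < 3/10" "7/5 \<le> s" | "3/10 \<le> I" "I < 2/5" "3/2 \<le> s"
      | "2/5 \<le> I" "I < 1/2" "20/13 \<le> s" | "1/2 \<le> I" "I < 4/5" "11/6 \<le> s"
      unfolding d by blast
    then show ?P
    proof cases
      case 1
      then show ?thesis using x by (cases "x < 2/5") (auto intro: P0 P1)
    next
      case 2
      then show ?thesis using x by (cases "x < 1/2") (auto intro: P0 P1)
    next
      case 3
      then show ?thesis using x by (cases "x < 1/2") (auto intro: P0 P1)
    next
      case 4
      then show ?thesis using x x56 by (cases "x < 3/5") (auto intro: P0 P1)
    qed
  qed
  then have "I * ((x * x * S * (1 - I) + I + a) * W) \<le> I * (a * a * F * S * (S - I))"
    using nn by (intro mult_left_mono) auto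
  then have "(r * r * S * (1 - I) + I * (I + a)) * W \<le>
      a * a * I * ((1 + I) * (1 + I) + S - (1 + r * r) * I + 2 * (r * (i * s))) * S * (S - I)"
  proof -
    have "I * ((x * x * S * (1 - I) + I + a) * W) = (r * r * S * (1 - I) + I * (I + a)) * W"
      unfolding r d by algebra
    moreover have "I * (a * a * F * S * (S - I)) =
      a * a * I * ((1 + I) * (1 + I) + S - (1 + r * r) * I + 2 * (r * (i * s))) * S * (S - I)"
      unfolding F_def r d by algebra
    ultimately show ?thesis
      using \<open>I * ((x * x * S * (1 - I) + I + a) * W) \<le> I * (a * a * F * S * (S - I))\<close> by (simp only:)
  qed
  then show ?thesis
    using assms by (intro genie_bound_le_rhs_term) (auto simp: W_def a d)
qed

lemma rhs_term_three_fifths: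
  fixes i s :: real
  defines "I \<equiv> i * i" and "S \<equiv> s * s" and "q \<equiv> i * s"
  shows "rhs_term i s (3/5) = (25 + 16 * (I + S)) * (5 * (1 + S + I) + 6 * q) *
     (25 * ((1 + I) * (1 + I) + S) - 34 * I + 30 * q) / (125 * ((25 + 16 * I) * (1 + I)))"
proof -
  have num: "1 - 3/5 * (3/5) = (16/25::real)" "1 + 3/5 * (3/5) = (34/25::real)"
    by simp_all
  have I: "0 \<le> I" by (simp add: I_def)
  have "(1 + 16/25 * I + 16/25 * S) * (1 + S + I + 2 * (3/5 * q)) *
      ((1 + I) * (1 + I) + S - 34/25 * I + 2 * (3/5 * q)) / ((1 + 16/25 * I) * (1 + I)) =
    (25 + 16 * (I + S)) * (5 * (1 + S + I) + 6 * q) *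
      (25 * ((1 + I) * (1 + I) + S) - 34 * I + 30 * q) / (125 * ((25 + 16 * I) * (1 + I)))"
  proof (subst frac_eq_eq)
    show "(1 + 16/25 * I) * (1 + I) \<noteq> 0" "125 * ((25 + 16 * I) * (1 + I)) \<noteq> 0" using I by auto
  qed algebra
  then show ?thesis
    using rhs_term_eq[of "3/5" i s] unfolding I_def[symmetric] S_def[symmetric] q_def[symmetric] num by simp
qed

lemma sum_bound_le_fixed:
  fixes i s r :: real
  assumes "7/10 \<le> i" "i < 3/2"
    and "(i \<le> s \<and> s < 13/10 * i \<and> 0 \<le> r \<and> r < 1/2) \<or> (2/3 \<le> s \<and> s < 11/6 \<and> 1/5 \<le> r \<and> r < 1/2)"
  shows "sum_bound i s r \<le> rhs_term i s (3/5)"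
proof -
  define I S a q where d: "I = i * i" "S = s * s" "a = 1 - r * r" "q = i * s"
  have r: "\<bar>r\<bar> \<le> 1" "0 \<le> a" using assms(3) one_minus_square_nonneg[of r] by (auto simp: d)
  have nn: "0 \<le> I" "0 \<le> S" by (simp_all add: d)
  have "(1 + a * I + a * S) * (1 + S + I + 2 * (r * q)) * (1 + a * S) / (1 + a * I) \<le>
      (25 + 16 * (I + S)) * (5 * (1 + S + I) + 6 * q) * (25 * ((1 + I) * (1 + I) + S) - 34 * I + 30 * q) /
      (125 * ((25 + 16 * I) * (1 + I)))"
  proof (rule frac_leI)
    show "(1 + a * I + a * S) * (1 + S + I + 2 * (r * q)) * (1 + a * S) * (125 * ((25 + 16 * I) * (1 + I))) \<le>
      (25 + 16 * (I + S)) * (5 * (1 + S + I) + 6 * q) * (25 * ((1 + I) * (1 + I) + S) - 34 * I + 30 * q) * (1 + a * I)"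
      using cert_sum_medium[OF assms] unfolding d by (simp only: mult_ac)
  qed (use nn r in \<open>auto intro!: add_pos_nonneg mult_pos_pos\<close>)
  then show ?thesis
    unfolding sum_bound_eq[OF r(1)] rhs_term_three_fifths d .
qed

lemma genie_bound_le_fixed:
  fixes i s r :: real
  assumes "(8/9 \<le> i \<and> i < 13/9 \<and> 11/6 \<le> s \<and> s < 3 \<and> 0 \<le> r \<and> r < 3/5) \<or>
    (7/5 \<le> i \<and> i \<le> s \<and> s < 1 + i * i \<and> 0 \<le> r \<and> r < 1)"
  shows "genie_bound i s (2/5) r \<le> rhs_term i s (3/5)"
proof -
  define I S a q where d: "I = i * i" "S = s * s" "a = 1 - r * r" "q = i * s"
  have r: "\<bar>r\<bar> \<le> 1" "0 \<le> a" using assms one_minus_square_nonneg[of r] by (auto simp: d)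
  have nn: "0 \<le> I" "0 \<le> S" by (simp_all add: d)
  define T where "T = 1 + S + I + 2 * (r * q)"
  define N where "N = 25 * (T * (1 + I)) - (5 * (q + r * I) + 2) * (5 * (q + r * I) + 2)"
  have e: "1 - 2/5 * (2/5) + a * I = (21 + 25 * (a * I)) / 25"
    "1 - 2/5 * (2/5) + a * I + a * (1 - 2/5 * (2/5)) * S = (21 + 25 * (a * I) + 21 * (a * S)) / (25::real)"
    "T * (1 + I) - (q + r * I + 2/5) * (q + r * I + 2/5) = N / 25"
    by (simp_all add: N_def algebra_simps)
  have "genie_bound i s (2/5) r = T * (21 + 25 * (a * I) + 21 * (a * S)) * N /
      ((21 + 25 * (a * I)) * 21 * (1 + I))"
  proof -
    have "genie_bound i s (2/5) r = T * ((21 + 25 * (a * I) + 21 * (a * S)) / 25) * (N / 25) /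
      ((21 + 25 * (a * I)) / 25 * (1 + I) * (21/25))"
      using genie_bound_eq[OF r(1), of "2/5" i s] unfolding d[symmetric] T_def[symmetric] e by simp
    also have "\<dots> = T * (21 + 25 * (a * I) + 21 * (a * S)) * N / ((21 + 25 * (a * I)) * 21 * (1 + I))"
    proof (subst frac_eq_eq)
      have "0 < 21 + 25 * (a * I)" using nn r by (simp add: add_pos_nonneg)
      then show "(21 + 25 * (a * I)) / 25 * (1 + I) * (21/25) \<noteq> 0" "(21 + 25 * (a * I)) * 21 * (1 + I) \<noteq> 0"
        using nn by auto
    qed algebra
    finally show ?thesis .
  qed
  moreover have "T * (21 + 25 * (a * I) + 21 * (a * S)) * N / ((21 + 25 * (a * I)) * 21 * (1 + I)) \<le>
      (25 + 16 * (I + S)) * (5 * (1 + S + I) + 6 * q) * (25 * ((1 + I) * (1 + I) + S) - 34 * I + 30 * q) /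
      (125 * ((25 + 16 * I) * (1 + I)))"
  proof (rule frac_leI)
    have "125 * (T * (21 + 25 * (a * I) + 21 * (a * S)) * N * (25 + 16 * I)) * (1 + I) \<le>
      (25 + 16 * (I + S)) * (5 * (1 + S + I) + 6 * q) * (25 * ((1 + I) * (1 + I) + S) - 34 * I + 30 * q) *
      ((21 + 25 * (a * I)) * 21) * (1 + I)"
      using cert_genie[OF assms] nn unfolding N_def T_def d by (intro mult_right_mono) auto
    then show "T * (21 + 25 * (a * I) + 21 * (a * S)) * N * (125 * ((25 + 16 * I) * (1 + I))) \<le>
      (25 + 16 * (I + S)) * (5 * (1 + S + I) + 6 * q) * (25 * ((1 + I) * (1 + I) + S) - 34 * I + 30 * q) *
      ((21 + 25 * (a * I)) * 21 * (1 + I))"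
      by (simp only: mult_ac)
  qed (use nn r in \<open>auto intro!: add_pos_nonneg mult_pos_pos\<close>)
  ultimately show ?thesis
    unfolding rhs_term_three_fifths d by simp
qed

text \<open>For \<open>r <= 1/5\<close> the dependence on \<open>r\<close> is given away:
  \<open>1 - r^2\<close> is raised to 1 in the middle factor, \<open>2 * r * q\<close> is raised to
  \<open>2 * q / 5\<close>, and the negative term \<open>r^2 * I^2\<close> is dropped. What remains
  is an inequality in \<open>i\<close> and \<open>s / i\<close>.\<close>

lemma genie_bound_zero_le_fixed:
  fixes i s r :: real
  assumes "7/10 \<le> i" "i < 3/2" "6/5 * i \<le> s" "s < 14/5 * i" "0 \<le> r" "r \<le> 1/5"
  shows "genie_bound i s 0 r \<le> rhs_term i s (3/5)"
proof -
  define I S a q where d: "I = i * i" "S = s * s" "a = 1 - r * r" "q = i * s"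
  have r: "\<bar>r\<bar> \<le> 1" "0 \<le> a" "a \<le> 1" using assms one_minus_square_nonneg[of r] by (auto simp: d)
  have nn: "0 \<le> I" "0 \<le> S" "0 \<le> q" using assms by (simp_all add: d)
  define M T where "M = 1 + S + I" and "T = M + 2 * (r * q)"
  define N where "N = T * (1 + I) - (q + r * I) * (q + r * I)"
  define G where "G = 5 * ((1 + I) * (1 + I) + S) + 2 * q"
  have rq: "5 * (r * q) \<le> q" using mult_right_mono[of r "1/5" q] nn assms by simp
  have "0 \<le> r * q" using nn assms by simp
  then have T: "0 \<le> T" using nn unfolding T_def M_def by linarith
  have T': "5 * T \<le> 5 * M + 2 * q" 
    unfolding T_def using rq by (simp add: algebra_simps)
  have n: "5 * N \<le> G"
  proof -
    have e: "N = (1 + I) * (1 + I) + S + 2 * (r * q) - (r * I) * (r * I)"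
      unfolding N_def T_def M_def d by algebra
    have gen: "5 * (x + S + 2 * p - y) \<le> 5 * (x + S) + 2 * q" if "5 * p \<le> q" "0 \<le> y" for x p y :: real
      using that by simp
    show ?thesis unfolding G_def e by (rule gen[OF rq]) simp
  qed
  have G: "0 \<le> G" using nn by (simp add: G_def)
  have "genie_bound i s 0 r = (1 + a * I + a * S) / (1 + a * I) * (T * N / (1 + I))"
    using genie_bound_eq[OF r(1), of 0 i s] unfolding d[symmetric] N_def T_def M_def by (simp add: mult_ac)
  also have "\<dots> \<le> M / (1 + I) * ((5 * M + 2 * q) * G / 25 / (1 + I))"
  proof (rule mult_mono)
    have "S * a \<le> S * 1" using r nn by (intro mult_left_mono) auto
    then have "(1 + a * I + a * S) * (1 + I) \<le> M * (1 + a * I)"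
      by (simp add: M_def algebra_simps)
    then show "(1 + a * I + a * S) / (1 + a * I) \<le> M / (1 + I)"
      using nn r by (intro frac_leI) (auto intro!: add_pos_nonneg)
    have "(5 * T) * (5 * N) \<le> (5 * T) * G"
      using T n by (intro mult_left_mono) auto
    also have "\<dots> \<le> (5 * M + 2 * q) * G"
      using T' G by (intro mult_right_mono) auto
    finally have "T * N \<le> (5 * M + 2 * q) * G / 25"
      by simp
    then show "T * N / (1 + I) \<le> (5 * M + 2 * q) * G / 25 / (1 + I)"
      using nn by (intro divide_right_mono) auto
    show "0 \<le> M / (1 + I)" using nn by (simp add: M_def)
    have "0 \<le> N"
    proof -
      have "N = (1 + I) * (1 + I) + S + 2 * (r * q) - (r * I) * (r * I)"
        unfolding N_def T_def M_def d by algebra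
      moreover have "(r * I) * (r * I) \<le> (1 + I) * (1 + I)"
        using nn assms by (intro mult_mono) (auto intro: order_trans[OF mult_left_le_one_le])
      moreover have "0 \<le> r * q" using nn assms by simp
      ultimately show ?thesis using nn by simp
    qed
    then show "0 \<le> T * N / (1 + I)" using T nn by simp
  qed
  also have "\<dots> = M * (5 * M + 2 * q) * G / (25 * ((1 + I) * (1 + I)))"
    by (simp add: mult_ac)
  also have "\<dots> \<le> (25 + 16 * (I + S)) * (5 * (1 + S + I) + 6 * q) * (25 * ((1 + I) * (1 + I) + S) - 34 * I + 30 * q) /
      (125 * ((25 + 16 * I) * (1 + I)))"
  proof (rule frac_leI)
    have i: "i * (s / i) = s" using assms by simp
    have "5 * (M * (5 * M + 2 * q) * G * (25 + 16 * I)) \<le>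
      (25 + 16 * (I + S)) * (5 * M + 6 * q) * (25 * ((1 + I) * (1 + I) + S) - 34 * I + 30 * q) * (1 + I)"
      using cert_crude[of i "s / i"] assms unfolding i M_def G_def d by (simp add: field_simps)
    then have "25 * (1 + I) * (5 * (M * (5 * M + 2 * q) * G * (25 + 16 * I))) \<le> 25 * (1 + I) *
      ((25 + 16 * (I + S)) * (5 * M + 6 * q) * (25 * ((1 + I) * (1 + I) + S) - 34 * I + 30 * q) * (1 + I))"
      using nn by (intro mult_left_mono) auto
    then show "M * (5 * M + 2 * q) * G * (125 * ((25 + 16 * I) * (1 + I))) \<le>
      (25 + 16 * (I + S)) * (5 * (1 + S + I) + 6 * q) * (25 * ((1 + I) * (1 + I) + S) - 34 * I + 30 * q) *
      (25 * ((1 + I) * (1 + I)))"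
      unfolding M_def by (simp only: mult_ac)
  qed (use nn in \<open>auto intro!: add_pos_nonneg mult_pos_pos\<close>)
  finally show ?thesis
    unfolding rhs_term_three_fifths d .
qed

text \<open>The left side is first bounded uniformly in \<open>r\<close>. On the right, the argument
  \<open>i / s\<close> has square \<open>I / S\<close> and product \<open>I\<close> with
  \<open>q\<close>, so that side becomes rational in \<open>I\<close> and \<open>S\<close>.\<close>

lemma sum_bound_le_small:
  fixes i s r :: real
  assumes "0 < i" "i < s" "i * i < 1/2" "s * s - i * i < 2" "0 \<le> r" "r \<le> 1"
  shows "sum_bound i s r \<le> rhs_term i s (i / s)"
proof -
  define I S a q D where d: "I = i * i" "S = s * s" "a = 1 - r * r" "q = i * s" "D = S - I"
  have r: "\<bar>r\<bar> \<le> 1" "0 \<le> a" "a \<le> 1" using assms one_minus_square_nonneg[of r] by (auto simp: d)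
  have nn: "0 < I" "0 < S" "0 < q" "I < S" "0 < D"
    using assms by (auto simp: d intro!: mult_strict_mono)
  have qq: "q * q = S * I" by (simp add: d algebra_simps)
  define M where "M = 1 + S + I"
  have M: "0 < M" using nn by (simp add: M_def)
  have al: "i / s * (i / s) = I / S" "i / s * q = I" "\<bar>i / s\<bar> \<le> 1"
    using assms by (auto simp: d field_simps)
  have D: "(1 - I / S) * I = D * I / S" "(1 - I / S) * S = D" using nn by (auto simp: d(5) field_simps)
  have "sum_bound i s r = (1 + a * I + a * S) / (1 + a * I) * ((M + 2 * (r * q)) * (1 + a * S))"
    using sum_bound_eq[OF r(1), of i s] unfolding d M_def by (simp add: mult_ac)
  also have "\<dots> \<le> M / (1 + I) * ((1 + S) * (M * M + I * (1 + S)) / M)"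
  proof (rule mult_mono)
    have "S * a \<le> S * 1" using r nn by (intro mult_left_mono) auto
    then have "(1 + a * I + a * S) * (1 + I) \<le> M * (1 + a * I)"
      by (simp add: M_def algebra_simps)
    then show "(1 + a * I + a * S) / (1 + a * I) \<le> M / (1 + I)"
      using nn r by (intro frac_leI) (auto intro!: add_pos_nonneg)
    have "(M + 2 * (r * q)) * (1 + a * S) * M \<le> (1 + S) * (M * M + I * (1 + S))"
    proof -
      \<comment> \<open>Completing the square in \<open>r\<close> at
        \<open>(1 + S) * q / (S * M)\<close>; the cubic remainder is nonnegative.\<close>
      have "S * ((1 + S) * (M * M + I * (1 + S)) - (M + 2 * (r * q)) * (1 + a * S) * M) =
        ((1 + S) * q - r * S * M) * ((1 + S) * q - r * S * M) + 2 * (r * r * r * S * S * M * q)"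
        using qq unfolding d(3) by algebra
      also have "\<dots> \<ge> 0" using nn M assms by simp
      finally show ?thesis using nn by (simp add: zero_le_mult_iff)
    qed
    then show "(M + 2 * (r * q)) * (1 + a * S) \<le> (1 + S) * (M * M + I * (1 + S)) / M"
      using M by (simp add: pos_le_divide_eq)
    show "0 \<le> M / (1 + I)" using nn M by simp
    show "0 \<le> (M + 2 * (r * q)) * (1 + a * S)" using nn M r assms by simp
  qed
  also have "\<dots> = (1 + S) * (M * M + I * (1 + S)) / (1 + I)"
    using M by simp
  also have "\<dots> \<le> (S + D * I + D * S) * (M + 2 * I) * (S * ((1 + I) * (1 + I) + S + I) - I * I) /
     (S * (S + D * I) * (1 + I))"
  proof (rule frac_leI)
    have "(1 + S) * (M * M + I * (1 + S)) * S * (S + D * I) \<le>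
      (S + D * I + D * S) * (M + 2 * I) * (S * ((1 + I) * (1 + I) + S + I) - I * I)"
    proof -
      have S: "S = I + D" by (simp add: d(5))
      show ?thesis
        using cert_sum_small[of I D] nn assms unfolding M_def S by (simp add: d)
    qed
    then have "(1 + I) * ((1 + S) * (M * M + I * (1 + S)) * S * (S + D * I)) \<le> (1 + I) *
      ((S + D * I + D * S) * (M + 2 * I) * (S * ((1 + I) * (1 + I) + S + I) - I * I))"
      using nn by (intro mult_left_mono) auto
    then show "(1 + S) * (M * M + I * (1 + S)) * (S * (S + D * I) * (1 + I)) \<le>
      (S + D * I + D * S) * (M + 2 * I) * (S * ((1 + I) * (1 + I) + S + I) - I * I) * (1 + I)"
      by (simp only: mult_ac)
  qed (use nn in \<open>auto intro!: add_pos_nonneg mult_pos_pos\<close>)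
  also have "\<dots> = (1 + (1 - I / S) * I + (1 - I / S) * S) * (M + 2 * I) *
     ((1 + I) * (1 + I) + S - (1 + I / S) * I + 2 * I) / ((1 + (1 - I / S) * I) * (1 + I))"
  proof -
    have "1 + D * I / S + D = (S + D * I + D * S) / S" "1 + D * I / S = (S + D * I) / S"
      "(1 + I) * (1 + I) + S - (1 + I / S) * I + 2 * I = (S * ((1 + I) * (1 + I) + S + I) - I * I) / S"
      using nn by (simp_all add: field_simps)
    then show ?thesis unfolding D using nn by (simp add: mult_ac)
  qed
  also have "\<dots> = rhs_term i s (i / s)"
    using rhs_term_eq[OF al(3), of i s] unfolding d(1,2,4)[symmetric] al M_def by simp
  finally show ?thesis .
qed

text \<open>At correlation 0 the factor \<open>1 + S + I\<close> is common, and the rest amounts to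
  \<open>S * (2 * S + S * I + 2 + 2 * I) <= I * (1 + I + S)\<close>, which follows from
  \<open>S <= I / 4\<close> and \<open>I <= 1\<close>.\<close>

lemma direct_bound_le_rhs_term:
  fixes i s :: real
  assumes "0 \<le> i" "0 \<le> s" "i < 1" "2 * s \<le> i"
  shows "direct_bound i s \<le> rhs_term i s 0"
proof -
  define I S where d: "I = i * i" "S = s * s"
  have nn: "0 \<le> I" "0 \<le> S" by (simp_all add: d)
  have I: "I \<le> 1" using assms by (simp add: d mult_le_one)
  have "(2 * s) * (2 * s) \<le> i * i" using assms by (intro mult_mono) auto
  then have S: "S \<le> I / 4" by (simp add: d)
  have "S * (2 * S + S * I + 2 + 2 * I) \<le> I / 4 * (2 * S + S * I + 2 + 2 * I)"
    using S nn by (intro mult_right_mono) auto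
  also have "\<dots> \<le> I * (1 + I + S)"
  proof -
    have "S * I \<le> S * 1" using I nn by (intro mult_left_mono) auto
    then have "(2 * S + S * I + 2 + 2 * I) / 4 \<le> 1 + I + S" using nn by simp
    then have "I * ((2 * S + S * I + 2 + 2 * I) / 4) \<le> I * (1 + I + S)"
      using nn by (intro mult_left_mono) auto
    then show ?thesis by simp
  qed
  finally have "0 \<le> I * (I * (1 + I + S) - S * (2 * S + S * I + 2 + 2 * I))"
    using nn by simp
  also have "\<dots> = (1 + I + S) * ((1 + I) * (1 + I) + S - I) - (1 + S) * (1 + S) * ((1 + I) * (1 + I))"
    by algebra
  finally have "(1 + S + I) * ((1 + S) * (1 + S) * ((1 + I) * (1 + I))) \<le>
      (1 + S + I) * ((1 + I + S) * ((1 + I) * (1 + I) + S - I))"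
    using nn by (intro mult_left_mono) auto
  then have "(1 + S) * (1 + S) * (1 + S + I) / 1 \<le>
      (1 + I + S) * (1 + S + I) * ((1 + I) * (1 + I) + S - I) / ((1 + I) * (1 + I))"
    using nn by (intro frac_leI) (auto simp: mult_ac)
  then show ?thesis
    using rhs_term_eq[of 0 i s] unfolding d by (simp add: direct_bound_def power2_eq_square)
qed

text \<open>Where the premise of \<open>sum_bound_le_rhs_term\<close> holds, \<open>r\<close> itself
  is the witness. Its failure is informative: \<open>S - I\<close> and \<open>I - r^2\<close> then
  have the same strict sign, and for \<open>i < s\<close> also
  \<open>r^2 * (1 + I) < I\<close>.\<close>

lemma exists_rhs_term_ge:
  fixes i s r K :: real
  assumes nn: "0 \<le> i" "0 \<le> s" "0 \<le> r" "r \<le> 1"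
    and direct: "K \<le> direct_bound i s" and sum: "K \<le> sum_bound i s r"
    and genie: "\<And>al. 0 \<le> al \<Longrightarrow> al < 1 \<Longrightarrow> al * i \<le> s \<Longrightarrow> K \<le> genie_bound i s al r"
  shows "\<exists>r'. 0 \<le> r' \<and> r' \<le> 1 \<and> K \<le> rhs_term i s r'"
proof (cases "(s * s - i * i) * (i * i - r * r) \<le> 2 * (r * (i * s)) + r * r * (s * s) * (i * i)")
  case True
  with sum_bound_le_rhs_term[OF nn] sum nn show ?thesis
    by (intro exI[of _ r]) auto
next
  case h: False
  have rhs_nn: "0 \<le> 2 * (r * (i * s))" "0 \<le> r * r * (s * s) * (i * i)"
    using nn by simp_all
  then have h': "0 < (s * s - i * i) * (i * i - r * r)" using h by linarith
  show ?thesis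
  proof (cases "i < s")
    \<comment> \<open>Strong interference: both factors are negative, so \<open>i < r <= 1\<close>.
      Moreover \<open>s\<close> is at most \<open>i / 2\<close>, since otherwise the product could
      not exceed \<open>2 * r * (i * s)\<close>.\<close>
    case False
    then have "s * s \<le> i * i" using nn by (intro mult_mono) auto
    then have si: "s * s < i * i" "i * i < r * r"
      using h' by (auto simp: zero_less_mult_iff)
    have rr: "r * r \<le> 1" "r * r \<le> r" using nn by (auto simp: mult_le_one mult_left_le)
    have "i < r" using si(2) nn by (metis mult_mono not_le)
    then have i1: "i < 1" using nn by simp
    have "2 * s \<le> i"
    proof (rule ccontr)
      assume "\<not> 2 * s \<le> i"
      then have "i * i \<le> i * (2 * s)" using nn by (intro mult_left_mono) auto
      from mult_left_mono[OF this nn(3)] have "r * (i * i) \<le> r * (i * (2 * s))" .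
      moreover have "r * r * (i * i) \<le> r * (i * i)" using rr by (intro mult_right_mono) auto
      moreover have "(i * i - s * s) * (r * r - i * i) \<le> i * i * (r * r)"
        using si by (intro mult_mono) auto
      ultimately have "(s * s - i * i) * (i * i - r * r) \<le> 2 * (r * (i * s))"
        by (simp add: algebra_simps)
      then show False using h rhs_nn(2) by linarith
    qed
    with direct_bound_le_rhs_term[OF nn(1,2) i1] direct show ?thesis
      by (intro exI[of _ 0]) auto
  next
    case lt: True
    have "i * i < s * s" using nn lt by (intro mult_strict_mono') auto
    then have tI: "r * r < i * i" using h' by (auto simp: zero_less_mult_iff)
    then have ri: "r < i" using nn by (metis mult_mono not_le)
    then have i0: "0 < i" using nn by simp
    have t': "r * r * (1 + i * i) < i * i"
    proof -
      have "0 < s * s * (i * i - r * r * (1 + i * i)) - (i * i * (i * i - r * r) + 2 * (r * (i * s)))"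
        using h by (simp add: algebra_simps)
      moreover have "0 \<le> i * i * (i * i - r * r)" using tI by simp
      ultimately have "0 < s * s * (i * i - r * r * (1 + i * i))" using rhs_nn(1) by linarith
      then show ?thesis by (simp add: zero_less_mult_iff)
    qed
    have r1: "r < 1"
      using t' nn(4) by (cases "r = 1") auto
    have genie': "K \<le> genie_bound i s (i / s) r"
    proof (rule genie)
      show "i / s * i \<le> s" using lt i0 \<open>i * i < s * s\<close> by (simp add: field_simps)
    qed (use lt i0 in auto)
    have lt_of_sq: "x < i" if "x * x < i * i" for x using that i0 by (metis mult_mono' not_le order.strict_implies_order)
    have gt_of_sq: "i < x" if "i * i < x * x" "0 \<le> x" for x using that i0 by (metis mult_mono' not_le order.strict_implies_order)
    have le_of: "\<exists>r'. 0 \<le> r' \<and> r' \<le> 1 \<and> K \<le> rhs_term i s r'" if "K \<le> B" "B \<le> rhs_term i s r'" "0 \<le> r'" "r' \<le> 1" for B r'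
      using that by (intro exI[of _ r']) auto
    note pw = le_of[OF genie' _ nn(3,4)]
    have q: "(0::real) \<le> 3/5" "3/5 \<le> (1::real)" by simp_all
    \<comment> \<open>The size of \<open>s\<close> relative to \<open>i\<close> then decides: close
      to \<open>i\<close> the sum bound or the genie with a fixed \<open>al\<close> is compared with
      the right-hand side at another correlation, far above \<open>i\<close> the genie with
      \<open>al = i / s\<close> wins at \<open>r\<close> itself.\<close>
    consider "i * i < 1/2" | "1/2 \<le> i * i" "i * i < 2" | "2 \<le> i * i" by linarith
    then show ?thesis
    proof cases
      case 1
      show ?thesis
      proof (cases "(0 \<le> i * i \<and> i * i < 3/10 \<and> 7/5 \<le> s) \<or> (3/10 \<le> i * i \<and> i * i < 2/5 \<and> 3/2 \<le> s) \<or>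
          (2/5 \<le> i * i \<and> i * i < 1/2 \<and> 20/13 \<le> s)")
        case True
        then have "genie_bound i s (i / s) r \<le> rhs_term i s r"
          using i0 lt nn ri h by (intro genie_pointwise_small) auto
        then show ?thesis by (rule pw)
      next
        case False
        have ss: "s * s < x * x" if "s < x" for x using that nn by (intro mult_strict_mono') auto
        have "s * s - i * i < 2"
        proof -
          consider "i * i < 3/10" "s < 7/5" | "3/10 \<le> i * i" "s < 3/2" | "2/5 \<le> i * i" "s < 20/13"
            using False 1 by fastforce
          then show ?thesis
          proof cases
            case 1
            then have "s * s < 49/25" using ss[of "7/5"] by simp
            moreover have "0 \<le> i * i" by simp
            ultimately show ?thesis by linarith
          qed (use ss[of "3/2"] ss[of "20/13"] in auto)
        qed
        from sum_bound_le_small[OF i0 lt 1 this nn(3,4)]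
        show ?thesis by (rule le_of[OF sum]) (use i0 lt in auto)
      qed
    next
      case 2
      \<comment> \<open>\<open>49/100 < 1/2\<close> and \<open>169/81 > 2\<close>.\<close>
      have i: "7/10 \<le> i" "i < 3/2" "i < 13/9"
        using lt_of_sq[of "7/10"] gt_of_sq[of "3/2"] gt_of_sq[of "13/9"] 2 by auto
      show ?thesis
      proof (cases "s < 11/6")
        case s: True
        have "r < 1/2"
        proof (rule ccontr)
          assume "\<not> r < 1/2"
          then show False using cert_pointwise_sum[of i s r] i s lt r1 h by auto
        qed
        show ?thesis
        proof (cases "s < 13/10 * i \<or> 1/5 \<le> r")
          case True
          then have "sum_bound i s r \<le> rhs_term i s (3/5)"
            using i s lt nn \<open>r < 1/2\<close> by (intro sum_bound_le_fixed) auto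
          then show ?thesis by (rule le_of[OF sum]) auto
        next
          case False
          then have "genie_bound i s 0 r \<le> rhs_term i s (3/5)"
            using i s lt nn by (intro genie_bound_zero_le_fixed) auto
          moreover have "K \<le> genie_bound i s 0 r" using nn by (intro genie) auto
          ultimately show ?thesis using le_of q by blast
        qed
      next
        case s: False
        show ?thesis
        proof (cases "i * i < 4/5")
          case True
          then have "genie_bound i s (i / s) r \<le> rhs_term i s r"
            using i0 lt nn ri h s 2 by (intro genie_pointwise_small) auto
          then show ?thesis by (rule pw)
        next
          case I: False
          have i': "8/9 \<le> i" using lt_of_sq[of "8/9"] I by auto
          show ?thesis
          proof (cases "s < 3")
            case True
            have "r < 3/5"
            proof (rule ccontr)
              assume "\<not> r < 3/5"
              then show False using cert_pointwise_sum[of i s r] i i' s True r1 h by auto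
            qed
            then have "genie_bound i s (2/5) r \<le> rhs_term i s (3/5)"
              using i i' s True nn by (intro genie_bound_le_fixed) auto
            moreover have "K \<le> genie_bound i s (2/5) r" using i0 lt by (intro genie) auto
            ultimately show ?thesis using le_of q by blast
          next
            case False
            then have "3 * 3 \<le> s * s" by (intro mult_mono) auto
            then have "genie_bound i s (i / s) r \<le> rhs_term i s r"
              using i0 lt nn 2 I t' by (intro genie_pointwise_medium) auto
            then show ?thesis by (rule pw)
          qed
        qed
      qed
    next
      case 3
      show ?thesis
      proof (cases "s < 1 + i * i")
        case True
        have "7/5 \<le> i" using lt_of_sq[of "7/5"] 3 by auto
        then have "genie_bound i s (2/5) r \<le> rhs_term i s (3/5)"
          using True lt nn r1 by (intro genie_bound_le_fixed) auto
        moreover have "K \<le> genie_bound i s (2/5) r" using i0 lt by (intro genie) auto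
        ultimately show ?thesis using le_of q by blast
      next
        case False
        then have "(1 + i * i) * (1 + i * i) \<le> s * s" using nn by (intro mult_mono) auto
        then have "genie_bound i s (i / s) r \<le> rhs_term i s r"
          using i0 lt nn 3 t' by (intro genie_pointwise_medium) auto
        then show ?thesis by (rule pw)
      qed
    qed
  qed
qed

subsection \<open>Gaussian noise and feedback maps\<close>

text \<open>Keeps the index sets \<open>{1..N}\<close> and \<open>{1..<j}\<close> in the form in
  which they are stated.\<close>

declare One_nat_def [simp del]

text \<open>Change of variables in the plane: \<open>b^2\<close> is the Jacobian in real dimension
  two, and the exponential is the quotient of the Gaussian densities at the new and the old
  point.\<close>

lemma nn_integral_cgauss_affine:
  fixes f :: "complex \<Rightarrow> ennreal"
  assumes [measurable]: "f \<in> borel_measurable borel" and b: "0 < b"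
  shows "(\<integral>\<^sup>+z. f (m + of_real b * z) *
      ennreal (b\<^sup>2 * exp ((cmod z)\<^sup>2 - (cmod (m + of_real b * z))\<^sup>2)) \<partial>cgauss) = (\<integral>\<^sup>+y. f y \<partial>cgauss)"
proof -
  let ?g = "\<lambda>y. f y * ennreal (exp (- (cmod y)\<^sup>2) / pi)"
  have "(\<integral>\<^sup>+y. f y \<partial>cgauss) = (\<integral>\<^sup>+y. ?g y \<partial>lborel)"
    unfolding cgauss_def by (subst nn_integral_density) (auto simp: mult.commute)
  also have "\<dots> = (\<integral>\<^sup>+y. ?g y \<partial>density (distr lborel borel (\<lambda>x. m + b *\<^sub>R x)) (\<lambda>_. ennreal (\<bar>b\<bar> ^ DIM(complex))))"
    using b by (subst lborel_affine[of b m]) auto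
  also have "\<dots> = (\<integral>\<^sup>+x. ennreal (b\<^sup>2) * ?g (m + b *\<^sub>R x) \<partial>lborel)"
    by (subst nn_integral_density, simp, simp, subst nn_integral_distr) (simp_all add: b)
  also have "\<dots> = (\<integral>\<^sup>+z. f (m + of_real b * z) *
      ennreal (b\<^sup>2 * exp ((cmod z)\<^sup>2 - (cmod (m + of_real b * z))\<^sup>2)) \<partial>cgauss)"
    unfolding cgauss_def
    apply (subst nn_integral_density)
    apply simp_all
    apply (rule nn_integral_cong)
    subgoal for x
    proof -
      have "exp (- (cmod x)\<^sup>2) / pi * (b\<^sup>2 * exp ((cmod x)\<^sup>2 - (cmod (m + of_real b * x))\<^sup>2)) =
          b\<^sup>2 * (exp (- (cmod (m + of_real b * x))\<^sup>2) / pi)"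
      proof -
        have e: "exp (- (cmod x)\<^sup>2) * exp ((cmod x)\<^sup>2 - (cmod (m + of_real b * x))\<^sup>2) =
            exp (- (cmod (m + of_real b * x))\<^sup>2)"
          by (simp flip: exp_add)
        have "exp (- (cmod x)\<^sup>2) / pi * (b\<^sup>2 * exp ((cmod x)\<^sup>2 - (cmod (m + of_real b * x))\<^sup>2)) =
            b\<^sup>2 * (exp (- (cmod x)\<^sup>2) * exp ((cmod x)\<^sup>2 - (cmod (m + of_real b * x))\<^sup>2) / pi)"
          by simp
        then show ?thesis by (simp only: e)
      qed
      note e = this
      have "ennreal (b\<^sup>2) * ennreal (exp (- (cmod (m + of_real b * x))\<^sup>2) / pi) =
        ennreal (b\<^sup>2 * (exp (- (cmod (m + of_real b * x))\<^sup>2) / pi))"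
        by (rule ennreal_mult'[symmetric]) simp
      also have "\<dots> = ennreal (exp (- (cmod x)\<^sup>2) / pi) * ennreal (b\<^sup>2 * exp ((cmod x)\<^sup>2 - (cmod (m + of_real b * x))\<^sup>2))"
        unfolding e[symmetric] by (rule ennreal_mult') simp
      finally have "ennreal (b\<^sup>2) * ennreal (exp (- (cmod (m + of_real b * x))\<^sup>2) / pi) = \<dots>" .
      then show ?thesis by (simp add: scaleR_conv_of_real mult_ac) (metis mult.left_commute)
    qed
    done
  finally show ?thesis by simp
qed

text \<open>\<open>gauss_ratio v m y\<close> is the density of \<open>CN(m, v)\<close> relative to \<open>CN(0, 1)\<close>.\<close>

definition gauss_ratio :: "real \<Rightarrow> complex \<Rightarrow> complex \<Rightarrow> real" where
  "gauss_ratio v m y = exp ((cmod y)\<^sup>2 - (cmod (y - m))\<^sup>2 / v) / v"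

lemma gauss_ratio_pos: "0 < v \<Longrightarrow> 0 < gauss_ratio v m y"
  by (simp add: gauss_ratio_def)

lemma gauss_ratio_measurable [measurable (raw)]:
  assumes [measurable]: "f \<in> borel_measurable M" "g \<in> borel_measurable M"
  shows "(\<lambda>x. gauss_ratio v (f x) (g x)) \<in> borel_measurable M"
  unfolding gauss_ratio_def by measurable

lemma nn_integral_gauss_ratio:
  assumes "0 < v"
  shows "(\<integral>\<^sup>+y. ennreal (gauss_ratio v m y) \<partial>cgauss) = 1"
proof -
  let ?b = "1 / sqrt v"
  have "(\<integral>\<^sup>+y. 1 * ennreal (?b\<^sup>2 * exp ((cmod y)\<^sup>2 - (cmod (- m / sqrt v + of_real ?b * y))\<^sup>2)) \<partial>cgauss) = (\<integral>\<^sup>+y. 1 \<partial>cgauss)"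
    using assms by (intro nn_integral_cgauss_affine[of "\<lambda>_. 1"]) auto
  moreover have "?b\<^sup>2 * exp ((cmod y)\<^sup>2 - (cmod (- m / sqrt v + of_real ?b * y))\<^sup>2) = gauss_ratio v m y" for y
  proof -
    have "- m / sqrt v + of_real ?b * y = (y - m) / of_real (sqrt v)"
      by (simp add: diff_divide_distrib)
    then have "(cmod (- m / sqrt v + of_real ?b * y))\<^sup>2 = (cmod (y - m))\<^sup>2 / v"
      using assms by (simp add: norm_divide power_divide)
    then show ?thesis using assms by (simp add: gauss_ratio_def power_divide)
  qed
  ultimately show ?thesis
    using prob_space.emeasure_space_1[OF prob_space_cgauss] by simp
qed

lemma measurable_cgauss_iff: "f \<in> measurable cgauss M \<longleftrightarrow> f \<in> measurable borel M"
  by (simp cong: measurable_cong_sets)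

interpretation cgauss: prob_space cgauss
  by (rule prob_space_cgauss)

interpretation cgauss_seq: product_prob_space "\<lambda>_::nat. cgauss" UNIV
  by standard

abbreviation "noise N \<equiv> PiM {1..N::nat} (\<lambda>_. cgauss)"

lemma prob_space_noise: "prob_space (noise N)"
  by (intro prob_space_PiM prob_space_cgauss)

text \<open>A channel whose mean at time \<open>j\<close> is a function of the past outputs. The
  output of the first receiver as a function of its effective noise is an instance, and so is a mere
  shift, whose mean ignores the past.\<close>

function feedback :: "(nat \<Rightarrow> (nat \<Rightarrow> complex) \<Rightarrow> complex) \<Rightarrow> real \<Rightarrow> (nat \<Rightarrow> complex) \<Rightarrow> nat \<Rightarrow> complex" where
  "feedback m b z j = m j (\<lambda>i\<in>{1..<j}. feedback m b z i) + of_real b * z j"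
  by pat_completeness auto
termination
  by (relation "Wellfounded.measure (\<lambda>(_, _, _, j). j)") auto

declare feedback.simps [simp del]

lemma feedback_cong:
  assumes "\<And>i. i \<in> {1..j} \<Longrightarrow> z i = z' i" "1 \<le> j"
  shows "feedback m b z j = feedback m b z' j"
  using assms
proof (induction j rule: less_induct)
  case (less j)
  have "(\<lambda>i\<in>{1..<j}. feedback m b z i) = (\<lambda>i\<in>{1..<j}. feedback m b z' i)"
    using less by (intro restrict_ext) auto
  then show ?case using less.prems by (simp add: feedback.simps[of m b _ j])
qed

lemma measurable_noise_component:
  "j \<in> {1..N} \<Longrightarrow> (\<lambda>z. z j) \<in> borel_measurable (noise N)"
  using measurable_component_singleton[of j "{1..N}" "\<lambda>_. cgauss"] by simp

lemma measurable_feedback: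
  assumes "\<And>j. j \<in> {1..N} \<Longrightarrow> m j \<in> borel_measurable (\<Pi>\<^sub>M i\<in>{1..<j}. borel)" "j \<in> {1..N}"
  shows "(\<lambda>z. feedback m b z j) \<in> borel_measurable (noise N)"
  using assms(2)
proof (induction j rule: less_induct)
  case (less j)
  have "(\<lambda>z. \<lambda>i\<in>{1..<j}. feedback m b z i) \<in> measurable (noise N) (\<Pi>\<^sub>M i\<in>{1..<j}. borel)"
    using less by (intro measurable_restrict) auto
  moreover have "(\<lambda>z. z j) \<in> borel_measurable (noise N)"
    using less.prems by (rule measurable_noise_component)
  ultimately show ?case
    unfolding feedback.simps[of m b _ j]
    by (intro borel_measurable_add borel_measurable_times borel_measurable_const)
      (rule measurable_compose[OF _ assms(1)[OF less.prems]])
qed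

lemma sets_noise: "sets (noise N) = sets (\<Pi>\<^sub>M i\<in>{1..N}. (borel :: complex measure))"
  by (rule sets_PiM_cong) auto

lemma measurable_feedback_seq:
  assumes "\<And>j. j \<in> {1..N} \<Longrightarrow> m j \<in> borel_measurable (\<Pi>\<^sub>M i\<in>{1..<j}. borel)"
  shows "(\<lambda>z. \<lambda>j\<in>{1..N}. feedback m b z j) \<in> measurable (noise N) (noise N)"
proof -
  have "(\<lambda>z. \<lambda>j\<in>{1..N}. feedback m b z j) \<in> measurable (noise N) (\<Pi>\<^sub>M i\<in>{1..N}. borel)"
    using assms by (intro measurable_restrict measurable_feedback)
  then show ?thesis using measurable_cong_sets[OF refl sets_noise] by blast
qed

lemma nn_integral_noise_Suc:
  assumes "f \<in> borel_measurable (noise (Suc N))"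
  shows "(\<integral>\<^sup>+z. f z \<partial>noise (Suc N)) = (\<integral>\<^sup>+z. \<integral>\<^sup>+x. f (z(Suc N := x)) \<partial>cgauss \<partial>noise N)"
proof -
  have "{1..Suc N} = insert (Suc N) {1..N}" by auto
  then show ?thesis
    using cgauss_seq.product_nn_integral_insert[of "{1..N}" "Suc N" f] assms by simp
qed

lemma measurable_fun_upd_noise [measurable]:
  "(\<lambda>(z, x). z(Suc N := x)) \<in> measurable (noise N \<Otimes>\<^sub>M cgauss) (noise (Suc N))"
proof -
  have "{1..Suc N} = insert (Suc N) {1..N}" by auto
  then show ?thesis using measurable_add_dim[of "Suc N" "{1..N}" "\<lambda>_. cgauss"] by simp
qed

text \<open>A feedback map with unit gain is volume preserving, whatever the past outputs do to the mean.\<close>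

lemma nn_integral_feedback:
  assumes "\<And>j. j \<in> {1..N} \<Longrightarrow> m j \<in> borel_measurable (\<Pi>\<^sub>M i\<in>{1..<j}. borel)"
    and "f \<in> borel_measurable (noise N)" and b: "0 < b"
  shows "(\<integral>\<^sup>+z. f (\<lambda>j\<in>{1..N}. feedback m b z j) *
      ennreal (\<Prod>j\<in>{1..N}. b\<^sup>2 * exp ((cmod (z j))\<^sup>2 - (cmod (feedback m b z j))\<^sup>2)) \<partial>noise N)
    = (\<integral>\<^sup>+y. f y \<partial>noise N)"
  using assms(1,2)
proof (induction N arbitrary: f)
  case 0
  have "space (noise 0) = {\<lambda>x. undefined}" by (simp add: space_PiM)
  then show ?case by (intro nn_integral_cong) (auto simp: restrict_def)
next
  case (Suc N)
  let ?F = "\<lambda>N z. \<lambda>j\<in>{1..N}. feedback m b z j"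
  let ?w = "\<lambda>z j. b\<^sup>2 * exp ((cmod (z j))\<^sup>2 - (cmod (feedback m b z j))\<^sup>2)"
  have m: "m j \<in> borel_measurable (\<Pi>\<^sub>M i\<in>{1..<j}. borel)" if "j \<in> {1..Suc N}" for j
    using Suc.prems(1) that by blast
  have [measurable]: "f \<in> borel_measurable (noise (Suc N))" by fact
  have [measurable]: "?F (Suc N) \<in> measurable (noise (Suc N)) (noise (Suc N))"
    by (rule measurable_feedback_seq[OF m])
  have FN: "?F N \<in> measurable (noise N) (noise N)"
    by (rule measurable_feedback_seq) (use m in auto)
  have wm: "(\<lambda>z. ennreal (\<Prod>j\<in>{1..Suc N}. ?w z j)) \<in> borel_measurable (noise (Suc N))"
  proof (intro measurable_compose[OF _ measurable_ennreal] borel_measurable_prod)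
    fix j assume j: "j \<in> {1..Suc N}"
    have [measurable]: "(\<lambda>z. feedback m b z j) \<in> borel_measurable (noise (Suc N))"
      by (rule measurable_feedback[OF m j])
    have [measurable]: "(\<lambda>z. z j) \<in> borel_measurable (noise (Suc N))"
      by (rule measurable_noise_component[OF j])
    show "(\<lambda>z. ?w z j) \<in> borel_measurable (noise (Suc N))" by measurable
  qed
  have upd: "feedback m b (z(Suc N := x)) j = feedback m b z j" if "j \<in> {1..N}" for z x j
    using that by (intro feedback_cong) auto
  define g where "g y = (\<integral>\<^sup>+x. f (y(Suc N := x)) \<partial>cgauss)" for y
  have g [measurable]: "g \<in> borel_measurable (noise N)"
    unfolding g_def by measurable
  \<comment> \<open>The last noise sample enters only the last output, whose mean is fixed by the
    earlier samples; integrating it out is a single affine substitution.\<close>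
  have inner: "(\<integral>\<^sup>+x. f (?F (Suc N) (z(Suc N := x))) * ennreal (\<Prod>j\<in>{1..Suc N}. ?w (z(Suc N := x)) j) \<partial>cgauss)
      = g (?F N z) * ennreal (\<Prod>j\<in>{1..N}. ?w z j)" if z: "z \<in> space (noise N)" for z
  proof -
    define mu where "mu = m (Suc N) (\<lambda>i\<in>{1..<Suc N}. feedback m b z i)"
    have past: "(\<lambda>i\<in>{1..<Suc N}. feedback m b (z(Suc N := x)) i) = (\<lambda>i\<in>{1..<Suc N}. feedback m b z i)" for x
      by (intro restrict_ext upd) auto
    have last: "feedback m b (z(Suc N := x)) (Suc N) = mu + of_real b * x" for x
      by (subst feedback.simps) (simp only: past mu_def fun_upd_same)
    have F: "?F (Suc N) (z(Suc N := x)) = (?F N z)(Suc N := mu + of_real b * x)" for x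
      using last upd by (auto simp: restrict_def fun_eq_iff)
    have W: "(\<Prod>j\<in>{1..Suc N}. ?w (z(Suc N := x)) j) =
        (\<Prod>j\<in>{1..N}. ?w z j) * (b\<^sup>2 * exp ((cmod x)\<^sup>2 - (cmod (mu + of_real b * x))\<^sup>2))" for x
      using last by (simp add: upd)
    have Fz: "?F N z \<in> space (noise N)" using measurable_space[OF FN z] .
    have h: "(\<lambda>y. f ((?F N z)(Suc N := y))) \<in> borel_measurable borel"
    proof -
      have "(\<lambda>y. (?F N z)(Suc N := y)) \<in> measurable cgauss (noise (Suc N))"
        using measurable_compose[OF measurable_Pair1'[OF Fz] measurable_fun_upd_noise] by simp
      from measurable_compose[OF this Suc.prems(2)] show ?thesis by (simp only: measurable_cgauss_iff)
    qed
    have "(\<integral>\<^sup>+x. f (?F (Suc N) (z(Suc N := x))) * ennreal (\<Prod>j\<in>{1..Suc N}. ?w (z(Suc N := x)) j) \<partial>cgauss)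
      = (\<integral>\<^sup>+x. ennreal (\<Prod>j\<in>{1..N}. ?w z j) * (f ((?F N z)(Suc N := mu + of_real b * x)) *
          ennreal (b\<^sup>2 * exp ((cmod x)\<^sup>2 - (cmod (mu + of_real b * x))\<^sup>2))) \<partial>cgauss)"
      unfolding F W by (intro nn_integral_cong) (simp add: ennreal_mult prod_nonneg mult_ac)
    also have "\<dots> = ennreal (\<Prod>j\<in>{1..N}. ?w z j) * (\<integral>\<^sup>+x. f ((?F N z)(Suc N := mu + of_real b * x)) *
          ennreal (b\<^sup>2 * exp ((cmod x)\<^sup>2 - (cmod (mu + of_real b * x))\<^sup>2)) \<partial>cgauss)"
      by (rule nn_integral_cmult) (use h in measurable)
    also have "\<dots> = ennreal (\<Prod>j\<in>{1..N}. ?w z j) * g (?F N z)"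
      unfolding g_def by (subst nn_integral_cgauss_affine[OF h b]) simp
    finally show ?thesis by (simp add: mult.commute)
  qed
  have "(\<integral>\<^sup>+z. f (?F (Suc N) z) * ennreal (\<Prod>j\<in>{1..Suc N}. ?w z j) \<partial>noise (Suc N)) =
      (\<integral>\<^sup>+z. \<integral>\<^sup>+x. f (?F (Suc N) (z(Suc N := x))) * ennreal (\<Prod>j\<in>{1..Suc N}. ?w (z(Suc N := x)) j) \<partial>cgauss \<partial>noise N)"
    by (rule nn_integral_noise_Suc) (use wm in measurable)
  also have "\<dots> = (\<integral>\<^sup>+z. g (?F N z) * ennreal (\<Prod>j\<in>{1..N}. ?w z j) \<partial>noise N)"
    by (intro nn_integral_cong inner)
  also have "\<dots> = (\<integral>\<^sup>+y. g y \<partial>noise N)"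
    using Suc.prems(1) by (intro Suc.IH g) auto
  also have "\<dots> = (\<integral>\<^sup>+y. f y \<partial>noise (Suc N))"
    unfolding g_def by (rule nn_integral_noise_Suc[symmetric]) fact
  finally show ?case .
qed

lemma nn_integral_noise_prod:
  assumes "\<And>j. j \<in> {1..N} \<Longrightarrow> f j \<in> borel_measurable borel"
  shows "(\<integral>\<^sup>+y. (\<Prod>j\<in>{1..N}. f j (y j)) \<partial>noise N) = (\<Prod>j\<in>{1..N}. \<integral>\<^sup>+x. f j x \<partial>cgauss)"
  using assms by (intro cgauss_seq.product_nn_integral_prod) auto

lemma nn_integral_noise_gauss_ratio:
  assumes "0 < v"
  shows "(\<integral>\<^sup>+y. ennreal (\<Prod>j\<in>{1..N}. gauss_ratio v (m j) (y j)) \<partial>noise N) = 1"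
proof -
  have "(\<integral>\<^sup>+y. (\<Prod>j\<in>{1..N}. ennreal (gauss_ratio v (m j) (y j))) \<partial>noise N) =
     (\<Prod>j\<in>{1..N}. \<integral>\<^sup>+x. ennreal (gauss_ratio v (m j) x) \<partial>cgauss)"
    by (rule nn_integral_noise_prod) (simp add: gauss_ratio_def)
  then show ?thesis
    using assms by (simp add: nn_integral_gauss_ratio gauss_ratio_pos less_imp_le prod_ennreal)
qed

text \<open>Stability of the Gaussian law: the kernel \<open>?k\<close> of the sum \<open>u\<close>
  given \<open>x\<close> has the same form as a kernel of \<open>x\<close> given \<open>u\<close>,
  so after exchanging the integrals the inner one is the total mass of a density.\<close>

lemma nn_integral_cgauss_rotate:
  fixes f :: "complex \<Rightarrow> ennreal"
  assumes f [measurable]: "f \<in> borel_measurable borel" and b: "0 < b" and ab: "(cmod al)\<^sup>2 + b\<^sup>2 = 1"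
  shows "(\<integral>\<^sup>+x. \<integral>\<^sup>+y. f (al * x + of_real b * y) \<partial>cgauss \<partial>cgauss) = (\<integral>\<^sup>+u. f u \<partial>cgauss)"
proof -
  let ?k = "\<lambda>x u. gauss_ratio (b\<^sup>2) (al * x) u"
  have k_swap: "?k x u = gauss_ratio (b\<^sup>2) (cnj al * u) x" for x u
  proof -
    have e1: "(cmod (u - al * x))\<^sup>2 = (cmod u)\<^sup>2 + (cmod al)\<^sup>2 * (cmod x)\<^sup>2 - 2 * Re (cnj al * u * cnj x)"
      and e2: "(cmod (x - cnj al * u))\<^sup>2 = (cmod x)\<^sup>2 + (cmod al)\<^sup>2 * (cmod u)\<^sup>2 - 2 * Re (cnj al * u * cnj x)"
      unfolding cmod_power2 by (simp_all add: power2_eq_square algebra_simps)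
    have "(cmod al)\<^sup>2 = 1 - b\<^sup>2" using ab by simp
    note al2 = this
    have "(cmod u)\<^sup>2 - (cmod (u - al * x))\<^sup>2 / b\<^sup>2 = (cmod x)\<^sup>2 - (cmod (x - cnj al * u))\<^sup>2 / b\<^sup>2"
      unfolding e1 e2 al2 using b by (simp add: field_simps)
    then show ?thesis by (simp add: gauss_ratio_def)
  qed
  have inner: "(\<integral>\<^sup>+y. f (al * x + of_real b * y) \<partial>cgauss) = (\<integral>\<^sup>+u. f u * ennreal (?k x u) \<partial>cgauss)" for x
  proof -
    have "(\<integral>\<^sup>+y. (\<lambda>u. f u * ennreal (?k x u)) (al * x + of_real b * y) *
       ennreal (b\<^sup>2 * exp ((cmod y)\<^sup>2 - (cmod (al * x + of_real b * y))\<^sup>2)) \<partial>cgauss) =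
       (\<integral>\<^sup>+u. f u * ennreal (?k x u) \<partial>cgauss)"
      using b by (intro nn_integral_cgauss_affine) (auto simp: gauss_ratio_def)
    moreover have "ennreal (?k x (al * x + of_real b * y)) *
        ennreal (b\<^sup>2 * exp ((cmod y)\<^sup>2 - (cmod (al * x + of_real b * y))\<^sup>2)) = 1" for y
      using b by (simp add: gauss_ratio_def norm_mult power_mult_distrib flip: ennreal_mult' exp_add)
    ultimately show ?thesis by (simp add: mult.assoc)
  qed
  have "(\<integral>\<^sup>+x. \<integral>\<^sup>+y. f (al * x + of_real b * y) \<partial>cgauss \<partial>cgauss) =
      (\<integral>\<^sup>+x. \<integral>\<^sup>+u. f u * ennreal (?k x u) \<partial>cgauss \<partial>cgauss)"
    by (simp add: inner)
  also have "\<dots> = (\<integral>\<^sup>+u. \<integral>\<^sup>+x. f u * ennreal (?k x u) \<partial>cgauss \<partial>cgauss)"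
  proof -
    interpret pair_sigma_finite cgauss cgauss by standard
    show ?thesis
      by (rule Fubini') (simp add: gauss_ratio_def, measurable)
  qed
  also have "\<dots> = (\<integral>\<^sup>+u. f u \<partial>cgauss)"
  proof (rule nn_integral_cong)
    fix u
    have "(\<integral>\<^sup>+x. ennreal (?k x u) \<partial>cgauss) = 1"
      unfolding k_swap using b by (intro nn_integral_gauss_ratio) simp
    moreover have "(\<integral>\<^sup>+x. f u * ennreal (?k x u) \<partial>cgauss) = f u * (\<integral>\<^sup>+x. ennreal (?k x u) \<partial>cgauss)"
      by (rule nn_integral_cmult) measurable
    ultimately show "(\<integral>\<^sup>+x. f u * ennreal (?k x u) \<partial>cgauss) = f u" by simp
  qed
  finally show ?thesis .
qed

lemma nn_integral_noise_rotate:
  assumes "f \<in> borel_measurable (noise N)" and b: "0 < b" and ab: "(cmod al)\<^sup>2 + b\<^sup>2 = 1"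
  shows "(\<integral>\<^sup>+x. \<integral>\<^sup>+y. f (\<lambda>j\<in>{1..N}. al * x j + of_real b * y j) \<partial>noise N \<partial>noise N) = (\<integral>\<^sup>+u. f u \<partial>noise N)"
  using assms(1)
proof (induction N arbitrary: f)
  case 0
  have "noise 0 = count_space {\<lambda>k. undefined}" by (simp add: PiM_empty)
  then show ?case by (simp add: restrict_def nn_integral_count_space_finite)
next
  case (Suc N)
  have [measurable]: "f \<in> borel_measurable (noise (Suc N))" by fact
  let ?c = "\<lambda>N x y. \<lambda>j\<in>{1..N}. al * x j + of_real b * y j"
  have c [measurable]: "(\<lambda>(x, y). ?c N x y) \<in> measurable (noise N \<Otimes>\<^sub>M noise N) (noise N)" for N
  proof -
    have "(\<lambda>p. \<lambda>j\<in>{1..N}. al * fst p j + of_real b * snd p j) \<in>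
        measurable (noise N \<Otimes>\<^sub>M noise N) (\<Pi>\<^sub>M i\<in>{1..N}. (borel :: complex measure))"
    proof (intro measurable_restrict)
      fix j assume j: "j \<in> {1..N}"
      note [measurable] = measurable_noise_component[OF j]
      show "(\<lambda>p. al * fst p j + of_real b * snd p j) \<in> borel_measurable (noise N \<Otimes>\<^sub>M noise N)"
        by measurable
    qed
    then show ?thesis using measurable_cong_sets[OF refl sets_noise] by (simp add: case_prod_beta')
  qed
  have upd: "?c (Suc N) (x(Suc N := s)) (y(Suc N := t)) = (?c N x y)(Suc N := al * s + of_real b * t)" for x y s t
    by (auto simp: restrict_def fun_eq_iff)
  interpret NP: prob_space "noise N" by (rule prob_space_noise)
  interpret SP: prob_space "noise (Suc N)" by (rule prob_space_noise)
  interpret P: pair_sigma_finite cgauss "noise N" by standard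
  have "(\<integral>\<^sup>+x. \<integral>\<^sup>+y. f (?c (Suc N) x y) \<partial>noise (Suc N) \<partial>noise (Suc N)) =
    (\<integral>\<^sup>+x. \<integral>\<^sup>+s. \<integral>\<^sup>+y. \<integral>\<^sup>+t. f ((?c N x y)(Suc N := al * s + of_real b * t)) \<partial>cgauss \<partial>noise N \<partial>cgauss \<partial>noise N)"
    apply (subst nn_integral_noise_Suc)
     apply measurable
    apply (intro nn_integral_cong)
    apply (subst nn_integral_noise_Suc)
    subgoal for x s
    proof -
      assume "x \<in> space (noise N)" "s \<in> space cgauss"
      then have "x(Suc N := s) \<in> space (noise (Suc N))"
        using measurable_space[OF measurable_fun_upd_noise, of "(x, s)"] by (simp add: space_pair_measure)
      from measurable_compose[OF measurable_Pair1'[OF this] measurable_compose[OF c \<open>f \<in> _\<close>]]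
      show ?thesis by simp
    qed
    apply (simp only: upd)
    done
  also have "\<dots> = (\<integral>\<^sup>+x. \<integral>\<^sup>+y. \<integral>\<^sup>+s. \<integral>\<^sup>+t. f ((?c N x y)(Suc N := al * s + of_real b * t)) \<partial>cgauss \<partial>cgauss \<partial>noise N \<partial>noise N)"
  proof (intro nn_integral_cong)
    fix x assume x: "x \<in> space (noise N)"
    have [measurable]: "(\<lambda>y. ?c N x y) \<in> measurable (noise N) (noise N)"
      using measurable_compose[OF measurable_Pair1'[OF x] c] by simp
    show "(\<integral>\<^sup>+s. \<integral>\<^sup>+y. \<integral>\<^sup>+t. f ((?c N x y)(Suc N := al * s + of_real b * t)) \<partial>cgauss \<partial>noise N \<partial>cgauss) =
      (\<integral>\<^sup>+y. \<integral>\<^sup>+s. \<integral>\<^sup>+t. f ((?c N x y)(Suc N := al * s + of_real b * t)) \<partial>cgauss \<partial>cgauss \<partial>noise N)"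
      by (rule P.Fubini'[symmetric]) measurable
  qed
  also have "\<dots> = (\<integral>\<^sup>+x. \<integral>\<^sup>+y. (\<integral>\<^sup>+u. f ((?c N x y)(Suc N := u)) \<partial>cgauss) \<partial>noise N \<partial>noise N)"
  proof (rule nn_integral_cong, rule nn_integral_cong)
    fix x y assume "x \<in> space (noise N)" "y \<in> space (noise N)"
    then have "?c N x y \<in> space (noise N)"
      using measurable_space[OF c, of "(x, y)"] by (simp add: space_pair_measure)
    from measurable_compose[OF measurable_compose[OF measurable_Pair1'[OF this] measurable_fun_upd_noise] \<open>f \<in> _\<close>]
    have "(\<lambda>u. f ((?c N x y)(Suc N := u))) \<in> borel_measurable borel"
      by (simp only: measurable_cgauss_iff prod.case)
    from nn_integral_cgauss_rotate[OF this b ab]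
    show "(\<integral>\<^sup>+s. \<integral>\<^sup>+t. f ((?c N x y)(Suc N := al * s + of_real b * t)) \<partial>cgauss \<partial>cgauss) =
        (\<integral>\<^sup>+u. f ((?c N x y)(Suc N := u)) \<partial>cgauss)" .
  qed
  also have "\<dots> = (\<integral>\<^sup>+z. \<integral>\<^sup>+u. f (z(Suc N := u)) \<partial>cgauss \<partial>noise N)"
    by (rule Suc.IH) measurable
  also have "\<dots> = (\<integral>\<^sup>+u. f u \<partial>noise (Suc N))"
    by (rule nn_integral_noise_Suc[symmetric]) fact
  finally show ?case .
qed

lemma nn_integral_cgauss_normal:
  fixes f :: "complex \<Rightarrow> ennreal"
  assumes [measurable]: "f \<in> borel_measurable borel"
  shows "(\<integral>\<^sup>+z. f z \<partial>cgauss) = (\<integral>\<^sup>+x. \<integral>\<^sup>+y. f (Complex x y) * ennreal (normal_density 0 (sqrt (1/2)) y) \<partial>lborel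
      * ennreal (normal_density 0 (sqrt (1/2)) x) \<partial>lborel)"
proof -
  let ?n = "normal_density 0 (sqrt (1/2))"
  have dens: "exp (- (cmod (Complex x y))\<^sup>2) / pi = ?n x * ?n y" for x y
    by (simp add: normal_density_def cmod_def exp_add[symmetric] flip: times_divide_times_eq)
  have [measurable]: "(\<lambda>p. Complex (fst p) (snd p)) \<in> borel_measurable (lborel \<Otimes>\<^sub>M lborel)"
    using measurable_Complex_pair by (simp add: case_prod_beta')
  have "(\<integral>\<^sup>+z. f z \<partial>cgauss) = (\<integral>\<^sup>+p. f (Complex (fst p) (snd p)) * ennreal (?n (fst p) * ?n (snd p)) \<partial>(lborel \<Otimes>\<^sub>M lborel))"
    unfolding cgauss_def
    by (subst nn_integral_density, simp, simp, subst lborel_complex_eq_distr, subst nn_integral_distr)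
      (use measurable_Complex_pair in \<open>auto simp: case_prod_beta' dens mult.commute\<close>)
  also have "\<dots> = (\<integral>\<^sup>+x. \<integral>\<^sup>+y. f (Complex x y) * ennreal (?n y) * ennreal (?n x) \<partial>lborel \<partial>lborel)"
    by (subst lborel.nn_integral_fst[symmetric]) (auto simp: ennreal_mult mult_ac)
  also have "\<dots> = (\<integral>\<^sup>+x. (\<integral>\<^sup>+y. f (Complex x y) * ennreal (?n y) \<partial>lborel) * ennreal (?n x) \<partial>lborel)"
  proof (rule nn_integral_cong)
    fix x :: real
    have "(\<lambda>y. Complex x y) \<in> borel_measurable lborel"
      using measurable_compose[OF measurable_Pair1'[of x lborel lborel] measurable_Complex_pair] by simp
    then have "(\<lambda>y. f (Complex x y) * ennreal (?n y)) \<in> borel_measurable lborel" by measurable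
    then show "(\<integral>\<^sup>+y. f (Complex x y) * ennreal (?n y) * ennreal (?n x) \<partial>lborel) =
        (\<integral>\<^sup>+y. f (Complex x y) * ennreal (?n y) \<partial>lborel) * ennreal (?n x)"
      by (rule nn_integral_multc)
  qed
  finally show ?thesis .
qed

lemma nn_integral_normal_shift_square:
  fixes a c :: real
  assumes "0 \<le> c"
  shows "(\<integral>\<^sup>+x. ennreal ((a + x)\<^sup>2 + c) * ennreal (normal_density 0 (sqrt (1/2)) x) \<partial>lborel) = ennreal (a\<^sup>2 + 1/2 + c)"
proof -
  let ?n = "normal_density 0 (sqrt (1/2))"
  have 1: "has_bochner_integral lborel ?n 1"
    using prob_space_normal_density[of "sqrt (1/2)" 0]
    by (simp add: has_bochner_integral_iff)
  have 2: "has_bochner_integral lborel (\<lambda>x. ?n x * x) 0"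
    using normal_moment_odd[of "sqrt (1/2)" 0 0] by simp
  have 3: "has_bochner_integral lborel (\<lambda>x. ?n x * x\<^sup>2) (1/2)"
    using normal_moment_even[of "sqrt (1/2)" 0 1] by (simp add: fact_numeral real_sqrt_divide power_divide)
  have "has_bochner_integral lborel (\<lambda>x. (a\<^sup>2 + c) * ?n x + 2 * a * (?n x * x) + ?n x * x\<^sup>2)
      ((a\<^sup>2 + c) * 1 + 2 * a * 0 + 1/2)"
    by (intro has_bochner_integral_add has_bochner_integral_mult_right 1 2 3)
  then have "has_bochner_integral lborel (\<lambda>x. ((a + x)\<^sup>2 + c) * ?n x) (a\<^sup>2 + 1/2 + c)"
    by (simp add: power2_sum algebra_simps)
  then have "(\<integral>\<^sup>+x. ennreal (((a + x)\<^sup>2 + c) * ?n x) \<partial>lborel) = ennreal (a\<^sup>2 + 1/2 + c)"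
    using assms by (intro nn_integral_eq_integral[THEN trans]) (auto simp: has_bochner_integral_iff)
  then show ?thesis using assms by (simp add: ennreal_mult)
qed

text \<open>The real and imaginary parts have variance 1/2 each and mean 0. A nonnegative integral
  is used so that integrability follows from the value.\<close>

lemma nn_integral_cgauss_square:
  "(\<integral>\<^sup>+z. ennreal ((cmod (f + c * z))\<^sup>2) \<partial>cgauss) = ennreal ((cmod f)\<^sup>2 + (cmod c)\<^sup>2)"
proof (cases "c = 0")
  case True
  then show ?thesis by (simp add: cgauss.emeasure_space_1[simplified])
next
  case False
  have basic: "(\<integral>\<^sup>+z. ennreal ((cmod (g + z))\<^sup>2) \<partial>cgauss) = ennreal ((cmod g)\<^sup>2 + 1)" for g
  proof -
    let ?n = "normal_density 0 (sqrt (1/2))"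
    have sq: "(cmod (g + Complex x y))\<^sup>2 = (Im g + y)\<^sup>2 + (Re g + x)\<^sup>2" for x y
      by (simp add: cmod_power2 add.commute)
    have inner: "(\<integral>\<^sup>+y. ennreal ((Im g + y)\<^sup>2 + (Re g + x)\<^sup>2) * ennreal (?n y) \<partial>lborel) =
        ennreal ((Re g + x)\<^sup>2 + ((Im g)\<^sup>2 + 1/2))" for x
      by (subst nn_integral_normal_shift_square, rule zero_le_power2) (rule arg_cong[of _ _ ennreal], simp)
    have "(\<integral>\<^sup>+z. ennreal ((cmod (g + z))\<^sup>2) \<partial>cgauss) =
      (\<integral>\<^sup>+x. \<integral>\<^sup>+y. ennreal ((cmod (g + Complex x y))\<^sup>2) * ennreal (?n y) \<partial>lborel * ennreal (?n x) \<partial>lborel)"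
      by (rule nn_integral_cgauss_normal) measurable
    also have "\<dots> = (\<integral>\<^sup>+x. ennreal ((Re g + x)\<^sup>2 + ((Im g)\<^sup>2 + 1/2)) * ennreal (?n x) \<partial>lborel)"
      by (simp only: sq inner)
    also have "\<dots> = ennreal ((Re g)\<^sup>2 + 1/2 + ((Im g)\<^sup>2 + 1/2))"
      by (rule nn_integral_normal_shift_square) simp
    also have "\<dots> = ennreal ((cmod g)\<^sup>2 + 1)"
      by (rule arg_cong[of _ _ ennreal]) (simp add: cmod_power2)
    finally show ?thesis .
  qed
  have "(\<integral>\<^sup>+z. ennreal ((cmod (f + c * z))\<^sup>2) \<partial>cgauss) =
      (\<integral>\<^sup>+z. ennreal ((cmod c)\<^sup>2) * ennreal ((cmod (f / c + z))\<^sup>2) \<partial>cgauss)"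
  proof (intro nn_integral_cong)
    fix z
    have "f + c * z = c * (f / c + z)" using False by (simp add: field_simps)
    then have "cmod (f + c * z) = cmod c * cmod (f / c + z)" by (metis norm_mult)
    then show "ennreal ((cmod (f + c * z))\<^sup>2) = ennreal ((cmod c)\<^sup>2) * ennreal ((cmod (f / c + z))\<^sup>2)"
      by (simp add: power_mult_distrib ennreal_mult)
  qed
  also have "\<dots> = ennreal ((cmod c)\<^sup>2) * ennreal ((cmod (f / c))\<^sup>2 + 1)"
    by (simp add: nn_integral_cmult basic)
  also have "\<dots> = ennreal ((cmod f)\<^sup>2 + (cmod c)\<^sup>2)"
  proof -
    have "(cmod c)\<^sup>2 * ((cmod (f / c))\<^sup>2 + 1) = (cmod f)\<^sup>2 + (cmod c)\<^sup>2"
      using False by (simp add: norm_divide power_divide distrib_left)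
    then show ?thesis by (metis ennreal_mult' zero_le_power2)
  qed
  finally show ?thesis .
qed

lemma nn_integral_shift_change:
  assumes "f \<in> borel_measurable (noise N)" "0 < b"
  shows "(\<integral>\<^sup>+z. f (\<lambda>j\<in>{1..N}. m j + of_real b * z j) *
      ennreal (\<Prod>j\<in>{1..N}. b\<^sup>2 * exp ((cmod (z j))\<^sup>2 - (cmod (m j + of_real b * z j))\<^sup>2)) \<partial>noise N)
    = (\<integral>\<^sup>+y. f y \<partial>noise N)"
  using nn_integral_feedback[of N "\<lambda>j p. m j" f b] assms by (simp add: feedback.simps)

lemma measurable_shift_noise:
  "(\<lambda>z. \<lambda>j\<in>{1..N}. m j + c * z j) \<in> measurable (noise N) (noise N)"
proof -
  have "(\<lambda>z. \<lambda>j\<in>{1..N}. m j + c * z j) \<in> measurable (noise N) (\<Pi>\<^sub>M i\<in>{1..N}. borel)"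
    by (intro measurable_restrict borel_measurable_add borel_measurable_times measurable_noise_component) auto
  then show ?thesis using measurable_cong_sets[OF refl sets_noise] by blast
qed

lemma gauss_ratio_change:
  assumes "0 < b"
  shows "gauss_ratio (b\<^sup>2) m (m + of_real b * z) * (b\<^sup>2 * exp ((cmod z)\<^sup>2 - (cmod (m + of_real b * z))\<^sup>2)) = 1"
  using assms by (simp add: gauss_ratio_def norm_mult power_mult_distrib flip: exp_add)

text \<open>The factor of \<open>nn_integral_shift_change\<close> is the reciprocal of
  \<open>gauss_ratio\<close> along the shift (\<open>gauss_ratio_change\<close>), which turns the
  change of variables into a statement on the law of the output.\<close>

lemma nn_integral_shift_law:
  assumes f [measurable]: "f \<in> borel_measurable (noise N)" and b: "0 < b"
  shows "(\<integral>\<^sup>+z. f (\<lambda>j\<in>{1..N}. m j + of_real b * z j) \<partial>noise N) =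
    (\<integral>\<^sup>+y. f y * ennreal (\<Prod>j\<in>{1..N}. gauss_ratio (b\<^sup>2) (m j) (y j)) \<partial>noise N)"
proof -
  let ?g = "\<lambda>y. f y * ennreal (\<Prod>j\<in>{1..N}. gauss_ratio (b\<^sup>2) (m j) (y j))"
  have g: "?g \<in> borel_measurable (noise N)"
  proof -
    have "(\<lambda>y. \<Prod>j\<in>{1..N}. gauss_ratio (b\<^sup>2) (m j) (y j)) \<in> borel_measurable (noise N)"
      by (intro borel_measurable_prod gauss_ratio_measurable measurable_noise_component) auto
    then show ?thesis by measurable
  qed
  have "(\<Prod>j\<in>{1..N}. gauss_ratio (b\<^sup>2) (m j) ((\<lambda>j\<in>{1..N}. m j + of_real b * z j) j)) *
     (\<Prod>j\<in>{1..N}. b\<^sup>2 * exp ((cmod (z j))\<^sup>2 - (cmod (m j + of_real b * z j))\<^sup>2)) = 1" for z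
    using b by (simp add: gauss_ratio_change flip: prod.distrib)
  then have "?g (\<lambda>j\<in>{1..N}. m j + of_real b * z j) *
      ennreal (\<Prod>j\<in>{1..N}. b\<^sup>2 * exp ((cmod (z j))\<^sup>2 - (cmod (m j + of_real b * z j))\<^sup>2)) =
      f (\<lambda>j\<in>{1..N}. m j + of_real b * z j)" for z
    using b by (simp add: mult.assoc prod_nonneg flip: ennreal_mult'')
  then show ?thesis
    using nn_integral_shift_change[OF g b, of m] by simp
qed

text \<open>The counting step of the converse: the reference law is the same for all messages, so
  they can be summed under the integral, where the gains add up to at most their number.\<close>

lemma sum_ratio_le:
  fixes g :: "'w \<Rightarrow> (nat \<Rightarrow> complex) \<Rightarrow> real"
  assumes v: "0 < v" and g [measurable]: "\<And>w. g w \<in> borel_measurable (noise N)"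
    and g0: "\<And>w y. 0 \<le> g w y" and le: "\<And>y. (\<Sum>w\<in>W. g w y) \<le> card W"
  shows "(\<Sum>w\<in>W. \<integral>\<^sup>+y. ennreal (g w y * (\<Prod>j\<in>{1..N}. gauss_ratio v (m j) (y j))) \<partial>noise N) \<le> ennreal (card W)"
proof -
  let ?p = "\<lambda>y. \<Prod>j\<in>{1..N}. gauss_ratio v (m j) (y j)"
  have [measurable]: "?p \<in> borel_measurable (noise N)"
    by (intro borel_measurable_prod gauss_ratio_measurable measurable_noise_component) auto
  have p: "0 \<le> ?p y" for y
    using v by (intro prod_nonneg) (auto intro: less_imp_le gauss_ratio_pos)
  have "(\<Sum>w\<in>W. \<integral>\<^sup>+y. ennreal (g w y * ?p y) \<partial>noise N) = (\<integral>\<^sup>+y. (\<Sum>w\<in>W. ennreal (g w y * ?p y)) \<partial>noise N)"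
    by (rule nn_integral_sum[symmetric]) measurable
  also have "\<dots> \<le> (\<integral>\<^sup>+y. ennreal (card W) * ennreal (?p y) \<partial>noise N)"
  proof (rule nn_integral_mono)
    fix y
    have "(\<Sum>w\<in>W. ennreal (g w y * ?p y)) = ennreal ((\<Sum>w\<in>W. g w y) * ?p y)"
      using g0 p by (simp add: sum_distrib_right)
    also have "\<dots> \<le> ennreal (card W * ?p y)"
      using le p by (intro ennreal_leI mult_right_mono)
    finally show "(\<Sum>w\<in>W. ennreal (g w y * ?p y)) \<le> ennreal (card W) * ennreal (?p y)"
      by (simp add: ennreal_mult')
  qed
  also have "\<dots> = ennreal (card W)"
    by (subst nn_integral_cmult) (measurable, simp add: nn_integral_noise_gauss_ratio[OF v])
  finally show ?thesis .
qed

text \<open>Only the total \<open>T\<close> of the logarithms is assumed integrable. The single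
  logarithms contain log-densities that cancel in the total, so \<open>ln x <= x - 1\<close> is
  applied inside the integral and only the upper bounds are integrated separately.\<close>

lemma (in prob_space) sum_log_le:
  fixes G :: "'i \<Rightarrow> 'w \<Rightarrow> 'a \<Rightarrow> real"
  assumes fin: "finite I" "finite W"
    and meas: "\<And>i w. i \<in> I \<Longrightarrow> w \<in> W \<Longrightarrow> G i w \<in> borel_measurable M"
    and pos: "\<And>i w x. i \<in> I \<Longrightarrow> w \<in> W \<Longrightarrow> x \<in> space M \<Longrightarrow> 0 < G i w x"
    and le: "\<And>i. i \<in> I \<Longrightarrow> (\<Sum>w\<in>W. \<integral>\<^sup>+x. ennreal (G i w x) \<partial>M) \<le> ennreal (card W)"
    and T: "\<And>w. w \<in> W \<Longrightarrow> integrable M (T w)"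
    and T_eq: "\<And>w x. w \<in> W \<Longrightarrow> x \<in> space M \<Longrightarrow> T w x = (\<Sum>i\<in>I. ln (G i w x))"
  shows "(\<Sum>w\<in>W. \<integral>x. T w x \<partial>M) \<le> 0"
proof -
  have fin_int: "(\<integral>\<^sup>+x. ennreal (G i w x) \<partial>M) < \<infinity>" if "i \<in> I" "w \<in> W" for i w
  proof -
    have "(\<integral>\<^sup>+x. ennreal (G i w x) \<partial>M) \<le> (\<Sum>w\<in>W. \<integral>\<^sup>+x. ennreal (G i w x) \<partial>M)"
      using that fin by (intro member_le_sum) auto
    also have "\<dots> \<le> ennreal (card W)" by (rule le[OF that(1)])
    finally show ?thesis by (metis ennreal_less_top infinity_ennreal_def le_less_trans)
  qed
  have int: "integrable M (G i w)" if "i \<in> I" "w \<in> W" for i w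
    using fin_int[OF that] pos[OF that] meas[OF that]
    by (intro integrableI_nonneg) (auto intro!: AE_I2 less_imp_le)
  have eq: "(\<integral>\<^sup>+x. ennreal (G i w x) \<partial>M) = ennreal (\<integral>x. G i w x \<partial>M)" if "i \<in> I" "w \<in> W" for i w
    using int[OF that] pos[OF that] by (intro nn_integral_eq_integral) (auto intro!: AE_I2 less_imp_le)
  have nonneg: "0 \<le> (\<integral>x. G i w x \<partial>M)" if "i \<in> I" "w \<in> W" for i w
    using pos[OF that] by (intro integral_nonneg_AE AE_I2) (auto intro: less_imp_le)
  have sum_le: "(\<Sum>w\<in>W. \<integral>x. G i w x \<partial>M) \<le> card W" if i: "i \<in> I" for i
  proof -
    have "ennreal (\<Sum>w\<in>W. \<integral>x. G i w x \<partial>M) = (\<Sum>w\<in>W. \<integral>\<^sup>+x. ennreal (G i w x) \<partial>M)"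
      using i nonneg eq by simp
    also have "\<dots> \<le> ennreal (card W)" by (rule le[OF i])
    finally show ?thesis by (simp add: ennreal_le_iff)
  qed
  have "(\<integral>x. T w x \<partial>M) \<le> (\<Sum>i\<in>I. (\<integral>x. G i w x \<partial>M) - 1)" if w: "w \<in> W" for w
  proof -
    have "(\<integral>x. T w x \<partial>M) \<le> (\<integral>x. (\<Sum>i\<in>I. G i w x - 1) \<partial>M)"
    proof (rule integral_mono)
      fix x assume "x \<in> space M"
      then show "T w x \<le> (\<Sum>i\<in>I. G i w x - 1)"
        unfolding T_eq[OF w \<open>x \<in> space M\<close>] by (intro sum_mono ln_le_minus_one pos w)
    qed (use T w int in auto)
    also have "\<dots> = (\<Sum>i\<in>I. (\<integral>x. G i w x \<partial>M) - 1)"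
      using int w by (simp add: prob_space)
    finally show ?thesis .
  qed
  then have "(\<Sum>w\<in>W. \<integral>x. T w x \<partial>M) \<le> (\<Sum>w\<in>W. \<Sum>i\<in>I. (\<integral>x. G i w x \<partial>M) - 1)"
    by (rule sum_mono)
  also have "\<dots> = (\<Sum>i\<in>I. (\<Sum>w\<in>W. \<integral>x. G i w x \<partial>M) - card W)"
    by (subst sum.swap) (simp add: sum_subtractf)
  also have "\<dots> \<le> 0"
    using sum_le by (intro sum_nonpos) simp
  finally show ?thesis .
qed

subsection \<open>Likelihood ratios of a feedback code\<close>

locale feedback_code =
  fixes gd gc :: complex and P :: real and N :: nat and R1 R2 :: real and C :: fb_code
  assumes valid: "valid_code gd gc P N R1 R2 C"
begin

abbreviation "W1 \<equiv> msgs N R1"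
abbreviation "W2 \<equiv> msgs N R2"

text \<open>Here \<open>s\<close> plays the role of \<open>gc X2 + Z1\<close>: all of \<open>X1\<close> and \<open>Y1\<close> is a function of \<open>W1\<close> and \<open>s\<close>.\<close>

definition "out w s j = feedback (\<lambda>j p. gd * enc1 C j w p) 1 s j"
definition "inp w s j = enc1 C j w (\<lambda>i\<in>{1..<j}. out w s i)"
definition "outs w s = (\<lambda>j\<in>{1..N}. out w s j)"
definition "obs w z = (\<lambda>j\<in>{1..N}. gc * enc2 C j w + z j)"

lemma out_eq: "out w s j = gd * inp w s j + s j"
  unfolding inp_def out_def by (subst feedback.simps) simp

lemma enc1_measurable: "j \<in> {1..N} \<Longrightarrow> enc1 C j w \<in> borel_measurable (\<Pi>\<^sub>M i\<in>{1..<j}. borel)"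
  using valid by (auto simp: valid_code_def)

lemma out_measurable: "j \<in> {1..N} \<Longrightarrow> (\<lambda>s. out w s j) \<in> borel_measurable (noise N)"
  unfolding out_def by (rule measurable_feedback) (intro borel_measurable_times borel_measurable_const enc1_measurable)

lemma outs_measurable: "outs w \<in> measurable (noise N) (noise N)"
  unfolding outs_def out_def by (rule measurable_feedback_seq) (intro borel_measurable_times borel_measurable_const enc1_measurable)

lemma inp_measurable:
  assumes "j \<in> {1..N}" shows "(\<lambda>s. inp w s j) \<in> borel_measurable (noise N)"
proof -
  have "(\<lambda>s. \<lambda>i\<in>{1..<j}. out w s i) \<in> measurable (noise N) (\<Pi>\<^sub>M i\<in>{1..<j}. borel)"
    using assms by (intro measurable_restrict out_measurable) auto
  from measurable_compose[OF this enc1_measurable[OF assms]] show ?thesis by (simp add: inp_def)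
qed

lemma obs_measurable: "obs w \<in> measurable (noise N) (noise N)"
  using measurable_shift_noise[where N = N and m = "\<lambda>j. gc * enc2 C j w" and c = 1] by (simp add: obs_def[abs_def])

lemma obs_app: "j \<in> {1..N} \<Longrightarrow> obs w z j = gc * enc2 C j w + z j"
  by (simp add: obs_def)

text \<open>The second input does not depend on outputs, so it can be counted as noise or as part of
  the mean. For fixed messages, the map from Z1 to Y1 is therefore a feedback map with unit gain as
  well.\<close>

lemma out_obs:
  "j \<in> {1..N} \<Longrightarrow> out w1 (obs w2 z) j = feedback (\<lambda>j p. gd * enc1 C j w1 p + gc * enc2 C j w2) 1 z j"
proof (induction j rule: less_induct)
  case (less j)
  have "(\<lambda>i\<in>{1..<j}. feedback (\<lambda>j p. gd * enc1 C j w1 p) 1 (obs w2 z) i) =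
      (\<lambda>i\<in>{1..<j}. feedback (\<lambda>j p. gd * enc1 C j w1 p + gc * enc2 C j w2) 1 z i)"
    using less by (intro restrict_ext) (auto simp: out_def)
  then show ?case
    using less.prems unfolding out_def
    by (subst (1 2) feedback.simps) (simp add: obs_app algebra_simps)
qed

lemma Y1_eq_out: "j \<in> {1..N} \<Longrightarrow> Y1 gd gc C (w1, w2, z1, z2) j = out w1 (obs w2 z1) j"
proof (induction j rule: less_induct)
  case (less j)
  have "(\<lambda>i\<in>{1..<j}. Y1 gd gc C (w1, w2, z1, z2) i) = (\<lambda>i\<in>{1..<j}. out w1 (obs w2 z1) i)"
    using less by (intro restrict_ext) auto
  then show ?case
    using less.prems by (simp add: Y1.simps[of _ _ _ _ _ _ _ j] out_eq[of _ _ j] inp_def obs_app)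
qed

lemma X1_eq_inp: "j \<in> {1..N} \<Longrightarrow> X1 gd gc C (w1, w2, z1, z2) j = inp w1 (obs w2 z1) j"
  unfolding X1.simps inp_def by (rule arg_cong[of _ _ "enc1 C j w1"], rule restrict_ext) (simp add: Y1_eq_out)

section \<open>Message sets and decoding gains\<close>

lemma finite_msgs: "finite (msgs N R)"
  by (simp add: msgs_def)

lemma card_msgs: "real (card (msgs N R)) \<ge> 2 powr (real N * R)" "card (msgs N R) > 0"
proof -
  have "0 < \<lceil>2 powr (real N * R)\<rceil>" by simp
  then show "card (msgs N R) > 0" by (simp add: msgs_def)
  show "real (card (msgs N R)) \<ge> 2 powr (real N * R)"
    unfolding msgs_def by simp
qed

text \<open>The logarithm of the gain has mean about \<open>N * R\<close> when the error is small, while the gains of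
  all messages add up to at most their number for every \<open>y\<close>; this replaces Fano's inequality.\<close>

definition "gain1 w y = (if dec1 C y = w then real (card W1) / 2 else 1 / 2)"
definition "gain2 w y = (if dec2 C y = w then real (card W2) / 2 else 1 / 2)"

lemma gain_pos: "0 < gain1 w y" "0 < gain2 w y"
  using card_msgs(2)[of R1] card_msgs(2)[of R2] by (auto simp: gain1_def gain2_def)

text \<open>At most one message is the decoded one, which gives half of the bound; the floor 1/2 of
  all the others gives the other half. The floor keeps logarithms finite on decoding errors and
  costs \<open>ln 2\<close> per gain.\<close>

lemma sum_gain_aux:
  assumes "finite W" "W \<noteq> {}"
  shows "(\<Sum>w\<in>W. if d = w then real (card W) / 2 else 1 / 2) \<le> card W"
proof -
  have "(\<Sum>w\<in>W. if d = w then real (card W) / 2 else 1 / 2) \<le> (\<Sum>w\<in>W. (if d = w then real (card W) / 2 else 0) + 1 / 2)"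
    by (intro sum_mono) auto
  also have "\<dots> \<le> card W" using assms by (simp add: sum.distrib)
  finally show ?thesis .
qed

lemma sum_gain: "(\<Sum>w\<in>W1. gain1 w y) \<le> card W1" "(\<Sum>w\<in>W2. gain2 w y) \<le> card W2"
  unfolding gain1_def gain2_def using card_msgs(2)[of R1] card_msgs(2)[of R2]
  by (auto intro!: sum_gain_aux finite_msgs)

lemma gain_measurable: "gain1 w \<in> borel_measurable (noise N)" "gain2 w \<in> borel_measurable (noise N)"
proof -
  have d: "dec1 C \<in> measurable (noise N) (count_space UNIV)" "dec2 C \<in> measurable (noise N) (count_space UNIV)"
    using valid measurable_cong_sets[OF sets_noise[symmetric] refl] by (auto simp: valid_code_def)
  have "(\<lambda>y. (\<lambda>n. if n = w then real (card W1) / 2 else 1 / 2) (dec1 C y)) \<in> borel_measurable (noise N)"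
    by (rule measurable_compose[OF d(1)]) simp
  moreover have "(\<lambda>y. (\<lambda>n. if n = w then real (card W2) / 2 else 1 / 2) (dec2 C y)) \<in> borel_measurable (noise N)"
    by (rule measurable_compose[OF d(2)]) simp
  ultimately show "gain1 w \<in> borel_measurable (noise N)" "gain2 w \<in> borel_measurable (noise N)"
    by (simp_all add: gain1_def[abs_def] gain2_def[abs_def])
qed

lemma noise_prod_measurable:
  assumes "\<And>j. j \<in> {1..N} \<Longrightarrow> f j \<in> borel_measurable M"
  shows "(\<lambda>x. ennreal (\<Prod>j\<in>{1..N}. f j x)) \<in> borel_measurable M"
  using assms by (intro measurable_compose[OF _ measurable_ennreal] borel_measurable_prod)

lemma sum_gain1_ratio_le:
  "0 < v \<Longrightarrow> (\<Sum>w\<in>W1. \<integral>\<^sup>+y. ennreal (gain1 w y * (\<Prod>j\<in>{1..N}. gauss_ratio v (m j) (y j))) \<partial>noise N) \<le> ennreal (card W1)"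
  by (rule sum_ratio_le) (auto simp: gain_pos less_imp_le sum_gain intro: gain_measurable)

lemma sum_gain2_ratio_le:
  "0 < v \<Longrightarrow> (\<Sum>w\<in>W2. \<integral>\<^sup>+y. ennreal (gain2 w y * (\<Prod>j\<in>{1..N}. gauss_ratio v (m j) (y j))) \<partial>noise N) \<le> ennreal (card W2)"
  by (rule sum_ratio_le) (auto simp: gain_pos less_imp_le sum_gain intro: gain_measurable)

section \<open>Densities of the effective noise and of the genie signal\<close>

lemma nn_integral_out_obs:
  assumes f: "f \<in> borel_measurable (noise N)"
  shows "(\<integral>\<^sup>+z. f (outs w1 (obs w2 z)) *
      ennreal (\<Prod>j\<in>{1..N}. exp ((cmod (z j))\<^sup>2 - (cmod (out w1 (obs w2 z) j))\<^sup>2)) \<partial>noise N) = (\<integral>\<^sup>+y. f y \<partial>noise N)"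
proof -
  have "outs w1 (obs w2 z) = (\<lambda>j\<in>{1..N}. feedback (\<lambda>j p. gd * enc1 C j w1 p + gc * enc2 C j w2) 1 z j)" for z
    unfolding outs_def by (intro restrict_ext out_obs)
  moreover have "(\<Prod>j\<in>{1..N}. exp ((cmod (z j))\<^sup>2 - (cmod (out w1 (obs w2 z) j))\<^sup>2)) =
    (\<Prod>j\<in>{1..N}. 1\<^sup>2 * exp ((cmod (z j))\<^sup>2 - (cmod (feedback (\<lambda>j p. gd * enc1 C j w1 p + gc * enc2 C j w2) 1 z j))\<^sup>2))" for z
    by (intro prod.cong refl) (simp add: out_obs)
  ultimately show ?thesis
    using nn_integral_feedback[of N "\<lambda>j p. gd * enc1 C j w1 p + gc * enc2 C j w2" f 1] f enc1_measurable
    by (simp del: atLeastAtMost_iff)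
qed

lemma nn_integral_outs:
  assumes f: "f \<in> borel_measurable (noise N)"
  shows "(\<integral>\<^sup>+s. f (outs w s) * ennreal (\<Prod>j\<in>{1..N}. exp ((cmod (s j))\<^sup>2 - (cmod (out w s j))\<^sup>2)) \<partial>noise N) = (\<integral>\<^sup>+y. f y \<partial>noise N)"
  using nn_integral_feedback[of N "\<lambda>j p. gd * enc1 C j w p" f 1] f enc1_measurable
  by (simp add: outs_def out_def del: atLeastAtMost_iff)

text \<open>Densities relative to the noise law: \<open>obs_dens\<close> is that of \<open>gc X2 + Z1\<close>, and \<open>inp_dens k w2\<close>
  is that of \<open>k X1 + V\<close> given \<open>W2 = w2\<close>.\<close>

definition "obs_dens s = (\<Sum>w\<in>W2. \<Prod>j\<in>{1..N}. gauss_ratio 1 (gc * enc2 C j w) (s j)) / card W2"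

definition "inp_int k w1 w2 q = enn2real (\<integral>\<^sup>+z. ennreal (\<Prod>j\<in>{1..N}. gauss_ratio 1 (k * inp w1 (obs w2 z) j) (q j)) \<partial>noise N)"

definition "inp_dens k w2 q = (\<Sum>w1\<in>W1. inp_int k w1 w2 q) / card W1"

text \<open>The genie signal Q divided by \<open>b\<close>, when \<open>k = gc / b\<close>: after
  this scaling its noise \<open>v\<close> has unit variance.\<close>

definition "relay k w1 w2 z v = (\<lambda>j\<in>{1..N}. k * inp w1 (obs w2 z) j + v j)"

lemma W_ne: "W1 \<noteq> {}" "W2 \<noteq> {}" "0 < card W1" "0 < card W2"
  using card_msgs(2)[of R1] card_msgs(2)[of R2] by auto

lemma ratio_prod_pos: "0 < (\<Prod>j\<in>{1..N}. gauss_ratio 1 (m j) (s j))"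
  by (intro prod_pos gauss_ratio_pos) auto

lemma obs_dens_pos: "0 < obs_dens s"
  unfolding obs_dens_def using W_ne by (intro divide_pos_pos sum_pos finite_msgs ratio_prod_pos) auto

lemma obs_dens_measurable [measurable]: "obs_dens \<in> borel_measurable (noise N)"
  unfolding obs_dens_def
  by (intro borel_measurable_divide borel_measurable_sum borel_measurable_prod gauss_ratio_measurable
      measurable_noise_component borel_measurable_const) auto

lemma inp_obs_measurable: "j \<in> {1..N} \<Longrightarrow> (\<lambda>z. inp w1 (obs w2 z) j) \<in> borel_measurable (noise N)"
  by (rule measurable_compose[OF obs_measurable inp_measurable])

lemma out_obs_measurable: "j \<in> {1..N} \<Longrightarrow> (\<lambda>z. out w1 (obs w2 z) j) \<in> borel_measurable (noise N)"
  by (rule measurable_compose[OF obs_measurable out_measurable])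

lemma relay_measurable [measurable]:
  "(\<lambda>(z, v). relay k w1 w2 z v) \<in> measurable (noise N \<Otimes>\<^sub>M noise N) (noise N)"
proof -
  have "(\<lambda>p. \<lambda>j\<in>{1..N}. k * inp w1 (obs w2 (fst p)) j + snd p j) \<in>
      measurable (noise N \<Otimes>\<^sub>M noise N) (\<Pi>\<^sub>M i\<in>{1..N}. (borel :: complex measure))"
  proof (intro measurable_restrict)
    fix j assume j: "j \<in> {1..N}"
    note [measurable] = measurable_noise_component[OF j] inp_obs_measurable[OF j]
    show "(\<lambda>p. k * inp w1 (obs w2 (fst p)) j + snd p j) \<in> borel_measurable (noise N \<Otimes>\<^sub>M noise N)"
      by measurable
  qed
  moreover have "measurable (noise N \<Otimes>\<^sub>M noise N) (noise N) =
      measurable (noise N \<Otimes>\<^sub>M noise N) (\<Pi>\<^sub>M i\<in>{1..N}. (borel :: complex measure))"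
    by (rule measurable_cong_sets[OF refl sets_noise])
  ultimately show ?thesis
    unfolding relay_def by (simp add: case_prod_beta')
qed

lemma ratio_joint_measurable:
  "(\<lambda>p. ennreal (\<Prod>j\<in>{1..N}. gauss_ratio 1 (k * inp w1 (obs w2 (snd p)) j) (fst p j)))
    \<in> borel_measurable (noise N \<Otimes>\<^sub>M noise N)"
proof (intro noise_prod_measurable)
  fix j assume j: "j \<in> {1..N}"
  note [measurable] = measurable_noise_component[OF j] inp_obs_measurable[OF j]
  show "(\<lambda>p. gauss_ratio 1 (k * inp w1 (obs w2 (snd p)) j) (fst p j)) \<in> borel_measurable (noise N \<Otimes>\<^sub>M noise N)"
    by measurable
qed

lemma inp_int_eq:
  "ennreal (inp_int k w1 w2 q) = (\<integral>\<^sup>+z. ennreal (\<Prod>j\<in>{1..N}. gauss_ratio 1 (k * inp w1 (obs w2 z) j) (q j)) \<partial>noise N)"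
  and inp_int_pos: "q \<in> space (noise N) \<Longrightarrow> 0 < inp_int k w1 w2 q"
proof -
  interpret prob_space "noise N" by (rule prob_space_noise)
  let ?f = "\<lambda>z. \<Prod>j\<in>{1..N}. gauss_ratio 1 (k * inp w1 (obs w2 z) j) (q j)"
  \<comment> \<open>Each ratio is at most \<open>exp ((cmod (q j))\<^sup>2)\<close>, so the integral
    is finite and \<open>enn2real\<close> in \<open>inp_int\<close> loses nothing.\<close>
  have "(\<integral>\<^sup>+z. ennreal (?f z) \<partial>noise N) \<le> (\<integral>\<^sup>+z. ennreal (\<Prod>j\<in>{1..N}. exp ((cmod (q j))\<^sup>2)) \<partial>noise N)"
    by (intro nn_integral_mono ennreal_leI prod_mono) (auto simp: gauss_ratio_def)
  also have "\<dots> < top" by (simp add: emeasure_space_1)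
  finally have fin: "(\<integral>\<^sup>+z. ennreal (?f z) \<partial>noise N) < top" .
  then show eq: "ennreal (inp_int k w1 w2 q) = (\<integral>\<^sup>+z. ennreal (?f z) \<partial>noise N)"
    by (simp add: inp_int_def)
  assume q: "q \<in> space (noise N)"
  have meas: "(\<lambda>z. ennreal (?f z)) \<in> borel_measurable (noise N)"
    using measurable_compose[OF measurable_Pair1'[OF q] ratio_joint_measurable] by simp
  have "(\<integral>\<^sup>+z. ennreal (?f z) \<partial>noise N) \<noteq> 0"
  proof
    assume "(\<integral>\<^sup>+z. ennreal (?f z) \<partial>noise N) = 0"
    then have "AE z in noise N. ennreal (?f z) = 0" using nn_integral_0_iff_AE[OF meas] by simp
    moreover have "(ennreal (?f z) = 0) = False" for z
      using ratio_prod_pos[of "\<lambda>j. k * inp w1 (obs w2 z) j" q] by (simp add: ennreal_eq_0_iff not_le)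
    ultimately have "AE z in noise N. False" by (simp only:)
    then show False by simp
  qed
  then show "0 < inp_int k w1 w2 q" using eq by (metis ennreal_0 ennreal_less_zero_iff ennreal_neg not_less not_gr_zero)
qed

lemma inp_int_measurable [measurable]: "inp_int k w1 w2 \<in> borel_measurable (noise N)"
proof -
  interpret prob_space "noise N" by (rule prob_space_noise)
  have "(\<lambda>q. \<integral>\<^sup>+z. ennreal (\<Prod>j\<in>{1..N}. gauss_ratio 1 (k * inp w1 (obs w2 z) j) (q j)) \<partial>noise N) \<in> borel_measurable (noise N)"
    by (rule borel_measurable_nn_integral) (use ratio_joint_measurable in \<open>simp add: case_prod_beta'\<close>)
  then show ?thesis unfolding inp_int_def by measurable
qed

lemma inp_dens_measurable [measurable]: "inp_dens k w2 \<in> borel_measurable (noise N)"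
  unfolding inp_dens_def by measurable

lemma inp_dens_pos: "q \<in> space (noise N) \<Longrightarrow> 0 < inp_dens k w2 q"
  unfolding inp_dens_def using W_ne by (intro divide_pos_pos sum_pos finite_msgs inp_int_pos) auto

text \<open>Consequently an integrand divided by \<open>obs_dens\<close> is averaged as if S were
  pure noise, and the second message disappears from the law.\<close>

lemma sum_nn_integral_obs:
  assumes [measurable]: "f \<in> borel_measurable (noise N)"
  shows "(\<Sum>w\<in>W2. \<integral>\<^sup>+z. f (obs w z) \<partial>noise N) = of_nat (card W2) * (\<integral>\<^sup>+s. f s * ennreal (obs_dens s) \<partial>noise N)"
proof -
  let ?p = "\<lambda>w s. \<Prod>j\<in>{1..N}. gauss_ratio 1 (gc * enc2 C j w) (s j)"
  have [measurable]: "?p w \<in> borel_measurable (noise N)" for w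
    by (intro borel_measurable_prod gauss_ratio_measurable measurable_noise_component borel_measurable_const) auto
  have "(\<integral>\<^sup>+z. f (obs w z) \<partial>noise N) = (\<integral>\<^sup>+s. f s * ennreal (?p w s) \<partial>noise N)" for w
    using nn_integral_shift_law[of f N 1 "\<lambda>j. gc * enc2 C j w"] by (simp add: obs_def[abs_def])
  then have "(\<Sum>w\<in>W2. \<integral>\<^sup>+z. f (obs w z) \<partial>noise N) = (\<integral>\<^sup>+s. (\<Sum>w\<in>W2. f s * ennreal (?p w s)) \<partial>noise N)"
    by (simp add: nn_integral_sum)
  also have "\<dots> = (\<integral>\<^sup>+s. of_nat (card W2) * (f s * ennreal (obs_dens s)) \<partial>noise N)"
  proof (rule nn_integral_cong)
    fix s
    have "(\<Sum>w\<in>W2. ennreal (?p w s)) = ennreal (card W2 * obs_dens s)"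
      using W_ne ratio_prod_pos[THEN less_imp_le] by (simp add: obs_dens_def)
    then show "(\<Sum>w\<in>W2. f s * ennreal (?p w s)) = of_nat (card W2) * (f s * ennreal (obs_dens s))"
      by (simp add: sum_distrib_left[symmetric] ennreal_mult' ennreal_of_nat_eq_real_of_nat mult_ac)
  qed
  also have "\<dots> = of_nat (card W2) * (\<integral>\<^sup>+s. f s * ennreal (obs_dens s) \<partial>noise N)"
    by (rule nn_integral_cmult) measurable
  finally show ?thesis .
qed

text \<open>The counterpart for Q. The second message stays fixed, because the density of Q is taken
  given W2; only the first message and both noises are averaged.\<close>

lemma sum_nn_integral_relay:
  assumes [measurable]: "f \<in> borel_measurable (noise N)"
  shows "(\<Sum>w1\<in>W1. \<integral>\<^sup>+z. \<integral>\<^sup>+v. f (relay k w1 w2 z v) \<partial>noise N \<partial>noise N) =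
    of_nat (card W1) * (\<integral>\<^sup>+q. f q * ennreal (inp_dens k w2 q) \<partial>noise N)"
proof -
  interpret prob_space "noise N" by (rule prob_space_noise)
  interpret P: pair_sigma_finite "noise N" "noise N" by standard
  let ?p = "\<lambda>w1 q z. \<Prod>j\<in>{1..N}. gauss_ratio 1 (k * inp w1 (obs w2 z) j) (q j)"
  note [measurable] = ratio_joint_measurable
  have "(\<integral>\<^sup>+z. \<integral>\<^sup>+v. f (relay k w1 w2 z v) \<partial>noise N \<partial>noise N) = (\<integral>\<^sup>+q. f q * ennreal (inp_int k w1 w2 q) \<partial>noise N)" for w1
  proof -
    have "(\<integral>\<^sup>+z. \<integral>\<^sup>+v. f (relay k w1 w2 z v) \<partial>noise N \<partial>noise N) =
        (\<integral>\<^sup>+z. \<integral>\<^sup>+q. f q * ennreal (?p w1 q z) \<partial>noise N \<partial>noise N)"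
      using nn_integral_shift_law[of f N 1 "\<lambda>j. k * inp w1 (obs w2 _) j"] by (simp add: relay_def)
    also have "\<dots> = (\<integral>\<^sup>+q. \<integral>\<^sup>+z. f q * ennreal (?p w1 q z) \<partial>noise N \<partial>noise N)"
    proof (rule P.Fubini')
      have "(\<lambda>p. f (fst p) * ennreal (?p w1 (fst p) (snd p))) \<in> borel_measurable (noise N \<Otimes>\<^sub>M noise N)"
        by measurable
      then show "(\<lambda>(q, z). f q * ennreal (?p w1 q z)) \<in> borel_measurable (noise N \<Otimes>\<^sub>M noise N)"
        by (simp add: case_prod_beta')
    qed
    also have "\<dots> = (\<integral>\<^sup>+q. f q * ennreal (inp_int k w1 w2 q) \<partial>noise N)"
    proof (rule nn_integral_cong)
      fix q assume q: "q \<in> space (noise N)"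
      show "(\<integral>\<^sup>+z. f q * ennreal (?p w1 q z) \<partial>noise N) = f q * ennreal (inp_int k w1 w2 q)"
        unfolding inp_int_eq
        by (rule nn_integral_cmult) (use measurable_compose[OF measurable_Pair1'[OF q] ratio_joint_measurable] in simp)
    qed
    finally show ?thesis .
  qed
  then have "(\<Sum>w1\<in>W1. \<integral>\<^sup>+z. \<integral>\<^sup>+v. f (relay k w1 w2 z v) \<partial>noise N \<partial>noise N) =
      (\<integral>\<^sup>+q. (\<Sum>w1\<in>W1. f q * ennreal (inp_int k w1 w2 q)) \<partial>noise N)"
    by (simp add: nn_integral_sum)
  also have "\<dots> = (\<integral>\<^sup>+q. of_nat (card W1) * (f q * ennreal (inp_dens k w2 q)) \<partial>noise N)"
  proof (rule nn_integral_cong)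
    fix q assume "q \<in> space (noise N)"
    then have "(\<Sum>w1\<in>W1. ennreal (inp_int k w1 w2 q)) = ennreal (card W1 * inp_dens k w2 q)"
      using W_ne inp_int_pos[THEN less_imp_le] by (simp add: inp_dens_def)
    then show "(\<Sum>w1\<in>W1. f q * ennreal (inp_int k w1 w2 q)) = of_nat (card W1) * (f q * ennreal (inp_dens k w2 q))"
      by (simp add: sum_distrib_left[symmetric] ennreal_mult' ennreal_of_nat_eq_real_of_nat mult_ac)
  qed
  also have "\<dots> = of_nat (card W1) * (\<integral>\<^sup>+q. f q * ennreal (inp_dens k w2 q) \<partial>noise N)"
    by (rule nn_integral_cmult) measurable
  finally show ?thesis .
qed

lemma nn_integral_obs_dens: "(\<integral>\<^sup>+s. ennreal (obs_dens s) \<partial>noise N) = 1"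
proof -
  interpret prob_space "noise N" by (rule prob_space_noise)
  have "of_nat (card W2) * (\<integral>\<^sup>+s. ennreal (obs_dens s) \<partial>noise N) = of_nat (card W2) * 1"
    using sum_nn_integral_obs[of "\<lambda>_. 1"] by (simp add: emeasure_space_1)
  then show ?thesis using W_ne
    by (subst (asm) ennreal_mult_cancel_left) (auto simp: ennreal_of_nat_eq_real_of_nat)
qed

lemma nn_integral_inp_dens: "(\<integral>\<^sup>+q. ennreal (inp_dens k w2 q) \<partial>noise N) = 1"
proof -
  interpret prob_space "noise N" by (rule prob_space_noise)
  have "of_nat (card W1) * (\<integral>\<^sup>+q. ennreal (inp_dens k w2 q) \<partial>noise N) = of_nat (card W1) * 1"
    using sum_nn_integral_relay[of "\<lambda>_. 1" k w2] by (simp add: emeasure_space_1)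
  then show ?thesis using W_ne
    by (subst (asm) ennreal_mult_cancel_left) (auto simp: ennreal_of_nat_eq_real_of_nat)
qed

lemma inp_dens_nonneg: "0 \<le> inp_dens k w2 q"
  by (auto simp: inp_dens_def inp_int_def intro!: divide_nonneg_nonneg sum_nonneg)

lemma ennreal_mult4:
  "0 \<le> a \<Longrightarrow> 0 \<le> b \<Longrightarrow> 0 \<le> c \<Longrightarrow> 0 \<le> d \<Longrightarrow> ennreal (a * b * c * d) = ennreal b * ennreal (a * c) * ennreal d"
  by (simp add: ennreal_mult mult_ac)

section \<open>Means of the six likelihood ratios\<close>

text \<open>The density of \<open>CN(0, v)\<close> at \<open>y\<close> over the density of
  \<open>CN(0, 1)\<close> at \<open>z\<close>. If the noise \<open>z\<close> produces the centered
  output \<open>y\<close> with unit gain, this is the likelihood ratio of the reference law against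
  the channel law.\<close>

definition "tilt v z y = exp ((cmod z)\<^sup>2 - (cmod y)\<^sup>2 / v) / v" for v :: real and z y :: complex

lemma tilt_pos: "0 < v \<Longrightarrow> 0 < tilt v z y"
  by (simp add: tilt_def)

lemma tilt_eq: "tilt v z (y - m) = gauss_ratio v m y * exp ((cmod z)\<^sup>2 - (cmod y)\<^sup>2)"
  by (simp add: tilt_def gauss_ratio_def flip: exp_add)

lemma tilt_measurable [measurable (raw)]:
  assumes [measurable]: "f \<in> borel_measurable M" "g \<in> borel_measurable M"
  shows "(\<lambda>x. tilt v (f x) (g x)) \<in> borel_measurable M"
  unfolding tilt_def by measurable

lemma tilt_prod_pos: "0 < v \<Longrightarrow> 0 < (\<Prod>j\<in>{1..N}. tilt v (z j) (y j))"
  by (intro prod_pos tilt_pos) auto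

lemma prod_tilt_eq:
  "(\<Prod>j\<in>{1..N}. tilt v (z j) (y j - m j)) =
    (\<Prod>j\<in>{1..N}. gauss_ratio v (m j) (y j)) * (\<Prod>j\<in>{1..N}. exp ((cmod (z j))\<^sup>2 - (cmod (y j))\<^sup>2))"
  by (simp add: tilt_eq prod.distrib)

lemma gain_ratio_measurable:
  "(\<lambda>y. ennreal (gain1 w y * (\<Prod>j\<in>{1..N}. gauss_ratio v (m j) (y j)))) \<in> borel_measurable (noise N)"
  "(\<lambda>y. ennreal (gain2 w y * (\<Prod>j\<in>{1..N}. gauss_ratio v (m j) (y j)))) \<in> borel_measurable (noise N)"
proof -
  have [measurable]: "(\<lambda>y. \<Prod>j\<in>{1..N}. gauss_ratio v (m j) (y j)) \<in> borel_measurable (noise N)"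
    by (intro borel_measurable_prod gauss_ratio_measurable measurable_noise_component borel_measurable_const) auto
  note [measurable] = gain_measurable
  show "(\<lambda>y. ennreal (gain1 w y * (\<Prod>j\<in>{1..N}. gauss_ratio v (m j) (y j)))) \<in> borel_measurable (noise N)"
    "(\<lambda>y. ennreal (gain2 w y * (\<Prod>j\<in>{1..N}. gauss_ratio v (m j) (y j)))) \<in> borel_measurable (noise N)"
    by measurable
qed

lemma nn_integral_gain1_tilt:
  assumes v: "0 < v"
  shows "(\<integral>\<^sup>+z. ennreal (gain1 w1 (outs w1 (obs w2 z)) * (\<Prod>j\<in>{1..N}. tilt v (z j) (out w1 (obs w2 z) j - m j))) \<partial>noise N)
    = (\<integral>\<^sup>+y. ennreal (gain1 w1 y * (\<Prod>j\<in>{1..N}. gauss_ratio v (m j) (y j))) \<partial>noise N)"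
proof -
  have "ennreal (gain1 w1 (outs w1 (obs w2 z)) * (\<Prod>j\<in>{1..N}. tilt v (z j) (out w1 (obs w2 z) j - m j))) =
    ennreal (gain1 w1 (outs w1 (obs w2 z)) * (\<Prod>j\<in>{1..N}. gauss_ratio v (m j) (outs w1 (obs w2 z) j))) *
    ennreal (\<Prod>j\<in>{1..N}. exp ((cmod (z j))\<^sup>2 - (cmod (out w1 (obs w2 z) j))\<^sup>2))" for z
    unfolding prod_tilt_eq mult.assoc[symmetric]
    by (subst ennreal_mult'') (auto simp: outs_def intro!: prod_nonneg)
  then show ?thesis
    using nn_integral_out_obs[OF gain_ratio_measurable(1)[of w1 v m], of w1 w2] by simp
qed

text \<open>The content of \<open>R1 <= I(W1; Y1 | W2)\<close>: the second message is fixed, and the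
  center \<open>m\<close> may depend on it but not on the first message.\<close>

lemma sum_gain1_tilt_le:
  assumes v: "0 < v"
  shows "(\<Sum>w1\<in>W1. \<integral>\<^sup>+z. ennreal (gain1 w1 (outs w1 (obs w2 z)) *
      (\<Prod>j\<in>{1..N}. tilt v (z j) (out w1 (obs w2 z) j - m j))) \<partial>noise N) \<le> ennreal (card W1)"
  unfolding nn_integral_gain1_tilt[OF v] by (rule sum_gain1_ratio_le[OF v])

text \<open>For \<open>I(W1; Y1)\<close> the noise of the channel is S. Division by
  \<open>obs_dens\<close> turns its law into the Gaussian one, and for fixed first message the map
  from S to Y1 preserves volume.\<close>

lemma sum_gain1_obs_dens_le:
  assumes v: "0 < v"
  shows "(\<Sum>w1\<in>W1. \<Sum>w2\<in>W2. \<integral>\<^sup>+z. ennreal (gain1 w1 (outs w1 (obs w2 z)) *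
      (\<Prod>j\<in>{1..N}. tilt v (obs w2 z j) (out w1 (obs w2 z) j)) / obs_dens (obs w2 z)) \<partial>noise N)
    \<le> ennreal (card W1) * ennreal (card W2)"
proof -
  have "(\<Sum>w2\<in>W2. \<integral>\<^sup>+z. ennreal (gain1 w1 (outs w1 (obs w2 z)) *
      (\<Prod>j\<in>{1..N}. tilt v (obs w2 z j) (out w1 (obs w2 z) j)) / obs_dens (obs w2 z)) \<partial>noise N) =
    of_nat (card W2) * (\<integral>\<^sup>+y. ennreal (gain1 w1 y * (\<Prod>j\<in>{1..N}. gauss_ratio v 0 (y j))) \<partial>noise N)" for w1
  proof -
    let ?F = "\<lambda>s. ennreal (gain1 w1 (outs w1 s) * (\<Prod>j\<in>{1..N}. tilt v (s j) (out w1 s j)) / obs_dens s)"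
    have [measurable]: "(\<lambda>s. \<Prod>j\<in>{1..N}. tilt v (s j) (out w1 s j)) \<in> borel_measurable (noise N)"
      by (intro borel_measurable_prod tilt_measurable measurable_noise_component out_measurable) auto
    note [measurable] = gain_measurable outs_measurable
    have "(\<Sum>w2\<in>W2. \<integral>\<^sup>+z. ?F (obs w2 z) \<partial>noise N) = of_nat (card W2) * (\<integral>\<^sup>+s. ?F s * ennreal (obs_dens s) \<partial>noise N)"
      by (rule sum_nn_integral_obs) measurable
    moreover have "?F s * ennreal (obs_dens s) = ennreal (gain1 w1 (outs w1 s) * (\<Prod>j\<in>{1..N}. gauss_ratio v 0 (outs w1 s j))) *
       ennreal (\<Prod>j\<in>{1..N}. exp ((cmod (s j))\<^sup>2 - (cmod (out w1 s j))\<^sup>2))" for s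
    proof -
      have "?F s * ennreal (obs_dens s) = ennreal (gain1 w1 (outs w1 s) * (\<Prod>j\<in>{1..N}. tilt v (s j) (out w1 s j - 0)))"
        using obs_dens_pos[of s] by (simp flip: ennreal_mult'')
      then show ?thesis
        unfolding prod_tilt_eq by (subst (asm) mult.assoc[symmetric]) (simp add: outs_def prod_nonneg ennreal_mult'')
    qed
    ultimately show ?thesis
      using nn_integral_outs[OF gain_ratio_measurable(1)[of w1 v "\<lambda>_. 0"], of w1] by simp
  qed
  then show ?thesis
    using mult_right_mono[OF sum_gain1_ratio_le[OF v, of "\<lambda>_. 0"], of "ennreal (card W2)"]
    by (simp add: sum_distrib_left[symmetric] mult.commute ennreal_of_nat_eq_real_of_nat)
qed

text \<open>For \<open>I(W1; Y1, Q | W2)\<close> the reference is the law of Q given W2 followed by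
  a Gaussian around \<open>c * Q + m\<close> for Y1. For fixed \<open>z\<close> the noise
  \<open>n\<close> is exchanged for Q; then, for fixed Q, the noise \<open>z\<close> for Y1.\<close>

lemma sum_gain1_inp_dens_le:
  assumes v: "0 < v"
  shows "(\<Sum>w1\<in>W1. \<integral>\<^sup>+z. \<integral>\<^sup>+n. ennreal (gain1 w1 (outs w1 (obs w2 z)) * inp_dens k w2 (relay k w1 w2 z n) *
      (\<Prod>j\<in>{1..N}. tilt v (z j) (out w1 (obs w2 z) j - (c * relay k w1 w2 z n j + m j))) *
      (\<Prod>j\<in>{1..N}. exp ((cmod (n j))\<^sup>2 - (cmod (relay k w1 w2 z n j))\<^sup>2))) \<partial>noise N \<partial>noise N) \<le> ennreal (card W1)"
proof -
  interpret prob_space "noise N" by (rule prob_space_noise)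
  interpret P: pair_sigma_finite "noise N" "noise N" by standard
  note [measurable] = gain_measurable outs_measurable obs_measurable
  let ?g = "\<lambda>w1 q z. gain1 w1 (outs w1 (obs w2 z)) * (\<Prod>j\<in>{1..N}. tilt v (z j) (out w1 (obs w2 z) j - (c * q j + m j)))"
  have tm [measurable]: "(\<lambda>p. \<Prod>j\<in>{1..N}. tilt v (snd p j) (out w1 (obs w2 (snd p)) j - (c * fst p j + m j)))
      \<in> borel_measurable (noise N \<Otimes>\<^sub>M noise N)" for w1
  proof (intro borel_measurable_prod)
    fix j assume j: "j \<in> {1..N}"
    note [measurable] = measurable_noise_component[OF j] out_obs_measurable[OF j]
    show "(\<lambda>p. tilt v (snd p j) (out w1 (obs w2 (snd p)) j - (c * fst p j + m j))) \<in> borel_measurable (noise N \<Otimes>\<^sub>M noise N)"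
      by measurable
  qed
  have gm: "(\<lambda>(q, z). ennreal (inp_dens k w2 q) * ennreal (?g w1 q z)) \<in> borel_measurable (noise N \<Otimes>\<^sub>M noise N)" for w1
    unfolding case_prod_beta' by measurable
  have "(\<integral>\<^sup>+n. ennreal (gain1 w1 (outs w1 (obs w2 z)) * inp_dens k w2 (relay k w1 w2 z n) *
      (\<Prod>j\<in>{1..N}. tilt v (z j) (out w1 (obs w2 z) j - (c * relay k w1 w2 z n j + m j))) *
      (\<Prod>j\<in>{1..N}. exp ((cmod (n j))\<^sup>2 - (cmod (relay k w1 w2 z n j))\<^sup>2))) \<partial>noise N) =
    (\<integral>\<^sup>+q. ennreal (inp_dens k w2 q) * ennreal (?g w1 q z) \<partial>noise N)" if z: "z \<in> space (noise N)" for w1 z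
  proof -
    let ?h = "\<lambda>q. ennreal (inp_dens k w2 q) * ennreal (?g w1 q z)"
    have h: "?h \<in> borel_measurable (noise N)"
      using measurable_compose[OF measurable_Pair2'[OF z] gm[of w1]] by simp
    have "(\<integral>\<^sup>+n. ?h (relay k w1 w2 z n) * ennreal (\<Prod>j\<in>{1..N}. exp ((cmod (n j))\<^sup>2 - (cmod (relay k w1 w2 z n j))\<^sup>2)) \<partial>noise N) =
       (\<integral>\<^sup>+q. ?h q \<partial>noise N)"
      using nn_integral_shift_change[OF h, of 1 "\<lambda>j. k * inp w1 (obs w2 z) j"] by (simp add: relay_def)
    moreover have "ennreal (gain1 w1 (outs w1 (obs w2 z)) * inp_dens k w2 (relay k w1 w2 z n) *
      (\<Prod>j\<in>{1..N}. tilt v (z j) (out w1 (obs w2 z) j - (c * relay k w1 w2 z n j + m j))) *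
      (\<Prod>j\<in>{1..N}. exp ((cmod (n j))\<^sup>2 - (cmod (relay k w1 w2 z n j))\<^sup>2))) =
      ?h (relay k w1 w2 z n) * ennreal (\<Prod>j\<in>{1..N}. exp ((cmod (n j))\<^sup>2 - (cmod (relay k w1 w2 z n j))\<^sup>2))" for n
      by (rule ennreal_mult4) (auto intro!: prod_nonneg less_imp_le[OF tilt_pos[OF v]] less_imp_le[OF gain_pos(1)] inp_dens_nonneg)
    ultimately show ?thesis by simp
  qed
  then have "?thesis \<longleftrightarrow> (\<Sum>w1\<in>W1. \<integral>\<^sup>+z. \<integral>\<^sup>+q. ennreal (inp_dens k w2 q) * ennreal (?g w1 q z) \<partial>noise N \<partial>noise N) \<le> ennreal (card W1)"
    by (simp cong: nn_integral_cong)
  moreover have "(\<integral>\<^sup>+z. \<integral>\<^sup>+q. ennreal (inp_dens k w2 q) * ennreal (?g w1 q z) \<partial>noise N \<partial>noise N) =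
      (\<integral>\<^sup>+q. ennreal (inp_dens k w2 q) * (\<integral>\<^sup>+z. ennreal (?g w1 q z) \<partial>noise N) \<partial>noise N)" for w1
  proof -
    have "(\<integral>\<^sup>+z. \<integral>\<^sup>+q. ennreal (inp_dens k w2 q) * ennreal (?g w1 q z) \<partial>noise N \<partial>noise N) =
       (\<integral>\<^sup>+q. \<integral>\<^sup>+z. ennreal (inp_dens k w2 q) * ennreal (?g w1 q z) \<partial>noise N \<partial>noise N)"
      by (rule P.Fubini') (rule gm)
    also have "\<dots> = (\<integral>\<^sup>+q. ennreal (inp_dens k w2 q) * (\<integral>\<^sup>+z. ennreal (?g w1 q z) \<partial>noise N) \<partial>noise N)"
    proof (rule nn_integral_cong, rule nn_integral_cmult)
      fix q assume q: "q \<in> space (noise N)"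
      note [measurable] = measurable_compose[OF measurable_Pair1'[OF q] tm[of w1], simplified]
      show "(\<lambda>z. ennreal (?g w1 q z)) \<in> borel_measurable (noise N)" by measurable
    qed
    finally show ?thesis .
  qed
  moreover have "(\<Sum>w1\<in>W1. \<integral>\<^sup>+q. ennreal (inp_dens k w2 q) * (\<integral>\<^sup>+z. ennreal (?g w1 q z) \<partial>noise N) \<partial>noise N) =
      (\<integral>\<^sup>+q. ennreal (inp_dens k w2 q) * (\<Sum>w1\<in>W1. \<integral>\<^sup>+z. ennreal (?g w1 q z) \<partial>noise N) \<partial>noise N)"
    unfolding sum_distrib_left
  proof (rule nn_integral_sum[symmetric])
    fix w1
    have "(\<lambda>p. ennreal (?g w1 (fst p) (snd p))) \<in> borel_measurable (noise N \<Otimes>\<^sub>M noise N)" by measurable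
    then have [measurable]: "(\<lambda>q. \<integral>\<^sup>+z. ennreal (?g w1 q z) \<partial>noise N) \<in> borel_measurable (noise N)"
      by (intro borel_measurable_nn_integral) (simp add: case_prod_beta')
    show "(\<lambda>q. ennreal (inp_dens k w2 q) * (\<integral>\<^sup>+z. ennreal (?g w1 q z) \<partial>noise N)) \<in> borel_measurable (noise N)"
      by measurable
  qed
  moreover have "\<dots> \<le> (\<integral>\<^sup>+q. ennreal (inp_dens k w2 q) * ennreal (card W1) \<partial>noise N)"
    by (intro nn_integral_mono mult_left_mono sum_gain1_tilt_le[OF v]) auto
  moreover have "\<dots> = ennreal (card W1)"
    by (subst nn_integral_multc) (auto simp: nn_integral_inp_dens)
  ultimately show ?thesis by simp
qed

text \<open>This is \<open>Y2\<close> when its noise is \<open>al t + b v\<close> and \<open>b q = gc X1 + b v\<close>.\<close>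

definition "out2 w2 al b t q = (\<lambda>j\<in>{1..N}. gd * enc2 C j w2 + al * t j + of_real b * q j)"

lemma out2_measurable:
  "(\<lambda>p. out2 w2 al b (fst p) (snd p)) \<in> measurable (noise N \<Otimes>\<^sub>M noise N) (noise N)"
proof -
  have "(\<lambda>p. \<lambda>j\<in>{1..N}. gd * enc2 C j w2 + al * fst p j + of_real b * snd p j) \<in>
      measurable (noise N \<Otimes>\<^sub>M noise N) (\<Pi>\<^sub>M i\<in>{1..N}. (borel :: complex measure))"
  proof (intro measurable_restrict)
    fix j assume j: "j \<in> {1..N}"
    note [measurable] = measurable_noise_component[OF j]
    show "(\<lambda>p. gd * enc2 C j w2 + al * fst p j + of_real b * snd p j) \<in> borel_measurable (noise N \<Otimes>\<^sub>M noise N)"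
      by measurable
  qed
  moreover have "measurable (noise N \<Otimes>\<^sub>M noise N) (noise N) =
      measurable (noise N \<Otimes>\<^sub>M noise N) (\<Pi>\<^sub>M i\<in>{1..N}. (borel :: complex measure))"
    by (rule measurable_cong_sets[OF refl sets_noise])
  ultimately show ?thesis
    unfolding out2_def by simp
qed

lemma nn_integral_gain2_tilt:
  assumes v: "0 < v" and b: "0 < b"
  shows "(\<integral>\<^sup>+q. ennreal (gain2 w2 (out2 w2 al b t q) * (\<Prod>j\<in>{1..N}. b\<^sup>2 * tilt v (q j) (out2 w2 al b t q j - m j))) \<partial>noise N)
    = (\<integral>\<^sup>+y. ennreal (gain2 w2 y * (\<Prod>j\<in>{1..N}. gauss_ratio v (m j) (y j))) \<partial>noise N)"
proof -
  have "ennreal (gain2 w2 (out2 w2 al b t q) * (\<Prod>j\<in>{1..N}. b\<^sup>2 * tilt v (q j) (out2 w2 al b t q j - m j))) =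
    ennreal (gain2 w2 (out2 w2 al b t q) * (\<Prod>j\<in>{1..N}. gauss_ratio v (m j) (out2 w2 al b t q j))) *
    ennreal (\<Prod>j\<in>{1..N}. b\<^sup>2 * exp ((cmod (q j))\<^sup>2 - (cmod (gd * enc2 C j w2 + al * t j + of_real b * q j))\<^sup>2))" for q
  proof -
    have "(\<Prod>j\<in>{1..N}. b\<^sup>2 * tilt v (q j) (out2 w2 al b t q j - m j)) =
      (\<Prod>j\<in>{1..N}. gauss_ratio v (m j) (out2 w2 al b t q j)) *
      (\<Prod>j\<in>{1..N}. b\<^sup>2 * exp ((cmod (q j))\<^sup>2 - (cmod (gd * enc2 C j w2 + al * t j + of_real b * q j))\<^sup>2))"
      unfolding prod.distrib[symmetric] tilt_eq by (intro prod.cong refl) (simp add: out2_def)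
    then show ?thesis
      by (simp only: mult.assoc[symmetric]) (rule ennreal_mult'', auto intro!: prod_nonneg)
  qed
  then show ?thesis
    using nn_integral_shift_change[OF gain_ratio_measurable(2)[of w2 v m] b, of "\<lambda>j. gd * enc2 C j w2 + al * t j"]
    by (simp add: out2_def)
qed

lemma sum_gain2_tilt_le:
  assumes v: "0 < v" and b: "0 < b"
  shows "(\<Sum>w2\<in>W2. \<integral>\<^sup>+q. ennreal (gain2 w2 (out2 w2 al b t q) *
    (\<Prod>j\<in>{1..N}. b\<^sup>2 * tilt v (q j) (out2 w2 al b t q j - m j))) \<partial>noise N) \<le> ennreal (card W2)"
  unfolding nn_integral_gain2_tilt[OF v b] by (rule sum_gain2_ratio_le[OF v])

text \<open>For \<open>I(W2; Y2)\<close>: with \<open>al = 0\<close>, \<open>b = 1\<close> the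
  output is Q shifted by the second input. Division by \<open>inp_dens\<close> makes Q Gaussian;
  this works only after averaging over the first message, since \<open>inp_dens\<close> is a mixture
  over it.\<close>

lemma sum_gain2_inp_dens_le:
  assumes v: "0 < v"
  shows "(\<Sum>w1\<in>W1. \<Sum>w2\<in>W2. \<integral>\<^sup>+z. \<integral>\<^sup>+n. ennreal (gain2 w2 (out2 w2 0 1 n (relay k w1 w2 z n)) *
      (\<Prod>j\<in>{1..N}. tilt v (relay k w1 w2 z n j) (out2 w2 0 1 n (relay k w1 w2 z n) j)) / inp_dens k w2 (relay k w1 w2 z n))
      \<partial>noise N \<partial>noise N) \<le> ennreal (card W1) * ennreal (card W2)"
proof -
  note [measurable] = gain_measurable
  define Osh where "Osh w2 q = (\<lambda>j\<in>{1..N}. gd * enc2 C j w2 + 1 * q j)" for w2 and q :: "nat \<Rightarrow> complex"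
  have o [measurable]: "Osh w2 \<in> measurable (noise N) (noise N)" for w2
    unfolding Osh_def[abs_def] by (rule measurable_shift_noise)
  have o0: "out2 w2 0 1 t q = Osh w2 q" for w2 t q
    by (simp add: out2_def Osh_def)
  let ?f = "\<lambda>w2 q. gain2 w2 (Osh w2 q) * (\<Prod>j\<in>{1..N}. tilt v (q j) (Osh w2 q j))"
  have [measurable]: "(\<lambda>q. \<Prod>j\<in>{1..N}. tilt v (q j) (Osh w2 q j)) \<in> borel_measurable (noise N)" for w2
    by (intro borel_measurable_prod tilt_measurable measurable_noise_component measurable_compose[OF o measurable_noise_component]) auto
  have "(\<Sum>w1\<in>W1. \<integral>\<^sup>+z. \<integral>\<^sup>+n. ennreal (?f w2 (relay k w1 w2 z n) / inp_dens k w2 (relay k w1 w2 z n)) \<partial>noise N \<partial>noise N) =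
      of_nat (card W1) * (\<integral>\<^sup>+q. ennreal (?f w2 q) \<partial>noise N)" for w2
  proof -
    have "(\<Sum>w1\<in>W1. \<integral>\<^sup>+z. \<integral>\<^sup>+n. ennreal (?f w2 (relay k w1 w2 z n) / inp_dens k w2 (relay k w1 w2 z n)) \<partial>noise N \<partial>noise N) =
      of_nat (card W1) * (\<integral>\<^sup>+q. ennreal (?f w2 q / inp_dens k w2 q) * ennreal (inp_dens k w2 q) \<partial>noise N)"
      by (rule sum_nn_integral_relay) measurable
    also have "(\<integral>\<^sup>+q. ennreal (?f w2 q / inp_dens k w2 q) * ennreal (inp_dens k w2 q) \<partial>noise N) = (\<integral>\<^sup>+q. ennreal (?f w2 q) \<partial>noise N)"
    proof (rule nn_integral_cong)
      fix q assume "q \<in> space (noise N)"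
      from inp_dens_pos[OF this, of k w2]
      have "?f w2 q / inp_dens k w2 q * inp_dens k w2 q = ?f w2 q" by simp
      then show "ennreal (?f w2 q / inp_dens k w2 q) * ennreal (inp_dens k w2 q) = ennreal (?f w2 q)"
        by (subst ennreal_mult''[symmetric]) (use inp_dens_nonneg in auto)
    qed
    finally show ?thesis .
  qed
  then have "(\<Sum>w2\<in>W2. \<Sum>w1\<in>W1. \<integral>\<^sup>+z. \<integral>\<^sup>+n. ennreal (?f w2 (relay k w1 w2 z n) / inp_dens k w2 (relay k w1 w2 z n)) \<partial>noise N \<partial>noise N) =
      of_nat (card W1) * (\<Sum>w2\<in>W2. \<integral>\<^sup>+q. ennreal (?f w2 q) \<partial>noise N)"
    by (simp add: sum_distrib_left)
  also have "\<dots> \<le> of_nat (card W1) * ennreal (card W2)"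
    using sum_gain2_tilt_le[OF v, of 1 0 "\<lambda>_. 0" "\<lambda>_. 0"] by (intro mult_left_mono) (auto simp: o0)
  finally show ?thesis
    unfolding o0 by (subst sum.swap) (simp add: ennreal_of_nat_eq_real_of_nat)
qed

text \<open>For \<open>I(W2; Y2, St)\<close> the reference is the law of St followed by a Gaussian
  around \<open>e * St\<close> for Y2. The law of Q is divided out as for \<open>I(W2; Y2)\<close>,
  after which Q is exchanged for Y2 and then \<open>t\<close> for St.\<close>

lemma sum_gain2_obs_dens_le:
  assumes v: "0 < v" and b: "0 < b"
  shows "(\<Sum>w1\<in>W1. \<Sum>w2\<in>W2. \<integral>\<^sup>+z. \<integral>\<^sup>+n. \<integral>\<^sup>+t. ennreal (gain2 w2 (out2 w2 al b t (relay k w1 w2 z n)) *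
      (\<Prod>j\<in>{1..N}. b\<^sup>2 * tilt v (relay k w1 w2 z n j) (out2 w2 al b t (relay k w1 w2 z n) j - e * obs w2 t j)) *
      (obs_dens (obs w2 t) * (\<Prod>j\<in>{1..N}. exp ((cmod (t j))\<^sup>2 - (cmod (obs w2 t j))\<^sup>2))) / inp_dens k w2 (relay k w1 w2 z n))
      \<partial>noise N \<partial>noise N \<partial>noise N) \<le> ennreal (card W1) * ennreal (card W2)"
proof -
  interpret prob_space "noise N" by (rule prob_space_noise)
  interpret P: pair_sigma_finite "noise N" "noise N" by standard
  note [measurable] = gain_measurable out2_measurable obs_measurable
  define g where "g w2 t q = gain2 w2 (out2 w2 al b t q) * (\<Prod>j\<in>{1..N}. b\<^sup>2 * tilt v (q j) (out2 w2 al b t q j - e * obs w2 t j))" for w2 t q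
  define h where "h w2 t = obs_dens (obs w2 t) * (\<Prod>j\<in>{1..N}. exp ((cmod (t j))\<^sup>2 - (cmod (obs w2 t j))\<^sup>2))" for w2 t
  have g0: "0 \<le> g w2 t q" for w2 t q
    unfolding g_def using v b gain_pos(2)[of w2] by (intro mult_nonneg_nonneg prod_nonneg) (auto intro: less_imp_le simp: tilt_def)
  have h0: "0 \<le> h w2 t" for w2 t
    unfolding h_def by (intro mult_nonneg_nonneg prod_nonneg) (auto intro: less_imp_le obs_dens_pos)
  have [measurable]: "(\<lambda>p. \<Prod>j\<in>{1..N}. b\<^sup>2 * tilt v (snd p j) (out2 w2 al b (fst p) (snd p) j - e * obs w2 (fst p) j))
     \<in> borel_measurable (noise N \<Otimes>\<^sub>M noise N)" for w2
  proof (intro borel_measurable_prod)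
    fix j assume j: "j \<in> {1..N}"
    note [measurable] = measurable_noise_component[OF j] measurable_compose[OF out2_measurable measurable_noise_component[OF j]]
      measurable_compose[OF obs_measurable measurable_noise_component[OF j]]
    show "(\<lambda>p. b\<^sup>2 * tilt v (snd p j) (out2 w2 al b (fst p) (snd p) j - e * obs w2 (fst p) j)) \<in> borel_measurable (noise N \<Otimes>\<^sub>M noise N)"
      by measurable
  qed
  have [measurable]: "(\<lambda>t. \<Prod>j\<in>{1..N}. exp ((cmod (t j))\<^sup>2 - (cmod (obs w2 t j))\<^sup>2)) \<in> borel_measurable (noise N)" for w2
  proof (intro borel_measurable_prod)
    fix j assume j: "j \<in> {1..N}"
    note [measurable] = measurable_noise_component[OF j] measurable_compose[OF obs_measurable measurable_noise_component[OF j]]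
    show "(\<lambda>t. exp ((cmod (t j))\<^sup>2 - (cmod (obs w2 t j))\<^sup>2)) \<in> borel_measurable (noise N)"
      by measurable
  qed
  have gm: "(\<lambda>p. ennreal (g w2 (fst p) (snd p))) \<in> borel_measurable (noise N \<Otimes>\<^sub>M noise N)" for w2
    unfolding g_def by measurable
  have gt: "(\<lambda>t. ennreal (g w2 t q)) \<in> borel_measurable (noise N)" if "q \<in> space (noise N)" for w2 q
    using measurable_compose[OF measurable_Pair2'[OF that] gm[of w2]] by simp
  have gq: "(\<lambda>q. ennreal (g w2 t q)) \<in> borel_measurable (noise N)" if "t \<in> space (noise N)" for w2 t
    using measurable_compose[OF measurable_Pair1'[OF that] gm[of w2]] by simp
  define f where "f w2 q = (\<integral>\<^sup>+t. ennreal (h w2 t) * ennreal (g w2 t q) \<partial>noise N)" for w2 q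
  have hg [measurable]: "(\<lambda>p. ennreal (h w2 (fst p)) * ennreal (g w2 (fst p) (snd p))) \<in> borel_measurable (noise N \<Otimes>\<^sub>M noise N)" for w2
    unfolding h_def g_def by measurable
  have hg': "(\<lambda>(q, t). ennreal (h w2 t) * ennreal (g w2 t q)) \<in> borel_measurable (noise N \<Otimes>\<^sub>M noise N)" for w2
    using measurable_compose[OF measurable_pair_swap' hg[of w2]] by (simp add: case_prod_beta')
  have f [measurable]: "f w2 \<in> borel_measurable (noise N)" for w2
    unfolding f_def by (rule borel_measurable_nn_integral) (rule hg')
  \<comment> \<open>The mean of the gain when Y2 has its reference law given \<open>St = s\<close>.
    Its dependence on the message is through the gain alone, so the sum over messages can be taken
    inside.\<close>
  define H where "H w2 s = (\<integral>\<^sup>+y. ennreal (gain2 w2 y * (\<Prod>j\<in>{1..N}. gauss_ratio v (e * s j) (y j))) \<partial>noise N)" for w2 s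
  have H: "(\<integral>\<^sup>+q. ennreal (g w2 t q) \<partial>noise N) = H w2 (obs w2 t)" for w2 t
    unfolding g_def nn_integral_gain2_tilt[OF v b] H_def ..
  have Hm [measurable]: "H w2 \<in> borel_measurable (noise N)" for w2
    unfolding H_def
  proof (rule borel_measurable_nn_integral)
    have [measurable]: "(\<lambda>p. \<Prod>j\<in>{1..N}. gauss_ratio v (e * fst p j) (snd p j)) \<in> borel_measurable (noise N \<Otimes>\<^sub>M noise N)"
    proof (intro borel_measurable_prod)
      fix j assume j: "j \<in> {1..N}"
      note [measurable] = measurable_noise_component[OF j]
      show "(\<lambda>p. gauss_ratio v (e * fst p j) (snd p j)) \<in> borel_measurable (noise N \<Otimes>\<^sub>M noise N)" by measurable
    qed
    have "(\<lambda>p. ennreal (gain2 w2 (snd p) * (\<Prod>j\<in>{1..N}. gauss_ratio v (e * fst p j) (snd p j)))) \<in> borel_measurable (noise N \<Otimes>\<^sub>M noise N)"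
      by measurable
    then show "(\<lambda>(s, y). ennreal (gain2 w2 y * (\<Prod>j\<in>{1..N}. gauss_ratio v (e * s j) (y j)))) \<in> borel_measurable (noise N \<Otimes>\<^sub>M noise N)"
      by (simp add: case_prod_beta')
  qed
  have split: "(\<integral>\<^sup>+t. ennreal (g w2 t q * h w2 t / inp_dens k w2 q) \<partial>noise N) = f w2 q / ennreal (inp_dens k w2 q)"
    if q: "q \<in> space (noise N)" for w2 q
  proof -
    have "ennreal (g w2 t q * h w2 t / inp_dens k w2 q) = ennreal (h w2 t) * ennreal (g w2 t q) / ennreal (inp_dens k w2 q)" for t
    proof -
      have "ennreal (g w2 t q * h w2 t / inp_dens k w2 q) = ennreal (h w2 t * g w2 t q) / ennreal (inp_dens k w2 q)"
        unfolding mult.commute[of "g w2 t q"]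
        by (rule divide_ennreal[symmetric]) (use g0 h0 inp_dens_pos[OF q] in auto)
      then show ?thesis by (simp only: ennreal_mult[OF h0 g0])
    qed
    then show ?thesis
      unfolding f_def by (subst nn_integral_divide[symmetric])
        (use measurable_compose[OF measurable_Pair2'[OF q] hg[of w2]] in auto)
  qed
  have rel: "relay k w1 w2 z n \<in> space (noise N)" if "z \<in> space (noise N)" "n \<in> space (noise N)" for w1 w2 z n
    using measurable_space[OF relay_measurable, of "(z, n)"] that by (simp add: space_pair_measure)
  have "(\<Sum>w1\<in>W1. \<integral>\<^sup>+z. \<integral>\<^sup>+n. f w2 (relay k w1 w2 z n) / ennreal (inp_dens k w2 (relay k w1 w2 z n)) \<partial>noise N \<partial>noise N) =
      of_nat (card W1) * (\<integral>\<^sup>+t. ennreal (h w2 t) * H w2 (obs w2 t) \<partial>noise N)" for w2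
  proof -
    have "(\<Sum>w1\<in>W1. \<integral>\<^sup>+z. \<integral>\<^sup>+n. f w2 (relay k w1 w2 z n) / ennreal (inp_dens k w2 (relay k w1 w2 z n)) \<partial>noise N \<partial>noise N) =
        of_nat (card W1) * (\<integral>\<^sup>+q. f w2 q / ennreal (inp_dens k w2 q) * ennreal (inp_dens k w2 q) \<partial>noise N)"
      by (rule sum_nn_integral_relay) measurable
    also have "(\<integral>\<^sup>+q. f w2 q / ennreal (inp_dens k w2 q) * ennreal (inp_dens k w2 q) \<partial>noise N) = (\<integral>\<^sup>+q. f w2 q \<partial>noise N)"
    proof (rule nn_integral_cong)
      fix q assume "q \<in> space (noise N)"
      from inp_dens_pos[OF this, of k w2] show "f w2 q / ennreal (inp_dens k w2 q) * ennreal (inp_dens k w2 q) = f w2 q"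
        by (simp add: ennreal_divide_times ennreal_divide_self ennreal_eq_0_iff not_le)
    qed
    also have "\<dots> = (\<integral>\<^sup>+t. \<integral>\<^sup>+q. ennreal (h w2 t) * ennreal (g w2 t q) \<partial>noise N \<partial>noise N)"
      unfolding f_def by (rule P.Fubini') (use hg in \<open>simp add: case_prod_beta'\<close>)
    also have "\<dots> = (\<integral>\<^sup>+t. ennreal (h w2 t) * H w2 (obs w2 t) \<partial>noise N)"
      by (intro nn_integral_cong) (simp only: nn_integral_cmult[OF gq] H)
    finally show ?thesis .
  qed
  moreover have "(\<integral>\<^sup>+t. ennreal (h w2 t) * H w2 (obs w2 t) \<partial>noise N) = (\<integral>\<^sup>+s. ennreal (obs_dens s) * H w2 s \<partial>noise N)" for w2
  proof -
    have "(\<integral>\<^sup>+t. (ennreal (obs_dens (obs w2 t)) * H w2 (obs w2 t)) * ennreal (\<Prod>j\<in>{1..N}. exp ((cmod (t j))\<^sup>2 - (cmod (obs w2 t j))\<^sup>2)) \<partial>noise N) =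
      (\<integral>\<^sup>+s. ennreal (obs_dens s) * H w2 s \<partial>noise N)"
      using nn_integral_shift_change[of "\<lambda>s. ennreal (obs_dens s) * H w2 s" N 1 "\<lambda>j. gc * enc2 C j w2"]
      by (simp add: obs_def[abs_def])
    moreover have "ennreal (h w2 t) = ennreal (obs_dens (obs w2 t)) *
        ennreal (\<Prod>j\<in>{1..N}. exp ((cmod (t j))\<^sup>2 - (cmod (obs w2 t j))\<^sup>2))" for t
      unfolding h_def by (rule ennreal_mult'') (auto intro!: prod_nonneg)
    ultimately show ?thesis by (simp only: mult_ac)
  qed
  ultimately have "(\<Sum>w2\<in>W2. \<Sum>w1\<in>W1. \<integral>\<^sup>+z. \<integral>\<^sup>+n. f w2 (relay k w1 w2 z n) / ennreal (inp_dens k w2 (relay k w1 w2 z n)) \<partial>noise N \<partial>noise N)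
    = of_nat (card W1) * (\<integral>\<^sup>+s. (\<Sum>w2\<in>W2. ennreal (obs_dens s) * H w2 s) \<partial>noise N)"
    by (simp add: sum_distrib_left nn_integral_sum)
  also have "\<dots> \<le> of_nat (card W1) * (\<integral>\<^sup>+s. ennreal (obs_dens s) * ennreal (card W2) \<partial>noise N)"
    unfolding H_def sum_distrib_left[symmetric]
    by (intro mult_left_mono nn_integral_mono sum_gain2_ratio_le[OF v]) auto
  also have "\<dots> = ennreal (card W1) * ennreal (card W2)"
    by (subst nn_integral_multc) (auto simp: nn_integral_obs_dens ennreal_of_nat_eq_real_of_nat)
  finally show ?thesis
    unfolding g_def[symmetric] h_def[symmetric] by (subst sum.swap) (simp add: split rel cong: nn_integral_cong)
qed

text \<open>For \<open>I(W2; Y1, Y2 | W1)\<close>: given W1, the sequences Y1 and S determine each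
  other, so S takes the place of Y1. Its reference is \<open>CN(0, v)\<close>; that of Y2 may
  contain X1, which is a function of W1 and S.\<close>

lemma sum_gain2_obs_le:
  assumes v: "0 < v" and u: "0 < u"
  shows "(\<Sum>w1\<in>W1. \<Sum>w2\<in>W2. \<integral>\<^sup>+z. \<integral>\<^sup>+n. ennreal (gain2 w2 (out2 w2 0 1 n (relay gc w1 w2 z n)) *
      (\<Prod>j\<in>{1..N}. tilt u (n j) (out2 w2 0 1 n (relay gc w1 w2 z n) j - (e * obs w2 z j + gc * inp w1 (obs w2 z) j))) *
      (\<Prod>j\<in>{1..N}. tilt v (z j) (obs w2 z j))) \<partial>noise N \<partial>noise N) \<le> ennreal (card W1) * ennreal (card W2)"
proof -
  interpret prob_space "noise N" by (rule prob_space_noise)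
  note [measurable] = gain_measurable obs_measurable
  define m where "m w1 s j = e * s j + gc * inp w1 s j" for w1 s j
  define H where "H w1 w2 s = (\<integral>\<^sup>+y. ennreal (gain2 w2 y * (\<Prod>j\<in>{1..N}. gauss_ratio u (m w1 s j) (y j))) \<partial>noise N)" for w1 w2 s
  have Hm [measurable]: "H w1 w2 \<in> borel_measurable (noise N)" for w1 w2
    unfolding H_def
  proof (rule borel_measurable_nn_integral)
    have [measurable]: "(\<lambda>p. \<Prod>j\<in>{1..N}. gauss_ratio u (m w1 (fst p) j) (snd p j)) \<in> borel_measurable (noise N \<Otimes>\<^sub>M noise N)"
    proof (intro borel_measurable_prod)
      fix j assume j: "j \<in> {1..N}"
      note [measurable] = measurable_noise_component[OF j] inp_measurable[OF j]
      show "(\<lambda>p. gauss_ratio u (m w1 (fst p) j) (snd p j)) \<in> borel_measurable (noise N \<Otimes>\<^sub>M noise N)"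
        unfolding m_def by measurable
    qed
    have "(\<lambda>p. ennreal (gain2 w2 (snd p) * (\<Prod>j\<in>{1..N}. gauss_ratio u (m w1 (fst p) j) (snd p j)))) \<in> borel_measurable (noise N \<Otimes>\<^sub>M noise N)"
      by measurable
    then show "(\<lambda>(s, y). ennreal (gain2 w2 y * (\<Prod>j\<in>{1..N}. gauss_ratio u (m w1 s j) (y j)))) \<in> borel_measurable (noise N \<Otimes>\<^sub>M noise N)"
      by (simp add: case_prod_beta')
  qed
  have inner: "(\<integral>\<^sup>+n. ennreal (gain2 w2 (out2 w2 0 1 n (relay gc w1 w2 z n)) *
      (\<Prod>j\<in>{1..N}. tilt u (n j) (out2 w2 0 1 n (relay gc w1 w2 z n) j - m w1 (obs w2 z) j)) *
      (\<Prod>j\<in>{1..N}. tilt v (z j) (obs w2 z j))) \<partial>noise N) =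
    ennreal (\<Prod>j\<in>{1..N}. tilt v (z j) (obs w2 z j)) * H w1 w2 (obs w2 z)" for w1 w2 z
  proof -
    let ?mu = "\<lambda>j. gd * enc2 C j w2 + gc * inp w1 (obs w2 z) j"
    have o: "out2 w2 0 1 n (relay gc w1 w2 z n) = (\<lambda>j\<in>{1..N}. ?mu j + of_real 1 * n j)" for n
      by (auto simp: out2_def relay_def)
    let ?f = "\<lambda>y. ennreal (gain2 w2 y * (\<Prod>j\<in>{1..N}. gauss_ratio u (m w1 (obs w2 z) j) (y j)))"
    let ?t = "\<Prod>j\<in>{1..N}. tilt v (z j) (obs w2 z j)"
    have "ennreal (gain2 w2 (out2 w2 0 1 n (relay gc w1 w2 z n)) *
      (\<Prod>j\<in>{1..N}. tilt u (n j) (out2 w2 0 1 n (relay gc w1 w2 z n) j - m w1 (obs w2 z) j)) * ?t) =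
      ennreal ?t * (?f (\<lambda>j\<in>{1..N}. ?mu j + of_real 1 * n j) *
        ennreal (\<Prod>j\<in>{1..N}. 1\<^sup>2 * exp ((cmod (n j))\<^sup>2 - (cmod (?mu j + of_real 1 * n j))\<^sup>2)))" for n
    proof -
      let ?E = "\<Prod>j\<in>{1..N}. 1\<^sup>2 * exp ((cmod (n j))\<^sup>2 - (cmod (?mu j + of_real 1 * n j))\<^sup>2)"
      let ?y = "\<lambda>j\<in>{1..N}. ?mu j + of_real 1 * n j"
      have "(\<Prod>j\<in>{1..N}. tilt u (n j) (?y j - m w1 (obs w2 z) j)) =
          (\<Prod>j\<in>{1..N}. gauss_ratio u (m w1 (obs w2 z) j) (?y j)) * ?E"
        unfolding prod_tilt_eq by (intro arg_cong2[where f = times] prod.cong refl) simp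
      then have "gain2 w2 ?y * (\<Prod>j\<in>{1..N}. tilt u (n j) (?y j - m w1 (obs w2 z) j)) * ?t =
          ?t * (gain2 w2 ?y * (\<Prod>j\<in>{1..N}. gauss_ratio u (m w1 (obs w2 z) j) (?y j)) * ?E)"
        by (simp only: mult_ac)
      moreover have "0 \<le> ?t" "0 \<le> ?E"
        using less_imp_le[OF tilt_prod_pos[OF v]] by (auto intro!: prod_nonneg)
      ultimately show ?thesis unfolding o by (simp only: ennreal_mult' ennreal_mult'')
    qed
    moreover have "(\<integral>\<^sup>+n. ?f (\<lambda>j\<in>{1..N}. ?mu j + of_real 1 * n j) *
        ennreal (\<Prod>j\<in>{1..N}. 1\<^sup>2 * exp ((cmod (n j))\<^sup>2 - (cmod (?mu j + of_real 1 * n j))\<^sup>2)) \<partial>noise N) = H w1 w2 (obs w2 z)"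
      unfolding H_def by (rule nn_integral_shift_change[OF gain_ratio_measurable(2)]) simp
    moreover have "(\<lambda>n. ?f (\<lambda>j\<in>{1..N}. ?mu j + of_real 1 * n j) *
        ennreal (\<Prod>j\<in>{1..N}. 1\<^sup>2 * exp ((cmod (n j))\<^sup>2 - (cmod (?mu j + of_real 1 * n j))\<^sup>2))) \<in> borel_measurable (noise N)"
    proof (rule borel_measurable_times_ennreal)
      show "(\<lambda>n. ?f (\<lambda>j\<in>{1..N}. ?mu j + of_real 1 * n j)) \<in> borel_measurable (noise N)"
        by (rule measurable_compose[OF measurable_shift_noise gain_ratio_measurable(2)])
      show "(\<lambda>n. ennreal (\<Prod>j\<in>{1..N}. 1\<^sup>2 * exp ((cmod (n j))\<^sup>2 - (cmod (?mu j + of_real 1 * n j))\<^sup>2))) \<in> borel_measurable (noise N)"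
      proof (rule noise_prod_measurable)
        fix j assume j: "j \<in> {1..N}"
        note [measurable] = measurable_noise_component[OF j]
        show "(\<lambda>n. 1\<^sup>2 * exp ((cmod (n j))\<^sup>2 - (cmod (?mu j + of_real 1 * n j))\<^sup>2)) \<in> borel_measurable (noise N)"
          by measurable
      qed
    qed
    ultimately show ?thesis by (simp only: nn_integral_cmult)
  qed
  have outer: "(\<integral>\<^sup>+z. ennreal (\<Prod>j\<in>{1..N}. tilt v (z j) (obs w2 z j)) * H w1 w2 (obs w2 z) \<partial>noise N) =
      (\<integral>\<^sup>+s. H w1 w2 s * ennreal (\<Prod>j\<in>{1..N}. gauss_ratio v 0 (s j)) \<partial>noise N)" for w1 w2
  proof -
    have [measurable]: "(\<lambda>s. \<Prod>j\<in>{1..N}. gauss_ratio v 0 (s j)) \<in> borel_measurable (noise N)"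
      by (intro borel_measurable_prod gauss_ratio_measurable measurable_noise_component borel_measurable_const) auto
    have "(\<integral>\<^sup>+z. (H w1 w2 (obs w2 z) * ennreal (\<Prod>j\<in>{1..N}. gauss_ratio v 0 (obs w2 z j))) *
        ennreal (\<Prod>j\<in>{1..N}. exp ((cmod (z j))\<^sup>2 - (cmod (obs w2 z j))\<^sup>2)) \<partial>noise N) =
        (\<integral>\<^sup>+s. H w1 w2 s * ennreal (\<Prod>j\<in>{1..N}. gauss_ratio v 0 (s j)) \<partial>noise N)"
      using nn_integral_shift_change[of "\<lambda>s. H w1 w2 s * ennreal (\<Prod>j\<in>{1..N}. gauss_ratio v 0 (s j))" N 1 "\<lambda>j. gc * enc2 C j w2"]
      by (simp add: obs_def[abs_def])
    moreover have "ennreal (\<Prod>j\<in>{1..N}. tilt v (z j) (obs w2 z j)) =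
        ennreal (\<Prod>j\<in>{1..N}. gauss_ratio v 0 (obs w2 z j)) * ennreal (\<Prod>j\<in>{1..N}. exp ((cmod (z j))\<^sup>2 - (cmod (obs w2 z j))\<^sup>2))" for z
      using prod_tilt_eq[of v z "obs w2 z" "\<lambda>_. 0"] by (simp add: ennreal_mult'' prod_nonneg)
    ultimately show ?thesis by (simp only: mult_ac)
  qed
  have "(\<Sum>w2\<in>W2. \<integral>\<^sup>+s. H w1 w2 s * ennreal (\<Prod>j\<in>{1..N}. gauss_ratio v 0 (s j)) \<partial>noise N) \<le> ennreal (card W2)" for w1
  proof -
    have [measurable]: "(\<lambda>s. \<Prod>j\<in>{1..N}. gauss_ratio v 0 (s j)) \<in> borel_measurable (noise N)"
      by (intro borel_measurable_prod gauss_ratio_measurable measurable_noise_component borel_measurable_const) auto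
    have "(\<Sum>w2\<in>W2. \<integral>\<^sup>+s. H w1 w2 s * ennreal (\<Prod>j\<in>{1..N}. gauss_ratio v 0 (s j)) \<partial>noise N) =
        (\<integral>\<^sup>+s. (\<Sum>w2\<in>W2. H w1 w2 s) * ennreal (\<Prod>j\<in>{1..N}. gauss_ratio v 0 (s j)) \<partial>noise N)"
      unfolding sum_distrib_right by (rule nn_integral_sum[symmetric]) measurable
    also have "\<dots> \<le> (\<integral>\<^sup>+s. ennreal (card W2) * ennreal (\<Prod>j\<in>{1..N}. gauss_ratio v 0 (s j)) \<partial>noise N)"
      unfolding H_def by (intro nn_integral_mono mult_right_mono sum_gain2_ratio_le[OF u]) auto
    also have "\<dots> = ennreal (card W2)"
      by (subst nn_integral_cmult) (auto simp: nn_integral_noise_gauss_ratio[OF v])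
    finally show ?thesis .
  qed
  then have "(\<Sum>w1\<in>W1. \<Sum>w2\<in>W2. \<integral>\<^sup>+s. H w1 w2 s * ennreal (\<Prod>j\<in>{1..N}. gauss_ratio v 0 (s j)) \<partial>noise N) \<le>
      (\<Sum>w1\<in>W1. ennreal (card W2))"
    by (intro sum_mono)
  then show ?thesis
    unfolding m_def[symmetric] inner outer by (simp add: ennreal_of_nat_eq_real_of_nat)
qed

section \<open>Second moments and causality\<close>

lemma nn_integral_noise_component:
  assumes "f \<in> borel_measurable borel" "j \<in> {1..N}"
  shows "(\<integral>\<^sup>+z. f (z j) \<partial>noise N) = (\<integral>\<^sup>+x. f x \<partial>cgauss)"
proof -
  have "distr (noise N) cgauss (\<lambda>z. z j) = cgauss"
    using assms(2) by (intro distr_PiM_component prob_space_cgauss) auto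
  then have "(\<integral>\<^sup>+x. f x \<partial>cgauss) = (\<integral>\<^sup>+x. f x \<partial>distr (noise N) cgauss (\<lambda>z. z j))" by simp
  also have "\<dots> = (\<integral>\<^sup>+z. f (z j) \<partial>noise N)"
    using assms by (intro nn_integral_distr) (auto intro: measurable_component_singleton simp: measurable_cgauss_iff)
  finally show ?thesis by simp
qed

lemma nn_integral_noise_square:
  "j \<in> {1..N} \<Longrightarrow> (\<integral>\<^sup>+z. ennreal ((cmod (f + c * z j))\<^sup>2) \<partial>noise N) = ennreal ((cmod f)\<^sup>2 + (cmod c)\<^sup>2)"
  using nn_integral_noise_component[of "\<lambda>x. ennreal ((cmod (f + c * x))\<^sup>2)" j] nn_integral_cgauss_square[of f c] by simp

lemma inp_cong:
  assumes "\<And>i. i \<in> {1..<j} \<Longrightarrow> s i = s' i"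
  shows "inp w s j = inp w s' j"
  unfolding inp_def out_def using assms
  by (intro arg_cong[of _ _ "enc1 C j w"] restrict_ext feedback_cong) auto

text \<open>Strict causality of the feedback: X1 at time \<open>j\<close> is a function of noise at
  earlier times, so the current sample is independent of it, and the cross term vanishes because the
  sample has mean 0.\<close>

lemma nn_integral_obs_square:
  assumes j: "j \<in> {1..N}"
  shows "(\<integral>\<^sup>+z. ennreal ((cmod (a * inp w1 (obs w2 z) j + f + c * z j))\<^sup>2) \<partial>noise N) =
    (\<integral>\<^sup>+z. ennreal ((cmod (a * inp w1 (obs w2 z) j + f))\<^sup>2) \<partial>noise N) + ennreal ((cmod c)\<^sup>2)"
proof -
  let ?I = "{1..N} - {j}"
  have ins: "{1..N} = insert j ?I" using j by auto
  interpret prob_space "noise N" by (rule prob_space_noise)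
  interpret R: prob_space "PiM ?I (\<lambda>_. cgauss)" by (intro prob_space_PiM prob_space_cgauss)
  note [measurable] = measurable_noise_component[OF j] inp_obs_measurable[OF j]
  have upd: "inp w1 (obs w2 (z(j := x))) j = inp w1 (obs w2 (z(j := 0))) j" for z x
    by (intro inp_cong) (auto simp: obs_def)
  \<comment> \<open>The value 0 at \<open>j\<close> is arbitrary: by \<open>upd\<close> the input
    does not see this coordinate.\<close>
  define F where "F z = a * inp w1 (obs w2 (z(j := 0))) j + f" for z
  have add: "(\<lambda>z. z(j := 0)) \<in> measurable (PiM ?I (\<lambda>_. cgauss)) (noise N)"
    using measurable_compose[OF measurable_Pair2'[of 0 cgauss] measurable_add_dim[of j ?I "\<lambda>_. cgauss"]] ins[symmetric] by simp
  have Fm [measurable]: "F \<in> borel_measurable (PiM ?I (\<lambda>_. cgauss))"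
    unfolding F_def using measurable_compose[OF add inp_obs_measurable[OF j]] by measurable
  have 1: "(\<integral>\<^sup>+z. ennreal ((cmod (a * inp w1 (obs w2 z) j + f + c' * z j))\<^sup>2) \<partial>noise N) =
      (\<integral>\<^sup>+z. ennreal ((cmod (F z))\<^sup>2) \<partial>PiM ?I (\<lambda>_. cgauss)) + ennreal ((cmod c')\<^sup>2)" for c'
  proof -
    let ?f = "\<lambda>z. ennreal ((cmod (a * inp w1 (obs w2 z) j + f + c' * z j))\<^sup>2)"
    have "?f \<in> borel_measurable (noise N)" by measurable
    then have "(\<integral>\<^sup>+z. ?f z \<partial>noise N) = (\<integral>\<^sup>+z. \<integral>\<^sup>+x. ?f (z(j := x)) \<partial>cgauss \<partial>PiM ?I (\<lambda>_. cgauss))"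
      using cgauss_seq.product_nn_integral_insert[of ?I j ?f] ins[symmetric] by simp
    also have "\<dots> = (\<integral>\<^sup>+z. ennreal ((cmod (F z))\<^sup>2 + (cmod c')\<^sup>2) \<partial>PiM ?I (\<lambda>_. cgauss))"
    proof (rule nn_integral_cong)
      fix z
      have "?f (z(j := x)) = ennreal ((cmod (F z + c' * x))\<^sup>2)" for x
        by (subst upd) (simp add: F_def)
      then show "(\<integral>\<^sup>+x. ?f (z(j := x)) \<partial>cgauss) = ennreal ((cmod (F z))\<^sup>2 + (cmod c')\<^sup>2)"
        by (simp only: nn_integral_cgauss_square)
    qed
    also have "\<dots> = (\<integral>\<^sup>+z. ennreal ((cmod (F z))\<^sup>2) + ennreal ((cmod c')\<^sup>2) \<partial>PiM ?I (\<lambda>_. cgauss))"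
      by simp
    also have "\<dots> = (\<integral>\<^sup>+z. ennreal ((cmod (F z))\<^sup>2) \<partial>PiM ?I (\<lambda>_. cgauss)) + ennreal ((cmod c')\<^sup>2)"
      by (subst nn_integral_add) (auto simp: R.emeasure_space_1)
    finally show ?thesis .
  qed
  \<comment> \<open>Taking \<open>c' = 0\<close> as well identifies the integral over the other
    coordinates.\<close>
  show ?thesis using 1[of c] 1[of 0] by simp
qed

end

subsection \<open>Second moments and the three outer bounds\<close>

lemma nn_integral_pair:
  assumes "prob_space M2" "f \<in> borel_measurable (M1 \<Otimes>\<^sub>M M2)"
  shows "(\<integral>\<^sup>+x. f x \<partial>(M1 \<Otimes>\<^sub>M M2)) = (\<integral>\<^sup>+x. \<integral>\<^sup>+y. f (x, y) \<partial>M2 \<partial>M1)"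
proof -
  interpret prob_space M2 by fact
  show ?thesis using assms(2) by (rule nn_integral_fst[symmetric])
qed

lemma nn_integral_triple:
  assumes p: "prob_space M2" "prob_space M3" and f: "f \<in> borel_measurable (M1 \<Otimes>\<^sub>M (M2 \<Otimes>\<^sub>M M3))"
  shows "(\<integral>\<^sup>+x. f x \<partial>(M1 \<Otimes>\<^sub>M (M2 \<Otimes>\<^sub>M M3))) = (\<integral>\<^sup>+x. \<integral>\<^sup>+y. \<integral>\<^sup>+z. f (x, y, z) \<partial>M3 \<partial>M2 \<partial>M1)"
  using nn_integral_pair[OF prob_space_pair[OF p] f] nn_integral_pair[OF p(2) measurable_Pair2[OF f]]
  by (simp cong: nn_integral_cong)

context feedback_code
begin

text \<open>A point of \<open>triple\<close> is \<open>(z, n, t)\<close>: the noise of \<open>Y1\<close>, the noise \<open>V\<close> of the genie, and the noise of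
  the copy of \<open>gc X2 + Z1\<close>; the noise of \<open>Y2\<close> is \<open>al t + b n\<close>.\<close>

abbreviation "triple \<equiv> noise N \<Otimes>\<^sub>M (noise N \<Otimes>\<^sub>M noise N)"

lemma prob_space_triple: "prob_space triple"
  by (intro prob_space_pair prob_space_noise)

lemma nn_integral_triple_noise:
  "f \<in> borel_measurable triple \<Longrightarrow>
    (\<integral>\<^sup>+x. f x \<partial>triple) = (\<integral>\<^sup>+z. \<integral>\<^sup>+n. \<integral>\<^sup>+t. f (z, n, t) \<partial>noise N \<partial>noise N \<partial>noise N)"
  by (intro nn_integral_triple prob_space_noise)

lemma emeasure_noise [simp]: "emeasure (noise N) (space (noise N)) = 1"
  using prob_space.emeasure_space_1[OF prob_space_noise] .

lemma nn_integral_chan: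
  assumes f: "f \<in> borel_measurable (chan_space N R1 R2)"
  shows "(\<integral>\<^sup>+x. f x \<partial>chan_space N R1 R2) =
    (\<Sum>w1\<in>W1. \<Sum>w2\<in>W2. \<integral>\<^sup>+z. \<integral>\<^sup>+z'. f (w1, w2, z, z') \<partial>noise N \<partial>noise N) / ennreal (card W1 * card W2)"
proof -
  let ?p = "\<lambda>R. measure_pmf (pmf_of_set (msgs N R))"
  have q: "prob_space (noise N \<Otimes>\<^sub>M noise N)" "prob_space (?p R2 \<Otimes>\<^sub>M (noise N \<Otimes>\<^sub>M noise N))"
    by (intro prob_space_pair prob_space_noise prob_space_measure_pmf)+
  have f': "f \<in> borel_measurable (?p R1 \<Otimes>\<^sub>M (?p R2 \<Otimes>\<^sub>M (noise N \<Otimes>\<^sub>M noise N)))"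
    using f by (simp add: chan_space_def)
  have f2: "(\<lambda>y. f (w1, w2, y)) \<in> borel_measurable (noise N \<Otimes>\<^sub>M noise N)" for w1 w2
    using measurable_Pair2[OF measurable_Pair2[OF f', of w1], of w2] by simp
  have "(\<integral>\<^sup>+x. f x \<partial>chan_space N R1 R2) = (\<integral>\<^sup>+w1. \<integral>\<^sup>+w2. \<integral>\<^sup>+y. f (w1, w2, y) \<partial>(noise N \<Otimes>\<^sub>M noise N) \<partial>?p R2 \<partial>?p R1)"
    unfolding chan_space_def
    by (subst nn_integral_triple[OF prob_space_measure_pmf q(1) f']) simp
  also have "\<dots> = (\<integral>\<^sup>+w1. \<integral>\<^sup>+w2. \<integral>\<^sup>+z. \<integral>\<^sup>+z'. f (w1, w2, z, z') \<partial>noise N \<partial>noise N \<partial>?p R2 \<partial>?p R1)"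
    by (simp add: nn_integral_pair[OF prob_space_noise f2])
  also have "\<dots> = (\<Sum>w1\<in>W1. (\<Sum>w2\<in>W2. \<integral>\<^sup>+z. \<integral>\<^sup>+z'. f (w1, w2, z, z') \<partial>noise N \<partial>noise N) / ennreal (card W2)) / ennreal (card W1)"
    using W_ne finite_msgs by (simp add: nn_integral_pmf_of_set ennreal_of_nat_eq_real_of_nat)
  also have "\<dots> = (\<Sum>w1\<in>W1. \<Sum>w2\<in>W2. \<integral>\<^sup>+z. \<integral>\<^sup>+z'. f (w1, w2, z, z') \<partial>noise N \<partial>noise N) / ennreal (card W1 * card W2)"
  proof -
    have "inverse (ennreal (card W2)) * inverse (ennreal (card W1)) = inverse (ennreal (card W1 * card W2))"
      using W_ne by (simp add: inverse_ennreal mult.commute flip: ennreal_mult')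
    then show ?thesis
      by (simp only: divide_ennreal_def sum_distrib_right[symmetric] mult.assoc)
  qed
  finally show ?thesis .
qed

lemma sum_nn_integral_X1:
  assumes j: "j \<in> {1..N}"
  shows "(\<Sum>w1\<in>W1. \<Sum>w2\<in>W2. \<integral>\<^sup>+z. ennreal ((cmod (inp w1 (obs w2 z) j))\<^sup>2) \<partial>noise N) \<le> ennreal (card W1 * card W2) * ennreal P"
    and sum_X2: "ennreal (\<Sum>w1\<in>W1. \<Sum>w2\<in>W2. (cmod (enc2 C j w2))\<^sup>2) \<le> ennreal (card W1 * card W2) * ennreal P"
proof -
  have div: "x \<le> ennreal (card W1 * card W2) * ennreal P" if "x / ennreal (card W1 * card W2) \<le> ennreal P" for x
  proof -
    let ?c = "ennreal (card W1 * card W2)"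
    have "0 < real (card W1 * card W2)" using W_ne by simp
    then have c: "?c \<noteq> 0" "?c \<noteq> top" by (metis ennreal_eq_0_iff not_le, simp)
    have "x = ?c * (x / ?c)"
      unfolding ennreal_times_divide using mult_divide_eq_ennreal[OF c, of x] by (simp add: mult.commute)
    also have "\<dots> \<le> ?c * ennreal P" using that by (rule mult_left_mono) simp
    finally show ?thesis .
  qed
  note [measurable] = measurable_X1[OF valid j] measurable_X2
  have p: "(\<integral>\<^sup>+\<omega>. ennreal ((cmod (X1 gd gc C \<omega> j))\<^sup>2) \<partial>chan_space N R1 R2) \<le> ennreal P"
    "(\<integral>\<^sup>+\<omega>. ennreal ((cmod (X2 C \<omega> j))\<^sup>2) \<partial>chan_space N R1 R2) \<le> ennreal P"
    using valid j by (auto simp: valid_code_def)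
  have "(\<integral>\<^sup>+\<omega>. ennreal ((cmod (X1 gd gc C \<omega> j))\<^sup>2) \<partial>chan_space N R1 R2) =
     (\<Sum>w1\<in>W1. \<Sum>w2\<in>W2. \<integral>\<^sup>+z. ennreal ((cmod (inp w1 (obs w2 z) j))\<^sup>2) \<partial>noise N) / ennreal (card W1 * card W2)"
    by (subst nn_integral_chan) (measurable, simp only: X1_eq_inp[OF j], simp)
  then show "(\<Sum>w1\<in>W1. \<Sum>w2\<in>W2. \<integral>\<^sup>+z. ennreal ((cmod (inp w1 (obs w2 z) j))\<^sup>2) \<partial>noise N) \<le> ennreal (card W1 * card W2) * ennreal P"
    using p(1) by (intro div) simp
  have "(\<integral>\<^sup>+\<omega>. ennreal ((cmod (X2 C \<omega> j))\<^sup>2) \<partial>chan_space N R1 R2) =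
     ennreal (\<Sum>w1\<in>W1. \<Sum>w2\<in>W2. (cmod (enc2 C j w2))\<^sup>2) / ennreal (card W1 * card W2)"
    by (subst nn_integral_chan) (measurable, simp add: sum_nonneg ennreal_of_nat_eq_real_of_nat ennreal_mult'[symmetric])
  then show "ennreal (\<Sum>w1\<in>W1. \<Sum>w2\<in>W2. (cmod (enc2 C j w2))\<^sup>2) \<le> ennreal (card W1 * card W2) * ennreal P"
    using p(2) by (intro div) simp
qed

text \<open>Coefficients of X1, X2, Z1, V and the noise of the copy. All signals and estimation
  errors in the logarithms have this shape, so a single second-moment computation serves all
  bounds.\<close>

fun form :: "complex \<times> complex \<times> complex \<times> complex \<times> complex \<Rightarrow> nat \<times> nat \<Rightarrow>
    (nat \<Rightarrow> complex) \<times> (nat \<Rightarrow> complex) \<times> (nat \<Rightarrow> complex) \<Rightarrow> nat \<Rightarrow> complex" where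
  "form (A, B, Z, D, E) (w1, w2) (z, n, t) j =
    A * inp w1 (obs w2 z) j + B * enc2 C j w2 + Z * z j + D * n j + E * t j"

definition "sq c w x = (\<Sum>j\<in>{1..N}. (cmod (form c w x j))\<^sup>2)"

lemma inp_triple_measurable:
  assumes j: "j \<in> {1..N}"
  shows "(\<lambda>x. inp w1 (obs w2 (fst x)) j) \<in> borel_measurable triple"
    "(\<lambda>x. fst x j) \<in> borel_measurable triple"
    "(\<lambda>x. fst (snd x) j) \<in> borel_measurable triple"
    "(\<lambda>x. snd (snd x) j) \<in> borel_measurable triple"
proof -
  note [measurable] = inp_obs_measurable[OF j] measurable_noise_component[OF j]
  show "(\<lambda>x. inp w1 (obs w2 (fst x)) j) \<in> borel_measurable triple"
    "(\<lambda>x. fst x j) \<in> borel_measurable triple"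
    "(\<lambda>x. fst (snd x) j) \<in> borel_measurable triple"
    "(\<lambda>x. snd (snd x) j) \<in> borel_measurable triple"
    by measurable
qed

lemma form_measurable:
  assumes "j \<in> {1..N}" shows "(\<lambda>x. form c w x j) \<in> borel_measurable triple"
proof -
  obtain A B Z D E w1 w2 where c: "c = (A, B, Z, D, E)" "w = (w1, w2)" by (cases c, cases w) auto
  have "(\<lambda>x. form c w x j) = (\<lambda>x. A * inp w1 (obs w2 (fst x)) j + B * enc2 C j w2 + Z * fst x j + D * fst (snd x) j + E * snd (snd x) j)"
    unfolding c by (rule ext, case_tac x) simp
  then show ?thesis using inp_triple_measurable[OF assms] by simp
qed

lemma sq_nonneg: "0 \<le> sq c w x"
  by (simp add: sq_def sum_nonneg)

section \<open>Total powers and total correlation\<close>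

definition "pow1 = (\<Sum>(w1, w2)\<in>W1 \<times> W2. \<Sum>j\<in>{1..N}. \<integral>z. (cmod (inp w1 (obs w2 z) j))\<^sup>2 \<partial>noise N)"
definition "pow2 = (\<Sum>(w1, w2)\<in>W1 \<times> W2. \<Sum>j\<in>{1..N}. (cmod (enc2 C j w2))\<^sup>2)"
definition "corr = (\<Sum>(w1, w2)\<in>W1 \<times> W2. \<Sum>j\<in>{1..N}. (\<integral>z. inp w1 (obs w2 z) j \<partial>noise N) * cnj (enc2 C j w2))"

lemma inp_integrable:
  assumes "w1 \<in> W1" "w2 \<in> W2" "j \<in> {1..N}"
  shows "integrable (noise N) (\<lambda>z. (cmod (inp w1 (obs w2 z) j))\<^sup>2)"
    and "integrable (noise N) (\<lambda>z. inp w1 (obs w2 z) j)"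
proof -
  interpret prob_space "noise N" by (rule prob_space_noise)
  note [measurable] = inp_obs_measurable[OF assms(3)]
  have "(\<integral>\<^sup>+z. ennreal ((cmod (inp w1 (obs w2 z) j))\<^sup>2) \<partial>noise N) \<le>
     (\<Sum>w1\<in>W1. \<Sum>w2\<in>W2. \<integral>\<^sup>+z. ennreal ((cmod (inp w1 (obs w2 z) j))\<^sup>2) \<partial>noise N)"
    using assms finite_msgs by (intro order_trans[OF member_le_sum[of w2 W2] member_le_sum[of w1 W1]]) auto
  also have "\<dots> < \<infinity>"
    using sum_nn_integral_X1(1)[OF assms(3)] by (rule le_less_trans) (simp add: ennreal_mult_less_top)
  finally show sq: "integrable (noise N) (\<lambda>z. (cmod (inp w1 (obs w2 z) j))\<^sup>2)"
    by (intro integrableI_nonneg) auto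
  show "integrable (noise N) (\<lambda>z. inp w1 (obs w2 z) j)"
  proof (rule Bochner_Integration.integrable_bound[of _ "\<lambda>z. 1 + (cmod (inp w1 (obs w2 z) j))\<^sup>2"])
    have "cmod y \<le> 1 + (cmod y)\<^sup>2" for y
      using zero_le_power2[of "cmod y - 1"] by (simp add: power2_eq_square algebra_simps) (smt (verit) norm_ge_zero)
    then show "AE z in noise N. norm (inp w1 (obs w2 z) j) \<le> norm (1 + (cmod (inp w1 (obs w2 z) j))\<^sup>2)"
      by (intro AE_I2) (smt (verit) real_norm_def)
  qed (use sq in auto)
qed

text \<open>The noises are independent of each other and of the current inputs, so the only cross
  term left is that of the two inputs. The computation runs through nonnegative integrals and
  thereby yields integrability too.\<close>

lemma form_square:
  fixes A B Z D E :: complex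
  assumes "w1 \<in> W1" "w2 \<in> W2" "j \<in> {1..N}"
  defines "f \<equiv> \<lambda>x. (cmod (form (A, B, Z, D, E) (w1, w2) x j))\<^sup>2"
  shows "has_bochner_integral triple f
    ((cmod A)\<^sup>2 * (\<integral>z. (cmod (inp w1 (obs w2 z) j))\<^sup>2 \<partial>noise N) + (cmod B)\<^sup>2 * (cmod (enc2 C j w2))\<^sup>2 +
      2 * Re (A * cnj B * ((\<integral>z. inp w1 (obs w2 z) j \<partial>noise N) * cnj (enc2 C j w2))) +
      ((cmod Z)\<^sup>2 + (cmod D)\<^sup>2 + (cmod E)\<^sup>2))"
proof -
  interpret prob_space "noise N" by (rule prob_space_noise)
  note int = inp_integrable[OF assms(1-3)]
  let ?x = "\<lambda>z. inp w1 (obs w2 z) j" and ?y = "enc2 C j w2"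
  note [measurable] = inp_obs_measurable[OF assms(3)] measurable_noise_component[OF assms(3)]
  have ex: "(cmod (A * x + B * ?y))\<^sup>2 = (cmod A)\<^sup>2 * (cmod x)\<^sup>2 + (cmod B)\<^sup>2 * (cmod ?y)\<^sup>2 + 2 * Re (A * cnj B * (x * cnj ?y))" for x
  proof -
    have "(cmod (p + q))\<^sup>2 = (cmod p)\<^sup>2 + (cmod q)\<^sup>2 + 2 * Re (p * cnj q)" for p q
      unfolding cmod_power2 by (simp add: power2_eq_square algebra_simps)
    moreover have "A * x * cnj (B * ?y) = A * cnj B * (x * cnj ?y)" by simp
    ultimately show ?thesis by (simp only: norm_mult power_mult_distrib)
  qed
  define m where "m = (cmod A)\<^sup>2 * (\<integral>z. (cmod (?x z))\<^sup>2 \<partial>noise N) + (cmod B)\<^sup>2 * (cmod ?y)\<^sup>2 +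
      2 * Re (A * cnj B * ((\<integral>z. ?x z \<partial>noise N) * cnj ?y))"
  have main: "has_bochner_integral (noise N) (\<lambda>z. (cmod (A * ?x z + B * ?y))\<^sup>2) m"
  proof -
    have 1: "integrable (noise N) (\<lambda>z. A * cnj B * (?x z * cnj ?y))" using int(2) by simp
    have "(\<integral>z. A * cnj B * (?x z * cnj ?y) \<partial>noise N) = A * cnj B * ((\<integral>z. ?x z \<partial>noise N) * cnj ?y)"
      by (simp only: integral_mult_right_zero integral_mult_left_zero)
    then have "has_bochner_integral (noise N) (\<lambda>z. Re (A * cnj B * (?x z * cnj ?y)))
        (Re (A * cnj B * ((\<integral>z. ?x z \<partial>noise N) * cnj ?y)))"
      using integral_Re[OF 1] integrable_Re[OF 1] by (simp only: has_bochner_integral_iff)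
    moreover have "has_bochner_integral (noise N) (\<lambda>z. (cmod ?y)\<^sup>2) ((cmod ?y)\<^sup>2)"
      by (simp add: has_bochner_integral_iff prob_space)
    moreover have "has_bochner_integral (noise N) (\<lambda>z. (cmod (?x z))\<^sup>2) (\<integral>z. (cmod (?x z))\<^sup>2 \<partial>noise N)"
      using int(1) by (simp add: has_bochner_integral_iff)
    ultimately show ?thesis
      unfolding ex m_def by (intro has_bochner_integral_add has_bochner_integral_mult_right)
  qed
  let ?v = "(cmod Z)\<^sup>2 + (cmod D)\<^sup>2 + (cmod E)\<^sup>2"
  have m0: "0 \<le> m" unfolding has_bochner_integral_integral_eq[OF main, symmetric] by (rule Bochner_Integration.integral_nonneg) simp
  have f [measurable]: "f \<in> borel_measurable triple"
    using form_measurable[OF assms(3), of "(A, B, Z, D, E)" "(w1, w2)"] unfolding f_def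
    by (intro borel_measurable_power measurable_compose[OF _ borel_measurable_norm])
  have n: "(\<integral>\<^sup>+t. ennreal ((cmod (g + c * t j))\<^sup>2 + e) \<partial>noise N) = ennreal ((cmod g)\<^sup>2 + ((cmod c)\<^sup>2 + e))" if "0 \<le> e" for g c e
  proof -
    have "(\<integral>\<^sup>+t. ennreal ((cmod (g + c * t j))\<^sup>2 + e) \<partial>noise N) = (\<integral>\<^sup>+t. ennreal ((cmod (g + c * t j))\<^sup>2) + ennreal e \<partial>noise N)"
      using that by simp
    also have "\<dots> = ennreal ((cmod g)\<^sup>2 + (cmod c)\<^sup>2) + ennreal e"
      by (subst nn_integral_add) (auto simp: nn_integral_noise_square[OF assms(3)])
    finally show ?thesis using that by (simp add: add.assoc flip: ennreal_plus)
  qed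
  have "(\<integral>\<^sup>+x. ennreal (f x) \<partial>triple) = (\<integral>\<^sup>+z. \<integral>\<^sup>+n. \<integral>\<^sup>+t. ennreal ((cmod (A * ?x z + B * ?y + Z * z j + D * n j + E * t j))\<^sup>2) \<partial>noise N \<partial>noise N \<partial>noise N)"
    by (subst nn_integral_triple_noise) (measurable, simp add: f_def)
  also have "\<dots> = (\<integral>\<^sup>+z. ennreal ((cmod (A * ?x z + B * ?y + Z * z j))\<^sup>2 + ((cmod D)\<^sup>2 + (cmod E)\<^sup>2)) \<partial>noise N)"
    by (simp only: nn_integral_noise_square[OF assms(3)] n zero_le_power2)
  also have "\<dots> = (\<integral>\<^sup>+z. ennreal ((cmod (A * ?x z + B * ?y + Z * z j))\<^sup>2) + ennreal ((cmod D)\<^sup>2 + (cmod E)\<^sup>2) \<partial>noise N)"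
    by simp
  also have "\<dots> = (\<integral>\<^sup>+z. ennreal ((cmod (A * ?x z + B * ?y + Z * z j))\<^sup>2) \<partial>noise N) + ennreal ((cmod D)\<^sup>2 + (cmod E)\<^sup>2)"
    by (subst nn_integral_add) auto
  also have "\<dots> = ennreal m + ennreal ((cmod Z)\<^sup>2) + ennreal ((cmod D)\<^sup>2 + (cmod E)\<^sup>2)"
    unfolding nn_integral_obs_square[OF assms(3)]
    using main by (subst nn_integral_eq_integral) (auto simp: has_bochner_integral_iff)
  also have "\<dots> = ennreal (m + ?v)"
    using m0 by (simp add: add.assoc flip: ennreal_plus)
  finally show ?thesis
    unfolding m_def[symmetric] using m0 f by (intro has_bochner_integral_nn_integral) (auto simp: f_def intro!: AE_I2)
qed

abbreviation "W \<equiv> W1 \<times> W2"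

lemma sq_integral:
  assumes "w \<in> W" shows "integrable triple (sq c w)"
proof -
  obtain A B Z D E w1 w2 where c: "c = (A, B, Z, D, E)" "w = (w1, w2)" by (cases c, cases w) auto
  have "\<And>j. j \<in> {1..N} \<Longrightarrow> integrable triple (\<lambda>x. (cmod (form c w x j))\<^sup>2)"
    using form_square[of w1 w2] assms unfolding c has_bochner_integral_iff by blast
  then show ?thesis unfolding sq_def[abs_def] by (rule Bochner_Integration.integrable_sum)
qed

lemma sum_sq_integral:
  "(\<Sum>w\<in>W. \<integral>x. sq (A, B, Z, D, E) w x \<partial>triple) =
    (cmod A)\<^sup>2 * pow1 + (cmod B)\<^sup>2 * pow2 + 2 * Re (A * cnj B * corr) +
    real (card W * N) * ((cmod Z)\<^sup>2 + (cmod D)\<^sup>2 + (cmod E)\<^sup>2)"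
proof -
  define v where "v = (cmod Z)\<^sup>2 + (cmod D)\<^sup>2 + (cmod E)\<^sup>2"
  have "(\<integral>x. sq (A, B, Z, D, E) (w1, w2) x \<partial>triple) =
     (\<Sum>j\<in>{1..N}. (cmod A)\<^sup>2 * (\<integral>z. (cmod (inp w1 (obs w2 z) j))\<^sup>2 \<partial>noise N) + (cmod B)\<^sup>2 * (cmod (enc2 C j w2))\<^sup>2 +
      2 * Re (A * cnj B * ((\<integral>z. inp w1 (obs w2 z) j \<partial>noise N) * cnj (enc2 C j w2))) +
      v)" if "w1 \<in> W1" "w2 \<in> W2" for w1 w2
  proof -
    have "(\<integral>x. sq (A, B, Z, D, E) (w1, w2) x \<partial>triple) =
        (\<Sum>j\<in>{1..N}. \<integral>x. (cmod (form (A, B, Z, D, E) (w1, w2) x j))\<^sup>2 \<partial>triple)"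
      unfolding sq_def by (rule Bochner_Integration.integral_sum) (rule integrable.intros[OF form_square[OF that]])
    also have "\<dots> = (\<Sum>j\<in>{1..N}. (cmod A)\<^sup>2 * (\<integral>z. (cmod (inp w1 (obs w2 z) j))\<^sup>2 \<partial>noise N) + (cmod B)\<^sup>2 * (cmod (enc2 C j w2))\<^sup>2 +
      2 * Re (A * cnj B * ((\<integral>z. inp w1 (obs w2 z) j \<partial>noise N) * cnj (enc2 C j w2))) + v)"
      unfolding v_def by (rule sum.cong[OF refl]) (rule has_bochner_integral_integral_eq[OF form_square[OF that]])
    finally show ?thesis .
  qed
  then have "(\<Sum>w\<in>W. \<integral>x. sq (A, B, Z, D, E) w x \<partial>triple) = (\<Sum>(w1, w2)\<in>W.
     (\<Sum>j\<in>{1..N}. (cmod A)\<^sup>2 * (\<integral>z. (cmod (inp w1 (obs w2 z) j))\<^sup>2 \<partial>noise N) + (cmod B)\<^sup>2 * (cmod (enc2 C j w2))\<^sup>2 +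
      2 * Re (A * cnj B * ((\<integral>z. inp w1 (obs w2 z) j \<partial>noise N) * cnj (enc2 C j w2))) +
      v))"
    by (intro sum.cong refl) auto
  also have "\<dots> = (cmod A)\<^sup>2 * pow1 + (cmod B)\<^sup>2 * pow2 + 2 * Re (A * cnj B * corr) +
    real (card W * N) * v"
    unfolding pow1_def pow2_def corr_def
    by (simp only: case_prod_beta' sum.distrib sum_distrib_left Re_sum sum_constant card_atLeastAtMost) (simp add: mult.assoc)
  finally show ?thesis unfolding v_def .
qed

lemma pow_le:
  assumes P: "0 \<le> P"
  shows "pow1 \<le> real (card W * N) * P" "pow2 \<le> real (card W * N) * P"
proof -
  have const: "(\<Sum>j\<in>{1..N}. card W1 * card W2 * P) = real (card W * N) * P"
    by (simp add: card_cartesian_product mult_ac)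
  have "(\<Sum>w1\<in>W1. \<Sum>w2\<in>W2. \<integral>z. (cmod (inp w1 (obs w2 z) j))\<^sup>2 \<partial>noise N) \<le> card W1 * card W2 * P" if j: "j \<in> {1..N}" for j
  proof -
    have "(\<Sum>w1\<in>W1. \<Sum>w2\<in>W2. \<integral>\<^sup>+z. ennreal ((cmod (inp w1 (obs w2 z) j))\<^sup>2) \<partial>noise N) =
        ennreal (\<Sum>w1\<in>W1. \<Sum>w2\<in>W2. \<integral>z. (cmod (inp w1 (obs w2 z) j))\<^sup>2 \<partial>noise N)"
    proof -
      have "(\<Sum>w1\<in>W1. \<Sum>w2\<in>W2. \<integral>\<^sup>+z. ennreal ((cmod (inp w1 (obs w2 z) j))\<^sup>2) \<partial>noise N) =
        (\<Sum>w1\<in>W1. \<Sum>w2\<in>W2. ennreal (\<integral>z. (cmod (inp w1 (obs w2 z) j))\<^sup>2 \<partial>noise N))"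
        by (intro sum.cong refl nn_integral_eq_integral inp_integrable(1) j) auto
      then show ?thesis by (simp add: sum_nonneg)
    qed
    then have "ennreal (\<Sum>w1\<in>W1. \<Sum>w2\<in>W2. \<integral>z. (cmod (inp w1 (obs w2 z) j))\<^sup>2 \<partial>noise N) \<le> ennreal (card W1 * card W2 * P)"
      using sum_nn_integral_X1(1)[OF j] P by (simp add: ennreal_mult')
    then show ?thesis using P by (simp add: ennreal_le_iff)
  qed
  then have "(\<Sum>j\<in>{1..N}. \<Sum>w1\<in>W1. \<Sum>w2\<in>W2. \<integral>z. (cmod (inp w1 (obs w2 z) j))\<^sup>2 \<partial>noise N) \<le> (\<Sum>j\<in>{1..N}. card W1 * card W2 * P)"
    by (intro sum_mono) auto
  moreover have "pow1 = (\<Sum>j\<in>{1..N}. \<Sum>w1\<in>W1. \<Sum>w2\<in>W2. \<integral>z. (cmod (inp w1 (obs w2 z) j))\<^sup>2 \<partial>noise N)"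
    unfolding pow1_def sum.cartesian_product[symmetric] by (subst (3) sum.swap, subst (2) sum.swap) (rule refl)
  ultimately show "pow1 \<le> real (card W * N) * P" by (simp only: const)
  have "(\<Sum>w1\<in>W1. \<Sum>w2\<in>W2. (cmod (enc2 C j w2))\<^sup>2) \<le> card W1 * card W2 * P" if j: "j \<in> {1..N}" for j
  proof -
    have "ennreal (\<Sum>w1\<in>W1. \<Sum>w2\<in>W2. (cmod (enc2 C j w2))\<^sup>2) \<le> ennreal (card W1 * card W2 * P)"
      using sum_X2[OF j] P by (simp add: ennreal_mult')
    then show ?thesis using P by (subst (asm) ennreal_le_iff) auto
  qed
  then have "(\<Sum>j\<in>{1..N}. \<Sum>w1\<in>W1. \<Sum>w2\<in>W2. (cmod (enc2 C j w2))\<^sup>2) \<le> (\<Sum>j\<in>{1..N}. card W1 * card W2 * P)"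
    by (intro sum_mono) auto
  moreover have "pow2 = (\<Sum>j\<in>{1..N}. \<Sum>w1\<in>W1. \<Sum>w2\<in>W2. (cmod (enc2 C j w2))\<^sup>2)"
    unfolding pow2_def sum.cartesian_product[symmetric] by (subst (3) sum.swap, subst (2) sum.swap) (rule refl)
  ultimately show "pow2 \<le> real (card W * N) * P" by (simp only: const)
qed

text \<open>Cauchy-Schwarz in the form \<open>E |X1 - u * X2|^2 >= 0\<close>, where \<open>u\<close>
  is the phase of the correlation.\<close>

lemma corr_eq:
  assumes P: "0 \<le> P"
  shows "\<exists>la. corr = of_real (real (card W * N) * P) * la \<and> cmod la \<le> 1"
proof -
  let ?c = "real (card W * N) * P"
  define u where "u = (if corr = 0 then 1 else corr / of_real (cmod corr))"
  have u: "cmod u = 1" "cnj u * corr = of_real (cmod corr)"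
    by (auto simp: u_def norm_divide complex_norm_square[symmetric] power2_eq_square mult.commute)
  have "0 \<le> (\<Sum>w\<in>W. \<integral>x. sq (1, - u, 0, 0, 0) w x \<partial>triple)"
    by (intro sum_nonneg integral_nonneg_AE AE_I2 sq_nonneg)
  also have "\<dots> = pow1 + pow2 - 2 * cmod corr"
    unfolding sum_sq_integral by (simp add: u)
  finally have le: "cmod corr \<le> ?c" using pow_le[OF P] by linarith
  have div: "corr = of_real c * (corr / of_real c) \<and> cmod (corr / of_real c) \<le> 1" if "0 < c" "cmod corr \<le> c" for c
    using that by (simp add: norm_divide divide_le_eq)
  show ?thesis
  proof (cases "?c = 0")
    case True
    \<comment> \<open>No power or no time: the correlation is 0 and any \<open>la\<close>
      fits.\<close>
    then show ?thesis using le by (intro exI[of _ 0]) auto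
  next
    case False
    moreover have "0 \<le> ?c" using P by simp
    ultimately have "0 < ?c" by linarith
    then show ?thesis using le
      using div[of ?c] by blast
  qed
qed

text \<open>Upper bound for the time average of \<open>E (cmod (form c))\<^sup>2\<close> when the inputs have power \<open>P\<close> and
  correlation \<open>la\<close>.\<close>

definition "mean_sq la c = (case c of (A, B, Z, D, E) \<Rightarrow>
  P * ((cmod A)\<^sup>2 + (cmod B)\<^sup>2 + 2 * Re (A * cnj B * la)) + ((cmod Z)\<^sup>2 + (cmod D)\<^sup>2 + (cmod E)\<^sup>2))"

lemma sum_sq_le:
  assumes P: "0 \<le> P" and la: "corr = of_real (real (card W * N) * P) * la"
  shows "(\<Sum>w\<in>W. \<integral>x. sq c w x \<partial>triple) \<le> real (card W * N) * mean_sq la c"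
proof -
  obtain A B Z D E where c: "c = (A, B, Z, D, E)" by (cases c) auto
  have r: "Re (A * cnj B * corr) = real (card W * N) * P * Re (A * cnj B * la)"
    unfolding la by (simp add: algebra_simps)
  show ?thesis
    unfolding c sum_sq_integral mean_sq_def r
    using mult_left_mono[OF pow_le(1)[OF P], of "(cmod A)\<^sup>2"] mult_left_mono[OF pow_le(2)[OF P], of "(cmod B)\<^sup>2"]
    by (simp add: algebra_simps)
qed

end

section \<open>Logarithms of the likelihood ratios\<close>

context feedback_code
begin

lemma form_eq:
  "form (A, B, Z, D, E) w x j = A * inp (fst w) (obs (snd w) (fst x)) j + B * enc2 C j (snd w) +
    Z * fst x j + D * fst (snd x) j + E * snd (snd x) j"
  by (cases w, cases x) simp

declare form.simps [simp del]

abbreviation "y1 w x \<equiv> outs (fst w) (obs (snd w) (fst x))"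
abbreviation "rl k w x \<equiv> relay k (fst w) (snd w) (fst x) (fst (snd x))"
abbreviation "y2 al b w x \<equiv> out2 (snd w) al b (snd (snd x)) (rl (gc / of_real b) w x)"

lemma y1_form: "j \<in> {1..N} \<Longrightarrow> out (fst w) (obs (snd w) (fst x)) j = form (gd, gc, 1, 0, 0) w x j"
  by (simp add: form_eq out_eq obs_app)

lemma rl_form: "j \<in> {1..N} \<Longrightarrow> rl k w x j = form (k, 0, 0, 1, 0) w x j"
  by (simp add: form_eq relay_def)

lemma y2_form: "j \<in> {1..N} \<Longrightarrow> b \<noteq> 0 \<Longrightarrow> y2 al b w x j = form (gc, gd, 0, of_real b, al) w x j"
  by (simp add: form_eq relay_def out2_def algebra_simps)

lemma ln_prod_tilt:
  assumes "0 < v" "\<And>j. j \<in> {1..N} \<Longrightarrow> f j = form c w x j" "\<And>j. j \<in> {1..N} \<Longrightarrow> g j = form c' w x j"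
  shows "ln (\<Prod>j\<in>{1..N}. tilt v (f j) (g j)) = sq c w x - sq c' w x / v - N * ln v"
proof -
  have "ln (\<Prod>j\<in>{1..N}. tilt v (f j) (g j)) = (\<Sum>j\<in>{1..N}. ln (tilt v (f j) (g j)))"
    by (rule ln_prod) (rule finite_atLeastAtMost less_imp_neq[THEN not_sym, OF tilt_pos[OF assms(1)]])+
  also have "\<dots> = (\<Sum>j\<in>{1..N}. (cmod (form c w x j))\<^sup>2 - (cmod (form c' w x j))\<^sup>2 / v - ln v)"
    using assms by (intro sum.cong refl) (simp add: tilt_def ln_div)
  finally show ?thesis by (simp add: sq_def sum_subtractf sum_divide_distrib)
qed

lemma ln_prod_scaled_tilt:
  assumes "0 < v" "0 < b" "\<And>j. j \<in> {1..N} \<Longrightarrow> f j = form c w x j" "\<And>j. j \<in> {1..N} \<Longrightarrow> g j = form c' w x j"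
  shows "ln (\<Prod>j\<in>{1..N}. b\<^sup>2 * tilt v (f j) (g j)) = sq c w x - sq c' w x / v - N * ln v + N * ln (b\<^sup>2)"
proof -
  have "ln (\<Prod>j\<in>{1..N}. b\<^sup>2 * tilt v (f j) (g j)) = ln ((\<Prod>j\<in>{1..N}. b\<^sup>2) * (\<Prod>j\<in>{1..N}. tilt v (f j) (g j)))"
    by (simp add: prod.distrib)
  also have "\<dots> = ln (\<Prod>j\<in>{1..N}. b\<^sup>2) + ln (\<Prod>j\<in>{1..N}. tilt v (f j) (g j))"
    using assms(2) by (intro ln_mult_pos tilt_prod_pos[OF assms(1)]) simp
  finally show ?thesis
    using ln_prod_tilt[OF assms(1,3,4)] assms(2) by (simp add: ln_realpow)
qed

lemma ln_prod_exp:
  assumes "\<And>j. j \<in> {1..N} \<Longrightarrow> f j = form c w x j" "\<And>j. j \<in> {1..N} \<Longrightarrow> g j = form c' w x j"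
  shows "ln (\<Prod>j\<in>{1..N}. exp ((cmod (f j))\<^sup>2 - (cmod (g j))\<^sup>2)) = sq c w x - sq c' w x"
  using ln_prod_tilt[of 1 f c w x g c'] assms by (simp add: tilt_def)

lemma prod_tilt_measurable:
  assumes "\<And>j x. j \<in> {1..N} \<Longrightarrow> f x j = form c w x j" "\<And>j x. j \<in> {1..N} \<Longrightarrow> g x j = form c' w x j"
  shows "(\<lambda>x. \<Prod>j\<in>{1..N}. a * tilt v (f x j) (g x j)) \<in> borel_measurable triple"
proof -
  have "(\<lambda>x. \<Prod>j\<in>{1..N}. a * tilt v (f x j) (g x j)) = (\<lambda>x. \<Prod>j\<in>{1..N}. a * tilt v (form c w x j) (form c' w x j))"
    using assms by (intro ext prod.cong) auto
  then show ?thesis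
    by (simp only:) (intro borel_measurable_prod borel_measurable_times borel_measurable_const tilt_measurable form_measurable)
qed

lemmas prod_tilt_measurable' = prod_tilt_measurable[where a = 1, simplified mult_1]

lemma prod_exp_measurable:
  assumes "\<And>j x. j \<in> {1..N} \<Longrightarrow> f x j = form c w x j" "\<And>j x. j \<in> {1..N} \<Longrightarrow> g x j = form c' w x j"
  shows "(\<lambda>x. \<Prod>j\<in>{1..N}. exp ((cmod (f x j))\<^sup>2 - (cmod (g x j))\<^sup>2)) \<in> borel_measurable triple"
  using prod_tilt_measurable'[where f = f and c = c and g = g and c' = c' and v = 1, OF assms] by (simp add: tilt_def)

lemma triple_maps:
  "(\<lambda>x. y1 w x) \<in> measurable triple (noise N)"
  "(\<lambda>x. obs w2 (fst x)) \<in> measurable triple (noise N)"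
  "(\<lambda>x. obs w2 (snd (snd x))) \<in> measurable triple (noise N)"
  "(\<lambda>x. rl k w x) \<in> measurable triple (noise N)"
  "(\<lambda>x. y2 al b w x) \<in> measurable triple (noise N)"
proof -
  note [measurable] = outs_measurable obs_measurable
  show "(\<lambda>x. y1 w x) \<in> measurable triple (noise N)"
    "(\<lambda>x. obs w2 (fst x)) \<in> measurable triple (noise N)"
    "(\<lambda>x. obs w2 (snd (snd x))) \<in> measurable triple (noise N)"
    by measurable
  have r: "(\<lambda>x. rl k w x) \<in> measurable triple (noise N)" for k
    using measurable_compose[of "\<lambda>x. (fst x, fst (snd x))" triple "noise N \<Otimes>\<^sub>M noise N" "\<lambda>(z, v). relay k (fst w) (snd w) z v", OF _ relay_measurable]
    by simp
  then show "(\<lambda>x. rl k w x) \<in> measurable triple (noise N)" .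
  have "(\<lambda>x. (snd (snd x), rl (gc / of_real b) w x)) \<in> measurable triple (noise N \<Otimes>\<^sub>M noise N)"
    using r by (intro measurable_Pair) auto
  from measurable_compose[OF this out2_measurable]
  show "(\<lambda>x. y2 al b w x) \<in> measurable triple (noise N)" by simp
qed

lemma gain_triple_measurable:
  "(\<lambda>x. gain1 w1 (y1 w x)) \<in> borel_measurable triple" "(\<lambda>x. gain2 w2 (y2 al b w x)) \<in> borel_measurable triple"
  by (rule measurable_compose[OF triple_maps(1) gain_measurable(1)], rule measurable_compose[OF triple_maps(5) gain_measurable(2)])

lemma rl_space: "x \<in> space triple \<Longrightarrow> rl k w x \<in> space (noise N)"
  using measurable_space[OF triple_maps(4)] .

lemma out2_unit: "out2 w2 0 1 t q = (\<lambda>j\<in>{1..N}. gd * enc2 C j w2 + q j)"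
  by (simp add: out2_def)

lemma sum_W: "(\<Sum>w\<in>W. f w) = (\<Sum>w1\<in>W1. \<Sum>w2\<in>W2. f (w1, w2))"
  by (simp add: sum.cartesian_product)

lemma card_W: "ennreal (card W) = ennreal (card W1) * ennreal (card W2)" "0 < card W"
  using W_ne by (simp_all add: card_cartesian_product ennreal_mult')

text \<open>What \<open>sum_log_le\<close> asks of a ratio: positive, measurable, and of mean at
  most 1 when averaged over the message pairs.\<close>

definition "admissible G \<longleftrightarrow>
  (\<forall>w\<in>W. G w \<in> borel_measurable triple \<and> (\<forall>x\<in>space triple. 0 < G w x)) \<and>
  (\<Sum>w\<in>W. \<integral>\<^sup>+x. ennreal (G w x) \<partial>triple) \<le> ennreal (card W)"

text \<open>The six ratios stand, in this order, for \<open>I(W1; Y1 | W2)\<close>,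
  \<open>I(W1; Y1)\<close>, \<open>I(W1; Y1, Q | W2)\<close>, \<open>I(W2; Y2)\<close>,
  \<open>I(W2; Y2, St)\<close> and \<open>I(W2; Y1, Y2 | W1)\<close>. The parameters
  \<open>c\<close>, \<open>d\<close>, \<open>e\<close> are coefficients of linear estimates that
  center the Gaussian references, and \<open>v\<close>, \<open>u\<close> are their
  variances.\<close>

definition "direct1 v d w x = gain1 (fst w) (y1 w x) *
  (\<Prod>j\<in>{1..N}. tilt v (fst x j) (out (fst w) (obs (snd w) (fst x)) j - d * enc2 C j (snd w)))"

definition "genie1 v w x = gain1 (fst w) (y1 w x) *
  (\<Prod>j\<in>{1..N}. tilt v (obs (snd w) (fst x) j) (out (fst w) (obs (snd w) (fst x)) j)) / obs_dens (obs (snd w) (fst x))"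

definition "relay1 v k c d w x = gain1 (fst w) (y1 w x) * inp_dens k (snd w) (rl k w x) *
  (\<Prod>j\<in>{1..N}. tilt v (fst x j) (out (fst w) (obs (snd w) (fst x)) j - (c * rl k w x j + d * enc2 C j (snd w)))) *
  (\<Prod>j\<in>{1..N}. exp ((cmod (fst (snd x) j))\<^sup>2 - (cmod (rl k w x j))\<^sup>2))"

definition "relay2 v w x = gain2 (snd w) (y2 0 1 w x) *
  (\<Prod>j\<in>{1..N}. tilt v (rl gc w x j) (y2 0 1 w x j)) / inp_dens gc (snd w) (rl gc w x)"

definition "genie2 v al b e w x = gain2 (snd w) (y2 al b w x) *
  (\<Prod>j\<in>{1..N}. b\<^sup>2 * tilt v (rl (gc / of_real b) w x j) (y2 al b w x j - e * obs (snd w) (snd (snd x)) j)) *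
  (obs_dens (obs (snd w) (snd (snd x))) *
    (\<Prod>j\<in>{1..N}. exp ((cmod (snd (snd x) j))\<^sup>2 - (cmod (obs (snd w) (snd (snd x)) j))\<^sup>2))) /
  inp_dens (gc / of_real b) (snd w) (rl (gc / of_real b) w x)"

definition "direct2 u v e w x = gain2 (snd w) (y2 0 1 w x) *
  (\<Prod>j\<in>{1..N}. tilt u (fst (snd x) j) (y2 0 1 w x j - (e * obs (snd w) (fst x) j + gc * inp (fst w) (obs (snd w) (fst x)) j))) *
  (\<Prod>j\<in>{1..N}. tilt v (fst x j) (obs (snd w) (fst x) j))"

lemma direct1_admissible: "0 < v \<Longrightarrow> admissible (direct1 v d)"
  unfolding admissible_def
proof (intro conjI ballI)
  assume v: "0 < v"
  fix w
  have [measurable]: "(\<lambda>x. \<Prod>j\<in>{1..N}. tilt v (fst x j) (out (fst w) (obs (snd w) (fst x)) j - d * enc2 C j (snd w))) \<in> borel_measurable triple" for w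
    by (rule prod_tilt_measurable'[where c = "(0, 0, 1, 0, 0)" and c' = "(gd, gc - d, 1, 0, 0)" and w = w])
      (simp_all add: y1_form form_eq algebra_simps)
  note [measurable] = gain_triple_measurable
  show m [measurable]: "direct1 v d w \<in> borel_measurable triple" for w unfolding direct1_def by measurable
  show "0 < direct1 v d w x" for x
    unfolding direct1_def by (intro mult_pos_pos gain_pos tilt_prod_pos v)
  have "(\<Sum>w\<in>W. \<integral>\<^sup>+x. ennreal (direct1 v d w x) \<partial>triple) =
    (\<Sum>w2\<in>W2. \<Sum>w1\<in>W1. \<integral>\<^sup>+z. ennreal (gain1 w1 (outs w1 (obs w2 z)) * (\<Prod>j\<in>{1..N}. tilt v (z j) (out w1 (obs w2 z) j - d * enc2 C j w2))) \<partial>noise N)"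
    unfolding sum_W by (subst sum.swap) (simp add: nn_integral_triple_noise, simp add: direct1_def)
  also have "\<dots> \<le> (\<Sum>w2\<in>W2. ennreal (card W1))"
    by (intro sum_mono sum_gain1_tilt_le v)
  also have "\<dots> = ennreal (card W)" by (simp add: card_W ennreal_of_nat_eq_real_of_nat mult.commute)
  finally show "(\<Sum>w\<in>W. \<integral>\<^sup>+x. ennreal (direct1 v d w x) \<partial>triple) \<le> ennreal (card W)" .
qed

lemma ln_direct1:
  assumes v: "0 < v"
  shows "ln (direct1 v d w x) = ln (gain1 (fst w) (y1 w x)) + sq (0, 0, 1, 0, 0) w x - sq (gd, gc - d, 1, 0, 0) w x / v - N * ln v"
  unfolding direct1_def ln_mult_pos[OF gain_pos(1) tilt_prod_pos[OF v]]
  by (subst ln_prod_tilt[OF v, where c = "(0, 0, 1, 0, 0)" and w = w and x = x and c' = "(gd, gc - d, 1, 0, 0)"])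
    (simp_all add: y1_form form_eq algebra_simps)

lemma genie1_admissible: "0 < v \<Longrightarrow> admissible (genie1 v)"
  unfolding admissible_def
proof (intro conjI ballI)
  assume v: "0 < v"
  fix w
  have [measurable]: "(\<lambda>x. \<Prod>j\<in>{1..N}. tilt v (obs (snd w) (fst x) j) (out (fst w) (obs (snd w) (fst x)) j)) \<in> borel_measurable triple" for w
    by (rule prod_tilt_measurable'[where c = "(0, gc, 1, 0, 0)" and c' = "(gd, gc, 1, 0, 0)" and w = w])
      (simp_all add: y1_form form_eq obs_app)
  note [measurable] = gain_triple_measurable measurable_compose[OF triple_maps(2) obs_dens_measurable]
  show m [measurable]: "genie1 v w \<in> borel_measurable triple" for w unfolding genie1_def by measurable
  show "0 < genie1 v w x" for x
    unfolding genie1_def by (intro divide_pos_pos mult_pos_pos gain_pos tilt_prod_pos v obs_dens_pos)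
  show "(\<Sum>w\<in>W. \<integral>\<^sup>+x. ennreal (genie1 v w x) \<partial>triple) \<le> ennreal (card W)"
    using sum_gain1_obs_dens_le[OF v] unfolding sum_W card_W
    by (simp add: nn_integral_triple_noise, simp add: genie1_def)
qed

lemma ln_genie1:
  assumes v: "0 < v"
  shows "ln (genie1 v w x) = ln (gain1 (fst w) (y1 w x)) + sq (0, gc, 1, 0, 0) w x - sq (gd, gc, 1, 0, 0) w x / v - N * ln v
    - ln (obs_dens (obs (snd w) (fst x)))"
  unfolding genie1_def ln_divide_pos[OF mult_pos_pos[OF gain_pos(1) tilt_prod_pos[OF v]] obs_dens_pos]
    ln_mult_pos[OF gain_pos(1) tilt_prod_pos[OF v]]
  by (subst ln_prod_tilt[OF v, where c = "(0, gc, 1, 0, 0)" and w = w and x = x and c' = "(gd, gc, 1, 0, 0)"])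
    (simp_all add: y1_form form_eq obs_app)

lemma relay1_admissible: "0 < v \<Longrightarrow> admissible (relay1 v k c d)"
  unfolding admissible_def
proof (intro conjI ballI)
  assume v: "0 < v"
  fix w
  have [measurable]: "(\<lambda>x. \<Prod>j\<in>{1..N}. tilt v (fst x j) (out (fst w) (obs (snd w) (fst x)) j - (c * rl k w x j + d * enc2 C j (snd w)))) \<in> borel_measurable triple" for w
    by (rule prod_tilt_measurable'[where c = "(0, 0, 1, 0, 0)" and c' = "(gd - c * k, gc - d, 1, - c, 0)" and w = w])
      (simp_all add: y1_form rl_form form_eq algebra_simps)
  have [measurable]: "(\<lambda>x. \<Prod>j\<in>{1..N}. exp ((cmod (fst (snd x) j))\<^sup>2 - (cmod (rl k w x j))\<^sup>2)) \<in> borel_measurable triple" for w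
    by (rule prod_exp_measurable[where c = "(0, 0, 0, 1, 0)" and c' = "(k, 0, 0, 1, 0)" and w = w])
      (simp_all add: rl_form form_eq)
  note [measurable] = gain_triple_measurable measurable_compose[OF triple_maps(4) inp_dens_measurable]
  show m [measurable]: "relay1 v k c d w \<in> borel_measurable triple" for w unfolding relay1_def by measurable
  show "0 < relay1 v k c d w x" if "x \<in> space triple" for x
    unfolding relay1_def using that
    by (intro mult_pos_pos gain_pos tilt_prod_pos v inp_dens_pos rl_space prod_pos) auto
  have "(\<Sum>w\<in>W. \<integral>\<^sup>+x. ennreal (relay1 v k c d w x) \<partial>triple) =
    (\<Sum>w2\<in>W2. \<Sum>w1\<in>W1. \<integral>\<^sup>+z. \<integral>\<^sup>+n. ennreal (gain1 w1 (outs w1 (obs w2 z)) * inp_dens k w2 (relay k w1 w2 z n) *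
      (\<Prod>j\<in>{1..N}. tilt v (z j) (out w1 (obs w2 z) j - (c * relay k w1 w2 z n j + d * enc2 C j w2))) *
      (\<Prod>j\<in>{1..N}. exp ((cmod (n j))\<^sup>2 - (cmod (relay k w1 w2 z n j))\<^sup>2))) \<partial>noise N \<partial>noise N)"
    unfolding sum_W by (subst sum.swap) (simp add: nn_integral_triple_noise, simp add: relay1_def)
  also have "\<dots> \<le> (\<Sum>w2\<in>W2. ennreal (card W1))"
    by (intro sum_mono sum_gain1_inp_dens_le v)
  also have "\<dots> = ennreal (card W)" by (simp add: card_W ennreal_of_nat_eq_real_of_nat mult.commute)
  finally show "(\<Sum>w\<in>W. \<integral>\<^sup>+x. ennreal (relay1 v k c d w x) \<partial>triple) \<le> ennreal (card W)" .
qed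

lemma ln_mult3:
  "0 < a \<Longrightarrow> 0 < b \<Longrightarrow> 0 < c \<Longrightarrow> ln (a * b * c :: real) = ln a + ln b + ln c"
  "0 < a \<Longrightarrow> 0 < b \<Longrightarrow> 0 < c \<Longrightarrow> 0 < d \<Longrightarrow> ln (a * b * c * d :: real) = ln a + ln b + ln c + ln d"
  "0 < a \<Longrightarrow> 0 < b \<Longrightarrow> 0 < c \<Longrightarrow> ln (a * b / c :: real) = ln a + ln b - ln c"
  "0 < a \<Longrightarrow> 0 < b \<Longrightarrow> 0 < c \<Longrightarrow> 0 < d \<Longrightarrow> 0 < q \<Longrightarrow> ln (a * b * (c * d) / q :: real) = ln a + ln b + ln c + ln d - ln q"
  by (simp_all add: ln_mult_pos ln_divide_pos)

lemma ln_relay1: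
  assumes v: "0 < v" and x: "x \<in> space triple"
  shows "ln (relay1 v k c d w x) = ln (gain1 (fst w) (y1 w x)) + ln (inp_dens k (snd w) (rl k w x)) +
    sq (0, 0, 1, 0, 0) w x - sq (gd - c * k, gc - d, 1, - c, 0) w x / v - N * ln v +
    sq (0, 0, 0, 1, 0) w x - sq (k, 0, 0, 1, 0) w x"
proof -
  have "0 < (\<Prod>j\<in>{1..N}. exp ((cmod (fst (snd x) j))\<^sup>2 - (cmod (rl k w x j))\<^sup>2))" by (intro prod_pos) auto
  from ln_mult3(2)[OF gain_pos(1) inp_dens_pos[OF rl_space[OF x]] tilt_prod_pos[OF v] this]
  show ?thesis
    unfolding relay1_def
    by (simp only:)
      (subst ln_prod_tilt[OF v, where c = "(0, 0, 1, 0, 0)" and w = w and x = x and c' = "(gd - c * k, gc - d, 1, - c, 0)"];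
       (subst ln_prod_exp[where c = "(0, 0, 0, 1, 0)" and w = w and x = x and c' = "(k, 0, 0, 1, 0)"])?;
       simp add: y1_form rl_form form_eq algebra_simps)
qed

lemma relay2_admissible: "0 < v \<Longrightarrow> admissible (relay2 v)"
  unfolding admissible_def
proof (intro conjI ballI)
  assume v: "0 < v"
  fix w
  have [measurable]: "(\<lambda>x. \<Prod>j\<in>{1..N}. tilt v (rl gc w x j) (y2 0 1 w x j)) \<in> borel_measurable triple" for w
    by (rule prod_tilt_measurable'[where c = "(gc, 0, 0, 1, 0)" and c' = "(gc, gd, 0, 1, 0)" and w = w])
      (simp_all add: relay_def out2_def form_eq algebra_simps)
  note [measurable] = gain_triple_measurable measurable_compose[OF triple_maps(4) inp_dens_measurable]
  show m [measurable]: "relay2 v w \<in> borel_measurable triple" for w unfolding relay2_def by measurable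
  show "0 < relay2 v w x" if "x \<in> space triple" for x
    unfolding relay2_def using that
    by (intro divide_pos_pos mult_pos_pos gain_pos tilt_prod_pos v inp_dens_pos rl_space)
  show "(\<Sum>w\<in>W. \<integral>\<^sup>+x. ennreal (relay2 v w x) \<partial>triple) \<le> ennreal (card W)"
    using sum_gain2_inp_dens_le[OF v, of gc] unfolding sum_W card_W out2_unit
    by (simp add: nn_integral_triple_noise, simp add: relay2_def out2_unit)
qed

lemma ln_relay2:
  assumes v: "0 < v" and x: "x \<in> space triple"
  shows "ln (relay2 v w x) = ln (gain2 (snd w) (y2 0 1 w x)) + sq (gc, 0, 0, 1, 0) w x -
    sq (gc, gd, 0, 1, 0) w x / v - N * ln v - ln (inp_dens gc (snd w) (rl gc w x))"
  unfolding relay2_def ln_mult3(3)[OF gain_pos(2) tilt_prod_pos[OF v] inp_dens_pos[OF rl_space[OF x]]]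
  by (subst ln_prod_tilt[OF v, where c = "(gc, 0, 0, 1, 0)" and w = w and x = x and c' = "(gc, gd, 0, 1, 0)"])
    (simp_all add: y2_form rl_form form_eq out2_def algebra_simps)

lemma genie2_admissible: "0 < v \<Longrightarrow> 0 < b \<Longrightarrow> admissible (genie2 v al b e)"
  unfolding admissible_def
proof (intro conjI ballI)
  assume v: "0 < v" and b: "0 < b"
  fix w
  have [measurable]: "(\<lambda>x. \<Prod>j\<in>{1..N}. b\<^sup>2 * tilt v (rl (gc / of_real b) w x j) (y2 al b w x j - e * obs (snd w) (snd (snd x)) j))
      \<in> borel_measurable triple" for w
    by (rule prod_tilt_measurable[where c = "(gc / of_real b, 0, 0, 1, 0)" and c' = "(gc, gd - e * gc, 0, of_real b, al - e)" and w = w])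
      (use b in \<open>simp_all add: y2_form rl_form obs_app form_eq algebra_simps\<close>)
  have [measurable]: "(\<lambda>x. \<Prod>j\<in>{1..N}. exp ((cmod (snd (snd x) j))\<^sup>2 - (cmod (obs (snd w) (snd (snd x)) j))\<^sup>2)) \<in> borel_measurable triple" for w :: "nat \<times> nat"
    by (rule prod_exp_measurable[where c = "(0, 0, 0, 0, 1)" and c' = "(0, gc, 0, 0, 1)" and w = w])
      (simp_all add: obs_app form_eq)
  note [measurable] = gain_triple_measurable measurable_compose[OF triple_maps(4) inp_dens_measurable]
    measurable_compose[OF triple_maps(3) obs_dens_measurable]
  show m [measurable]: "genie2 v al b e w \<in> borel_measurable triple" for w unfolding genie2_def by measurable
  show "0 < genie2 v al b e w x" if "x \<in> space triple" for x
    unfolding genie2_def using that b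
    by (intro divide_pos_pos mult_pos_pos gain_pos prod_pos tilt_pos v inp_dens_pos rl_space obs_dens_pos) auto
  show "(\<Sum>w\<in>W. \<integral>\<^sup>+x. ennreal (genie2 v al b e w x) \<partial>triple) \<le> ennreal (card W)"
    using sum_gain2_obs_dens_le[OF v b, of al "gc / of_real b" e] unfolding sum_W card_W
    by (simp add: nn_integral_triple_noise, simp add: genie2_def)
qed

lemma ln_genie2:
  assumes v: "0 < v" and b: "0 < b" and x: "x \<in> space triple"
  shows "ln (genie2 v al b e w x) = ln (gain2 (snd w) (y2 al b w x)) + sq (gc / of_real b, 0, 0, 1, 0) w x -
    sq (gc, gd - e * gc, 0, of_real b, al - e) w x / v - N * ln v + N * ln (b\<^sup>2) +
    ln (obs_dens (obs (snd w) (snd (snd x)))) + sq (0, 0, 0, 0, 1) w x - sq (0, gc, 0, 0, 1) w x -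
    ln (inp_dens (gc / of_real b) (snd w) (rl (gc / of_real b) w x))"
proof -
  have p: "0 < (\<Prod>j\<in>{1..N}. exp ((cmod (snd (snd x) j))\<^sup>2 - (cmod (obs (snd w) (snd (snd x)) j))\<^sup>2))"
    "0 < (\<Prod>j\<in>{1..N}. b\<^sup>2 * tilt v (rl (gc / of_real b) w x j) (y2 al b w x j - e * obs (snd w) (snd (snd x)) j))"
    using b by (auto intro!: prod_pos mult_pos_pos tilt_pos v)
  have "ln (\<Prod>j\<in>{1..N}. b\<^sup>2 * tilt v (rl (gc / of_real b) w x j) (y2 al b w x j - e * obs (snd w) (snd (snd x)) j)) =
      sq (gc / of_real b, 0, 0, 1, 0) w x - sq (gc, gd - e * gc, 0, of_real b, al - e) w x / v - N * ln v + N * ln (b\<^sup>2)"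
    by (rule ln_prod_scaled_tilt[OF v b]) (use b in \<open>simp_all add: y2_form rl_form obs_app form_eq algebra_simps\<close>)
  moreover have "ln (\<Prod>j\<in>{1..N}. exp ((cmod (snd (snd x) j))\<^sup>2 - (cmod (obs (snd w) (snd (snd x)) j))\<^sup>2)) =
      sq (0, 0, 0, 0, 1) w x - sq (0, gc, 0, 0, 1) w x"
    by (rule ln_prod_exp) (simp_all add: obs_app form_eq)
  ultimately show ?thesis
    unfolding genie2_def ln_mult3(4)[OF gain_pos(2) p(2) obs_dens_pos p(1) inp_dens_pos[OF rl_space[OF x]]] by simp
qed

lemma direct2_admissible: "0 < u \<Longrightarrow> 0 < v \<Longrightarrow> admissible (direct2 u v e)"
  unfolding admissible_def
proof (intro conjI ballI)
  assume u: "0 < u" and v: "0 < v"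
  fix w
  have [measurable]: "(\<lambda>x. \<Prod>j\<in>{1..N}. tilt u (fst (snd x) j) (y2 0 1 w x j - (e * obs (snd w) (fst x) j + gc * inp (fst w) (obs (snd w) (fst x)) j)))
      \<in> borel_measurable triple" for w
    by (rule prod_tilt_measurable'[where c = "(0, 0, 0, 1, 0)" and c' = "(0, gd - e * gc, - e, 1, 0)" and w = w])
      (simp_all add: relay_def out2_def obs_app form_eq algebra_simps)
  have [measurable]: "(\<lambda>x. \<Prod>j\<in>{1..N}. tilt v (fst x j) (obs (snd w) (fst x) j)) \<in> borel_measurable triple" for w :: "nat \<times> nat"
    by (rule prod_tilt_measurable'[where c = "(0, 0, 1, 0, 0)" and c' = "(0, gc, 1, 0, 0)" and w = w])
      (simp_all add: obs_app form_eq)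
  note [measurable] = gain_triple_measurable
  show m [measurable]: "direct2 u v e w \<in> borel_measurable triple" for w unfolding direct2_def by measurable
  show "0 < direct2 u v e w x" for x
    unfolding direct2_def by (intro mult_pos_pos gain_pos tilt_prod_pos u v)
  show "(\<Sum>w\<in>W. \<integral>\<^sup>+x. ennreal (direct2 u v e w x) \<partial>triple) \<le> ennreal (card W)"
    using sum_gain2_obs_le[OF v u, of e] unfolding sum_W card_W out2_unit
    by (simp add: nn_integral_triple_noise, simp add: direct2_def out2_unit)
qed

lemma ln_direct2:
  assumes u: "0 < u" and v: "0 < v"
  shows "ln (direct2 u v e w x) = ln (gain2 (snd w) (y2 0 1 w x)) +
    sq (0, 0, 0, 1, 0) w x - sq (0, gd - e * gc, - e, 1, 0) w x / u - N * ln u +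
    sq (0, 0, 1, 0, 0) w x - sq (0, gc, 1, 0, 0) w x / v - N * ln v"
proof -
  have "ln (\<Prod>j\<in>{1..N}. tilt u (fst (snd x) j) (y2 0 1 w x j - (e * obs (snd w) (fst x) j + gc * inp (fst w) (obs (snd w) (fst x)) j))) =
      sq (0, 0, 0, 1, 0) w x - sq (0, gd - e * gc, - e, 1, 0) w x / u - N * ln u"
    by (rule ln_prod_tilt[OF u]) (simp_all add: relay_def out2_def obs_app form_eq algebra_simps)
  moreover have "ln (\<Prod>j\<in>{1..N}. tilt v (fst x j) (obs (snd w) (fst x) j)) = sq (0, 0, 1, 0, 0) w x - sq (0, gc, 1, 0, 0) w x / v - N * ln v"
    by (rule ln_prod_tilt[OF v]) (simp_all add: obs_app form_eq)
  ultimately show ?thesis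
    unfolding direct2_def ln_mult3(1)[OF gain_pos(2) tilt_prod_pos[OF u] tilt_prod_pos[OF v]] by simp
qed

text \<open>An entry pairs a noise form of variance 1 with a form whose mean square is at most
  \<open>v\<close>; per message pair, the mean of the first is \<open>N\<close> and that of the
  second divided by \<open>v\<close> is on average at most \<open>N\<close>.\<close>

lemma gaps_nonneg:
  assumes P: "0 \<le> P" and la: "corr = of_real (real (card W * N) * P) * la"
    and fs: "\<And>Z D E c v. ((Z, D, E), c, v) \<in> set fs \<Longrightarrow> (cmod Z)\<^sup>2 + (cmod D)\<^sup>2 + (cmod E)\<^sup>2 = 1 \<and> 0 < v \<and> mean_sq la c \<le> v"
  shows "(\<forall>w\<in>W. integrable triple (\<lambda>x. \<Sum>((Z, D, E), c, v)\<leftarrow>fs. sq (0, 0, Z, D, E) w x - sq c w x / v)) \<and>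
    0 \<le> (\<Sum>w\<in>W. \<integral>x. (\<Sum>((Z, D, E), c, v)\<leftarrow>fs. sq (0, 0, Z, D, E) w x - sq c w x / v) \<partial>triple)"
  using fs
proof (induction fs)
  case (Cons f fs)
  obtain Z D E c v where f: "f = ((Z, D, E), c, v)" by (cases f) auto
  have c: "(cmod Z)\<^sup>2 + (cmod D)\<^sup>2 + (cmod E)\<^sup>2 = 1" "0 < v" "mean_sq la c \<le> v"
    using Cons.prems[of Z D E c v] unfolding f by (metis list.set_intros(1))+
  let ?r = "\<lambda>w x. \<Sum>((Z, D, E), c, v)\<leftarrow>fs. sq (0, 0, Z, D, E) w x - sq c w x / v"
  have IH: "\<And>w. w \<in> W \<Longrightarrow> integrable triple (?r w)" "0 \<le> (\<Sum>w\<in>W. \<integral>x. ?r w x \<partial>triple)"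
    using Cons.IH[OF Cons.prems[OF list.set_intros(2)]] by blast+
  have int: "integrable triple (\<lambda>x. sq (0, 0, Z, D, E) w x - sq c w x / v)" if "w \<in> W" for w
    using sq_integral[OF that] by auto
  have "(\<Sum>w\<in>W. \<integral>x. sq (0, 0, Z, D, E) w x - sq c w x / v \<partial>triple) =
      (\<Sum>w\<in>W. \<integral>x. sq (0, 0, Z, D, E) w x \<partial>triple) - (\<Sum>w\<in>W. \<integral>x. sq c w x \<partial>triple) / v"
    using sq_integral by (simp add: sum_subtractf sum_divide_distrib cong: sum.cong)
  moreover have "(\<Sum>w\<in>W. \<integral>x. sq (0, 0, Z, D, E) w x \<partial>triple) = real (card W * N)"
    unfolding sum_sq_integral using c(1) by simp
  moreover have "(\<Sum>w\<in>W. \<integral>x. sq c w x \<partial>triple) / v \<le> real (card W * N)"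
  proof -
    have "(\<Sum>w\<in>W. \<integral>x. sq c w x \<partial>triple) \<le> real (card W * N) * v"
      using sum_sq_le[OF P la, of c] mult_left_mono[OF c(3), of "real (card W * N)"] by simp
    then show ?thesis using c(2) by (simp add: divide_le_eq)
  qed
  ultimately have "0 \<le> (\<Sum>w\<in>W. \<integral>x. sq (0, 0, Z, D, E) w x - sq c w x / v \<partial>triple)" by linarith
  moreover have "(\<Sum>w\<in>W. \<integral>x. (sq (0, 0, Z, D, E) w x - sq c w x / v) + ?r w x \<partial>triple) =
      (\<Sum>w\<in>W. \<integral>x. sq (0, 0, Z, D, E) w x - sq c w x / v \<partial>triple) + (\<Sum>w\<in>W. \<integral>x. ?r w x \<partial>triple)"
    unfolding sum.distrib[symmetric]
    by (intro sum.cong refl Bochner_Integration.integral_add int IH(1))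
  ultimately have "0 \<le> (\<Sum>w\<in>W. \<integral>x. (sq (0, 0, Z, D, E) w x - sq c w x / v) + ?r w x \<partial>triple)"
    using IH(2) by linarith
  moreover have "(\<Sum>((Z, D, E), c, v)\<leftarrow>f # fs. sq (0, 0, Z, D, E) w x - sq c w x / v) =
      (sq (0, 0, Z, D, E) w x - sq c w x / v) + ?r w x" for w x
    unfolding f by (simp only: list.map sum_list.Cons case_prod_conv)
  ultimately show ?case
    by (simp only:) (intro conjI ballI TrueI Bochner_Integration.integrable_add int IH(1))
qed simp

text \<open>\<open>psi\<close> absorbs what cancels only in the mean. All other densities have to
  cancel pointwise for the equation on logarithms to hold.\<close>

lemma log_bound:
  fixes L :: real
  assumes P: "0 \<le> P" and la: "corr = of_real (real (card W * N) * P) * la"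
    and fs: "\<And>Z D E c v. ((Z, D, E), c, v) \<in> set fs \<Longrightarrow> (cmod Z)\<^sup>2 + (cmod D)\<^sup>2 + (cmod E)\<^sup>2 = 1 \<and> 0 < v \<and> mean_sq la c \<le> v"
    and G: "admissible G1" "admissible G2" "admissible G3"
    and g: "\<And>w. w \<in> W \<Longrightarrow> integrable triple (g w)"
    and psi: "\<And>w. w \<in> W \<Longrightarrow> integrable triple (psi w)" "\<And>w. w \<in> W \<Longrightarrow> (\<integral>x. psi w x \<partial>triple) = 0"
    and eq: "\<And>w x. w \<in> W \<Longrightarrow> x \<in> space triple \<Longrightarrow> ln (G1 w x) + ln (G2 w x) + ln (G3 w x) =
      g w x + psi w x + (\<Sum>((Z, D, E), c, v)\<leftarrow>fs. sq (0, 0, Z, D, E) w x - sq c w x / v) - N * L"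
  shows "(\<Sum>w\<in>W. \<integral>x. g w x \<partial>triple) \<le> card W * (N * L)"
proof -
  interpret prob_space triple by (rule prob_space_triple)
  let ?f = "\<lambda>w x. \<Sum>((Z, D, E), c, v)\<leftarrow>fs. sq (0, 0, Z, D, E) w x - sq c w x / v"
  have f: "\<And>w. w \<in> W \<Longrightarrow> integrable triple (?f w)" "0 \<le> (\<Sum>w\<in>W. \<integral>x. ?f w x \<partial>triple)"
    using gaps_nonneg[OF P la, of fs] fs by auto
  let ?G = "\<lambda>i::nat. if i = 0 then G1 else if i = 1 then G2 else G3"
  have adm: "admissible (?G i)" for i using G by simp
  have set3: "{0, 1, 2::nat} = {..<3}" by auto
  have "(\<Sum>w\<in>W. \<integral>x. g w x + psi w x + ?f w x - N * L \<partial>triple) \<le> 0"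
  proof (rule sum_log_le[where I = "{0, 1, 2::nat}" and G = ?G])
    show "finite W" using finite_msgs by auto
    show "(\<Sum>w\<in>W. \<integral>\<^sup>+x. ennreal (?G i w x) \<partial>triple) \<le> ennreal (card W)" for i
      using adm[of i] by (simp add: admissible_def)
    show "?G i w \<in> borel_measurable triple" if "w \<in> W" for i w
      using adm[of i] that unfolding admissible_def by blast
    show "0 < ?G i w x" if "w \<in> W" "x \<in> space triple" for i w x
      using adm[of i] that unfolding admissible_def by blast
    show "integrable triple (\<lambda>x. g w x + psi w x + ?f w x - N * L)" if "w \<in> W" for w
      using g psi f(1) that by simp
    show "g w x + psi w x + ?f w x - N * L = (\<Sum>i\<in>{0, 1, 2}. ln (?G i w x))" if "w \<in> W" "x \<in> space triple" for w x
      using eq[OF that] by simp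
  qed simp
  moreover have "(\<integral>x. g w x + psi w x + ?f w x - N * L \<partial>triple) = (\<integral>x. g w x \<partial>triple) + (\<integral>x. ?f w x \<partial>triple) - N * L"
    if "w \<in> W" for w
    using g psi f(1) that by (simp add: prob_space)
  then have "(\<Sum>w\<in>W. \<integral>x. g w x + psi w x + ?f w x - N * L \<partial>triple) =
     (\<Sum>w\<in>W. (\<integral>x. g w x \<partial>triple) + (\<integral>x. ?f w x \<partial>triple) - N * L)"
    by (rule sum.cong[OF refl])
  ultimately show ?thesis using f(2) by (simp add: sum.distrib sum_subtractf)
qed

end

section \<open>The log-density of the effective noise\<close>

context feedback_code
begin

text \<open>Minus the logarithm of the Lebesgue density of S, up to the constant
  \<open>N * ln pi\<close>: the Gaussian reference inside \<open>obs_dens\<close> has been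
  removed.\<close>

definition "excess s = (\<Sum>j\<in>{1..N}. (cmod (s j))\<^sup>2) - ln (obs_dens s)"

lemma ratio_prod_eq: "(\<Prod>j\<in>{1..N}. gauss_ratio 1 (m j) (s j)) = exp ((\<Sum>j\<in>{1..N}. (cmod (s j))\<^sup>2) - (\<Sum>j\<in>{1..N}. (cmod (s j - m j))\<^sup>2))"
  by (simp add: gauss_ratio_def exp_sum sum_subtractf[symmetric] del: sum_subtractf)

text \<open>A mixture of unit Gaussians has Lebesgue density at most \<open>pi^(-N)\<close>.\<close>

lemma excess_nonneg: "0 \<le> excess s"
proof -
  have "obs_dens s \<le> (\<Sum>w\<in>W2. exp (\<Sum>j\<in>{1..N}. (cmod (s j))\<^sup>2)) / card W2"
    unfolding obs_dens_def ratio_prod_eq by (intro divide_right_mono sum_mono) (auto intro: sum_nonneg)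
  also have "\<dots> = exp (\<Sum>j\<in>{1..N}. (cmod (s j))\<^sup>2)" using W_ne by simp
  finally have "ln (obs_dens s) \<le> ln (exp (\<Sum>j\<in>{1..N}. (cmod (s j))\<^sup>2))"
    using obs_dens_pos by (intro ln_mono) auto
  then show ?thesis by (simp add: excess_def)
qed

text \<open>The mixture is at least the component of the sent message divided by the number of
  messages.\<close>

lemma excess_le:
  assumes "w \<in> W2" shows "excess (obs w z) \<le> ln (card W2) + (\<Sum>j\<in>{1..N}. (cmod (z j))\<^sup>2)"
proof -
  let ?a = "\<Sum>j\<in>{1..N}. (cmod (obs w z j))\<^sup>2" and ?b = "\<Sum>j\<in>{1..N}. (cmod (z j))\<^sup>2"
  have "exp (?a - ?b) = (\<Prod>j\<in>{1..N}. gauss_ratio 1 (gc * enc2 C j w) (obs w z j))"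
    unfolding ratio_prod_eq by (intro arg_cong[of _ _ exp] arg_cong2[of _ _ _ _ minus] sum.cong refl) (simp add: obs_app)
  also have "\<dots> \<le> (\<Sum>w'\<in>W2. \<Prod>j\<in>{1..N}. gauss_ratio 1 (gc * enc2 C j w') (obs w z j))"
    by (rule member_le_sum[OF assms _ finite_msgs]) (rule less_imp_le[OF ratio_prod_pos])
  finally have "exp (?a - ?b) / card W2 \<le> obs_dens (obs w z)"
    unfolding obs_dens_def by (rule divide_right_mono) simp
  then have "ln (exp (?a - ?b) / card W2) \<le> ln (obs_dens (obs w z))"
    using W_ne by (intro ln_mono) (auto intro!: divide_pos_pos)
  then show ?thesis using W_ne by (simp add: excess_def ln_divide_pos)
qed

lemma excess_measurable: "excess \<in> borel_measurable (noise N)"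
proof -
  have "(\<lambda>s. \<Sum>j\<in>{1..N}. (cmod (s j))\<^sup>2) \<in> borel_measurable (noise N)"
  proof (rule borel_measurable_sum)
    fix j assume "j \<in> {1..N}"
    note [measurable] = measurable_noise_component[OF this]
    show "(\<lambda>s. (cmod (s j))\<^sup>2) \<in> borel_measurable (noise N)" by measurable
  qed
  then show ?thesis unfolding excess_def[abs_def] by measurable
qed

text \<open>The two bounds on \<open>excess\<close> make it integrable. For a given second message,
  S and its copy have the same law, so the two means agree although the samples differ.\<close>

lemma excess_triple:
  assumes w: "w \<in> W"
  shows "integrable triple (\<lambda>x. excess (obs (snd w) (fst x)))" "integrable triple (\<lambda>x. excess (obs (snd w) (snd (snd x))))"
    and "(\<integral>x. excess (obs (snd w) (fst x)) - excess (obs (snd w) (snd (snd x))) \<partial>triple) = 0"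
proof -
  interpret prob_space triple by (rule prob_space_triple)
  have w2: "snd w \<in> W2" using w by auto
  have m [measurable]: "(\<lambda>x. excess (obs (snd w) (fst x))) \<in> borel_measurable triple"
      "(\<lambda>x. excess (obs (snd w) (snd (snd x)))) \<in> borel_measurable triple"
    by (rule measurable_compose[OF triple_maps(2) excess_measurable], rule measurable_compose[OF triple_maps(3) excess_measurable])
  have sq: "(\<Sum>j\<in>{1..N}. (cmod (fst x j))\<^sup>2) = sq (0, 0, 1, 0, 0) w x"
      "(\<Sum>j\<in>{1..N}. (cmod (snd (snd x) j))\<^sup>2) = sq (0, 0, 0, 0, 1) w x" for x :: "_ \<times> (nat \<Rightarrow> complex) \<times> _"
    by (simp_all add: sq_def form_eq)
  show i1: "integrable triple (\<lambda>x. excess (obs (snd w) (fst x)))"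
  proof (rule Bochner_Integration.integrable_bound[of _ "\<lambda>x. ln (card W2) + sq (0, 0, 1, 0, 0) w x"])
    show "integrable triple (\<lambda>x. ln (card W2) + sq (0, 0, 1, 0, 0) w x)" using sq_integral[OF w] by simp
    have "norm (excess (obs (snd w) (fst x))) \<le> norm (ln (card W2) + sq (0, 0, 1, 0, 0) w x)" for x :: "_ \<times> (nat \<Rightarrow> complex) \<times> _"
      using excess_le[OF w2, of "fst x"] excess_nonneg[of "obs (snd w) (fst x)"] unfolding sq real_norm_def by arith
    then show "AE x in triple. norm (excess (obs (snd w) (fst x))) \<le> norm (ln (card W2) + sq (0, 0, 1, 0, 0) w x)" by (intro AE_I2)
  qed (rule m)
  show i2: "integrable triple (\<lambda>x. excess (obs (snd w) (snd (snd x))))"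
  proof (rule Bochner_Integration.integrable_bound[of _ "\<lambda>x. ln (card W2) + sq (0, 0, 0, 0, 1) w x"])
    show "integrable triple (\<lambda>x. ln (card W2) + sq (0, 0, 0, 0, 1) w x)" using sq_integral[OF w] by simp
    have "norm (excess (obs (snd w) (snd (snd x)))) \<le> norm (ln (card W2) + sq (0, 0, 0, 0, 1) w x)" for x :: "_ \<times> (nat \<Rightarrow> complex) \<times> _"
      using excess_le[OF w2, of "snd (snd x)"] excess_nonneg[of "obs (snd w) (snd (snd x))"] unfolding sq real_norm_def by arith
    then show "AE x in triple. norm (excess (obs (snd w) (snd (snd x)))) \<le> norm (ln (card W2) + sq (0, 0, 0, 0, 1) w x)" by (intro AE_I2)
  qed (rule m)
  have "(\<integral>x. excess (obs (snd w) (fst x)) \<partial>triple) = enn2real (\<integral>\<^sup>+x. ennreal (excess (obs (snd w) (fst x))) \<partial>triple)"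
    by (rule integral_eq_nn_integral) (auto simp: excess_nonneg)
  moreover have "(\<integral>x. excess (obs (snd w) (snd (snd x))) \<partial>triple) = enn2real (\<integral>\<^sup>+x. ennreal (excess (obs (snd w) (snd (snd x)))) \<partial>triple)"
    by (rule integral_eq_nn_integral) (auto simp: excess_nonneg)
  moreover have "(\<integral>\<^sup>+x. ennreal (excess (obs (snd w) (fst x))) \<partial>triple) = (\<integral>\<^sup>+x. ennreal (excess (obs (snd w) (snd (snd x)))) \<partial>triple)"
    by (simp add: nn_integral_triple_noise)
  ultimately show "(\<integral>x. excess (obs (snd w) (fst x)) - excess (obs (snd w) (snd (snd x))) \<partial>triple) = 0"
    using i1 i2 by simp
qed

section \<open>Error probabilities and the total gain\<close>

lemma dec_measurable:
  "dec1 C \<in> measurable (noise N) (count_space UNIV)" "dec2 C \<in> measurable (noise N) (count_space UNIV)"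
  using valid measurable_cong_sets[OF sets_noise[symmetric] refl] by (auto simp: valid_code_def)

definition "fail1 w x = (of_bool (dec1 C (y1 w x) \<noteq> fst w) :: real)"
definition "fail2 al b w x = (of_bool (dec2 C (y2 al b w x) \<noteq> snd w) :: real)"

lemma fail_measurable: "fail1 w \<in> borel_measurable triple" "fail2 al b w \<in> borel_measurable triple"
proof -
  show "fail1 w \<in> borel_measurable triple"
    using measurable_compose[OF measurable_compose[OF triple_maps(1) dec_measurable(1)], of "\<lambda>n. of_bool (n \<noteq> fst w) :: real" borel]
    by (simp add: fail1_def[abs_def])
  show "fail2 al b w \<in> borel_measurable triple"
    using measurable_compose[OF measurable_compose[OF triple_maps(5) dec_measurable(2)], of "\<lambda>n. of_bool (n \<noteq> snd w) :: real" borel]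
    by (simp add: fail2_def[abs_def])
qed

lemma fail_integrable: "integrable triple (fail1 w)" "integrable triple (fail2 al b w)"
proof -
  interpret prob_space triple by (rule prob_space_triple)
  show "integrable triple (fail1 w)"
    by (rule integrable_const_bound[of _ 1]) (auto simp: fail1_def intro: fail_measurable)
  show "integrable triple (fail2 al b w)"
    by (rule integrable_const_bound[of _ 1]) (auto simp: fail2_def intro: fail_measurable)
qed

lemma sum_fail_aux:
  assumes A: "A \<in> sets (chan_space N R1 R2)"
    and f: "\<And>w. integrable triple (f w)" "\<And>w x. 0 \<le> f w x"
    and eq: "\<And>w1 w2. (\<integral>\<^sup>+z. \<integral>\<^sup>+z'. indicator A (w1, w2, z, z') \<partial>noise N \<partial>noise N) = (\<integral>\<^sup>+x. ennreal (f (w1, w2) x) \<partial>triple)"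
  shows "(\<Sum>w\<in>W. \<integral>x. f w x \<partial>triple) = card W * measure (chan_space N R1 R2) A"
proof -
  interpret chan: prob_space "chan_space N R1 R2" by (rule prob_space_chan_space)
  have nn: "0 \<le> (\<integral>x. f w x \<partial>triple)" for w by (rule Bochner_Integration.integral_nonneg) (rule f(2))
  have "ennreal (measure (chan_space N R1 R2) A) = (\<integral>\<^sup>+x. indicator A x \<partial>chan_space N R1 R2)"
    using A by (simp add: chan.emeasure_eq_measure)
  also have "\<dots> = (\<Sum>w\<in>W. \<integral>\<^sup>+x. ennreal (f w x) \<partial>triple) / ennreal (card W1 * card W2)"
    using A by (subst nn_integral_chan) (simp_all add: eq sum_W)
  also have "(\<Sum>w\<in>W. \<integral>\<^sup>+x. ennreal (f w x) \<partial>triple) = (\<Sum>w\<in>W. ennreal (\<integral>x. f w x \<partial>triple))"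
    by (intro sum.cong refl nn_integral_eq_integral f AE_I2)
  also have "\<dots> = ennreal (\<Sum>w\<in>W. \<integral>x. f w x \<partial>triple)"
    using nn by simp
  also have "\<dots> / ennreal (card W1 * card W2) = ennreal ((\<Sum>w\<in>W. \<integral>x. f w x \<partial>triple) / card W)"
    using nn card_W(2) by (subst divide_ennreal) (auto simp: card_cartesian_product sum_nonneg simp del: of_nat_mult)
  finally have "measure (chan_space N R1 R2) A = (\<Sum>w\<in>W. \<integral>x. f w x \<partial>triple) / card W"
    using nn by (subst (asm) ennreal_inj) (auto intro!: divide_nonneg_nonneg sum_nonneg)
  then show ?thesis using card_W(2) by simp
qed

lemma space_chan: "(w1, w2, z, z') \<in> space (chan_space N R1 R2) \<longleftrightarrow> z \<in> space (noise N) \<and> z' \<in> space (noise N)"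
  by (simp add: chan_space_def space_pair_measure)

lemma sum_fail1: "(\<Sum>w\<in>W. \<integral>x. fail1 w x \<partial>triple) = card W * err1 gd gc N R1 R2 C"
  unfolding err1_def
proof (rule sum_fail_aux)
  let ?A = "{\<omega> \<in> space (chan_space N R1 R2). dec1 C (\<lambda>j\<in>{1..N}. Y1 gd gc C \<omega> j) \<noteq> fst \<omega>}"
  show "?A \<in> sets (chan_space N R1 R2)" by (rule sets_err_events(1)[OF valid])
  fix w1 w2
  have y: "(\<lambda>j\<in>{1..N}. Y1 gd gc C (w1, w2, z, z') j) = outs w1 (obs w2 z)" for z z'
    unfolding outs_def by (intro restrict_ext Y1_eq_out)
  have "(\<integral>\<^sup>+z. \<integral>\<^sup>+z'. indicator ?A (w1, w2, z, z') \<partial>noise N \<partial>noise N) =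
      (\<integral>\<^sup>+z. \<integral>\<^sup>+z'. ennreal (of_bool (dec1 C (outs w1 (obs w2 z)) \<noteq> w1)) \<partial>noise N \<partial>noise N)"
    by (intro nn_integral_cong) (simp add: indicator_def space_chan y)
  also have "\<dots> = (\<integral>\<^sup>+x. ennreal (fail1 (w1, w2) x) \<partial>triple)"
  proof -
    have m: "(\<lambda>x. ennreal (fail1 (w1, w2) x)) \<in> borel_measurable triple"
      using fail_measurable(1) by measurable
    show ?thesis unfolding nn_integral_triple_noise[OF m] by (simp add: fail1_def)
  qed
  finally show "(\<integral>\<^sup>+z. \<integral>\<^sup>+z'. indicator ?A (w1, w2, z, z') \<partial>noise N \<partial>noise N) = (\<integral>\<^sup>+x. ennreal (fail1 (w1, w2) x) \<partial>triple)" .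
qed (auto simp: fail1_def intro: fail_integrable[unfolded fail1_def])

text \<open>The noise of Y2 is built here as \<open>al * t + b * n\<close>; by rotation invariance
  it has the law of the channel noise, so the error probability is that of the code.\<close>

lemma sum_fail2:
  assumes b: "0 < b" and ab: "(cmod al)\<^sup>2 + b\<^sup>2 = 1"
  shows "(\<Sum>w\<in>W. \<integral>x. fail2 al b w x \<partial>triple) = card W * err2 gd gc N R1 R2 C"
  unfolding err2_def
proof (rule sum_fail_aux)
  interpret prob_space "noise N" by (rule prob_space_noise)
  interpret Q: pair_sigma_finite "noise N" "noise N" by standard
  let ?A = "{\<omega> \<in> space (chan_space N R1 R2). dec2 C (\<lambda>j\<in>{1..N}. Y2 gd gc C \<omega> j) \<noteq> fst (snd \<omega>)}"
  show "?A \<in> sets (chan_space N R1 R2)" by (rule sets_err_events(2)[OF valid])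
  fix w1 w2
  define F where "F z u = ennreal (of_bool (dec2 C (\<lambda>j\<in>{1..N}. (gd * enc2 C j w2 + gc * inp w1 (obs w2 z) j) + 1 * u j) \<noteq> w2))" for z u
  have F: "F z \<in> borel_measurable (noise N)" for z
    unfolding F_def using measurable_compose[OF measurable_compose[OF
        measurable_shift_noise[where m = "\<lambda>j. gd * enc2 C j w2 + gc * inp w1 (obs w2 z) j" and c = 1] dec_measurable(2)],
      of "\<lambda>n. ennreal (of_bool (n \<noteq> w2))" borel] by simp
  have y: "(\<lambda>j\<in>{1..N}. Y2 gd gc C (w1, w2, z, z') j) = (\<lambda>j\<in>{1..N}. (gd * enc2 C j w2 + gc * inp w1 (obs w2 z) j) + 1 * z' j)" for z z'
    by (intro restrict_ext) (simp add: X1_eq_inp del: X1.simps)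
  have y': "ennreal (fail2 al b (w1, w2) (z, n, t)) = F z (\<lambda>j\<in>{1..N}. al * t j + of_real b * n j)" for z n t
  proof -
    have "y2 al b (w1, w2) (z, n, t) = (\<lambda>j\<in>{1..N}. (gd * enc2 C j w2 + gc * inp w1 (obs w2 z) j) + 1 * (\<lambda>j\<in>{1..N}. al * t j + of_real b * n j) j)"
      unfolding out2_def using b by (intro restrict_ext) (simp add: relay_def algebra_simps)
    then show ?thesis by (simp only: F_def fail2_def fst_conv snd_conv)
  qed
  have "(\<integral>\<^sup>+z. \<integral>\<^sup>+z'. indicator ?A (w1, w2, z, z') \<partial>noise N \<partial>noise N) = (\<integral>\<^sup>+z. \<integral>\<^sup>+z'. F z z' \<partial>noise N \<partial>noise N)"
  proof (intro nn_integral_cong)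
    fix z z' assume "z \<in> space (noise N)" "z' \<in> space (noise N)"
    moreover have "F z z' = ennreal (of_bool (dec2 C (\<lambda>j\<in>{1..N}. Y2 gd gc C (w1, w2, z, z') j) \<noteq> w2))"
      unfolding F_def by (simp only: y)
    ultimately show "indicator ?A (w1, w2, z, z') = F z z'"
      by (simp add: indicator_def space_chan del: Y2.simps)
  qed
  also have "\<dots> = (\<integral>\<^sup>+z. \<integral>\<^sup>+t. \<integral>\<^sup>+n. F z (\<lambda>j\<in>{1..N}. al * t j + of_real b * n j) \<partial>noise N \<partial>noise N \<partial>noise N)"
    by (simp only: nn_integral_noise_rotate[OF F b ab])
  also have "\<dots> = (\<integral>\<^sup>+z. \<integral>\<^sup>+n. \<integral>\<^sup>+t. F z (\<lambda>j\<in>{1..N}. al * t j + of_real b * n j) \<partial>noise N \<partial>noise N \<partial>noise N)"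
  proof (rule nn_integral_cong)
    fix z assume z: "z \<in> space (noise N)"
    have "(\<lambda>x. ennreal (fail2 al b (w1, w2) x)) \<in> borel_measurable triple"
      using fail_measurable(2) by measurable
    then have "(\<lambda>y. ennreal (fail2 al b (w1, w2) (z, y))) \<in> borel_measurable (noise N \<Otimes>\<^sub>M noise N)"
      by (rule measurable_Pair2[OF _ z])
    then have "(\<lambda>(n, t). F z (\<lambda>j\<in>{1..N}. al * t j + of_real b * n j)) \<in> borel_measurable (noise N \<Otimes>\<^sub>M noise N)"
      by (simp add: case_prod_beta' flip: y')
    then show "(\<integral>\<^sup>+t. \<integral>\<^sup>+n. F z (\<lambda>j\<in>{1..N}. al * t j + of_real b * n j) \<partial>noise N \<partial>noise N) =
        (\<integral>\<^sup>+n. \<integral>\<^sup>+t. F z (\<lambda>j\<in>{1..N}. al * t j + of_real b * n j) \<partial>noise N \<partial>noise N)"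
      by (rule Q.Fubini')
  qed
  also have "\<dots> = (\<integral>\<^sup>+x. ennreal (fail2 al b (w1, w2) x) \<partial>triple)"
  proof -
    have m: "(\<lambda>x. ennreal (fail2 al b (w1, w2) x)) \<in> borel_measurable triple"
      using fail_measurable(2) by measurable
    show ?thesis unfolding nn_integral_triple_noise[OF m] by (simp only: y')
  qed
  finally show "(\<integral>\<^sup>+z. \<integral>\<^sup>+z'. indicator ?A (w1, w2, z, z') \<partial>noise N \<partial>noise N) = (\<integral>\<^sup>+x. ennreal (fail2 al b (w1, w2) x) \<partial>triple)" .
qed (auto simp: fail2_def intro: fail_integrable[unfolded fail2_def])

definition "log_gain al b w x = 2 * ln (gain1 (fst w) (y1 w x)) + ln (gain2 (snd w) (y2 al b w x))"

text \<open>The mean of \<open>log_gain\<close>, in nats over the whole block: with small errors it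
  is at least about \<open>N * (2 * R1 + R2) * ln 2\<close>. The three gains cost
  \<open>3 * ln 2\<close>.\<close>

definition "rate = 2 * (ln (card W1) * (1 - err1 gd gc N R1 R2 C)) + ln (card W2) * (1 - err2 gd gc N R1 R2 C) - 3 * ln 2"

lemma log_gain_eq:
  "log_gain al b w x = 2 * ln (card W1) + ln (card W2) - 3 * ln 2 - 2 * ln (card W1) * fail1 w x - ln (card W2) * fail2 al b w x"
  using W_ne by (auto simp: log_gain_def gain1_def gain2_def fail1_def fail2_def ln_div)

lemma log_gain_integrable: "integrable triple (log_gain al b w)"
proof -
  interpret prob_space triple by (rule prob_space_triple)
  show ?thesis unfolding log_gain_eq[abs_def] using fail_integrable by simp
qed

lemma sum_log_gain:
  assumes b: "0 < b" and ab: "(cmod al)\<^sup>2 + b\<^sup>2 = 1"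
  shows "(\<Sum>w\<in>W. \<integral>x. log_gain al b w x \<partial>triple) = card W * rate"
proof -
  interpret prob_space triple by (rule prob_space_triple)
  have "(\<integral>x. log_gain al b w x \<partial>triple) = 2 * ln (card W1) + ln (card W2) - 3 * ln 2 -
      2 * ln (card W1) * (\<integral>x. fail1 w x \<partial>triple) - ln (card W2) * (\<integral>x. fail2 al b w x \<partial>triple)" for w
    unfolding log_gain_eq using fail_integrable by (simp add: prob_space)
  then have "(\<Sum>w\<in>W. \<integral>x. log_gain al b w x \<partial>triple) = card W * (2 * ln (card W1) + ln (card W2) - 3 * ln 2) -
      2 * ln (card W1) * (\<Sum>w\<in>W. \<integral>x. fail1 w x \<partial>triple) - ln (card W2) * (\<Sum>w\<in>W. \<integral>x. fail2 al b w x \<partial>triple)"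
    by (simp add: sum_subtractf sum_distrib_left)
  then show ?thesis
    unfolding sum_fail1 sum_fail2[OF b ab] rate_def by (simp add: algebra_simps)
qed

end

section \<open>Linear estimation and the three rate bounds\<close>

context feedback_code
begin

text \<open>\<open>X1 - la * X2\<close> is the error of the best linear estimate of X1 from X2 when
  both have power \<open>P\<close>.\<close>

lemma mean_sq_residual:
  "mean_sq la (A, - (la * A), Z, D, E) = (1 - (cmod la)\<^sup>2) * P * (cmod A)\<^sup>2 + ((cmod Z)\<^sup>2 + (cmod D)\<^sup>2 + (cmod E)\<^sup>2)"
proof -
  have "2 * Re (A * cnj (- (la * A)) * la) = - (2 * ((cmod la)\<^sup>2 * (cmod A)\<^sup>2))"
    unfolding cmod_power2 by (simp add: power2_eq_square algebra_simps)
  then show ?thesis unfolding mean_sq_def by (simp add: norm_mult power_mult_distrib algebra_simps)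
qed

lemma mean_sq_residual':
  "B = - (la * A) \<Longrightarrow> mean_sq la (A, B, Z, D, E) = (1 - (cmod la)\<^sup>2) * P * (cmod A)\<^sup>2 + ((cmod Z)\<^sup>2 + (cmod D)\<^sup>2 + (cmod E)\<^sup>2)"
  using mean_sq_residual by simp

lemma Re_mult_le: "cmod la \<le> r \<Longrightarrow> Re (A * cnj B * la) \<le> cmod A * cmod B * r"
  by (rule order_trans[OF complex_Re_le_cmod]) (simp add: norm_mult mult_left_mono)

text \<open>The inputs contribute at least \<open>P * (cmod A - cmod B)^2\<close>.\<close>

lemma noise_le_mean_sq:
  assumes "0 \<le> P" "cmod la \<le> 1"
  shows "(cmod Z)\<^sup>2 + (cmod D)\<^sup>2 + (cmod E)\<^sup>2 \<le> mean_sq la (A, B, Z, D, E)"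
proof -
  have "- Re (A * cnj B * la) \<le> cmod A * cmod B * 1"
    using Re_mult_le[of "- la" 1 A B] assms by simp
  moreover have "0 \<le> (cmod A)\<^sup>2 + (cmod B)\<^sup>2 - 2 * cmod A * cmod B"
    using zero_le_power2[of "cmod A - cmod B"] by (simp add: power2_diff)
  ultimately have "0 \<le> (cmod A)\<^sup>2 + (cmod B)\<^sup>2 + 2 * Re (A * cnj B * la)"
    by linarith
  with assms(1) show ?thesis unfolding mean_sq_def by simp
qed

end

text \<open>The coefficient \<open>c\<close> minimizes \<open>T * (cmod (g - c * k))\<^sup>2 + (cmod c)\<^sup>2\<close>.\<close>

lemma least_squares:
  fixes g k :: complex and T :: real
  assumes T: "0 \<le> T"
  defines "c \<equiv> g * cnj k * of_real (T / (1 + T * (cmod k)\<^sup>2))"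
  shows "T * (cmod (g - c * k))\<^sup>2 + (cmod c)\<^sup>2 = T * (cmod g)\<^sup>2 / (1 + T * (cmod k)\<^sup>2)"
proof -
  let ?D = "1 + T * (cmod k)\<^sup>2"
  have D: "0 < ?D" using T by (intro add_pos_nonneg) auto
  have kk: "k * cnj k = of_real ((cmod k)\<^sup>2)" by (rule complex_norm_square[symmetric])
  have "g - c * k = g * (1 - of_real (T / ?D) * (k * cnj k))"
    by (simp add: c_def algebra_simps)
  also have "\<dots> = g * of_real (1 - T / ?D * (cmod k)\<^sup>2)" unfolding kk by simp
  also have "1 - T / ?D * (cmod k)\<^sup>2 = 1 / ?D" using D by (simp add: field_simps)
  finally have "cmod (g - c * k) = cmod g * \<bar>1 / ?D\<bar>" by (simp only: norm_mult norm_of_real)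
  then have "cmod (g - c * k) = cmod g / ?D" using D by simp
  moreover have "cmod c = cmod g * cmod k * (T / ?D)"
    unfolding c_def norm_mult norm_of_real complex_mod_cnj using D T by simp
  ultimately have "T * (cmod (g - c * k))\<^sup>2 + (cmod c)\<^sup>2 = T * (cmod g)\<^sup>2 * ?D / ?D\<^sup>2"
    by (simp add: power_mult_distrib power_divide add_divide_distrib[symmetric] power2_eq_square algebra_simps)
  then show ?thesis using D by (simp add: power2_eq_square)
qed

context feedback_code
begin

context
  fixes la :: complex and s i r :: real
  assumes P: "0 \<le> P" and la: "corr = of_real (real (card W * N) * P) * la" "cmod la \<le> 1"
  defines "s \<equiv> cmod gd * sqrt P" and "i \<equiv> cmod gc * sqrt P" and "r \<equiv> cmod la"
begin

lemma sq_gains: "s\<^sup>2 = (cmod gd)\<^sup>2 * P" "i\<^sup>2 = (cmod gc)\<^sup>2 * P" "s * i = cmod gd * cmod gc * P"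
  "0 \<le> s" "0 \<le> i" "0 \<le> 1 - r\<^sup>2" "0 \<le> r" "r \<le> 1"
  using P la(2) by (auto simp: s_def i_def r_def power_mult_distrib power_le_one)

lemma mean_sq_output:
  "mean_sq la (gd, gc, 1, 0, 0) \<le> 1 + s\<^sup>2 + i\<^sup>2 + 2 * r * (s * i)"
  "mean_sq la (gc, gd, 0, 1, 0) \<le> 1 + s\<^sup>2 + i\<^sup>2 + 2 * r * (s * i)"
  using mult_left_mono[OF Re_mult_le[of la r gd gc] P] mult_left_mono[OF Re_mult_le[of la r gc gd] P]
  by (simp_all only: mean_sq_def sq_gains(1-3) prod.case r_def order_refl) (simp_all add: algebra_simps)

lemma rate_bound:
  fixes L :: real
  assumes "\<And>Z D E c v. ((Z, D, E), c, v) \<in> set fs \<Longrightarrow> (cmod Z)\<^sup>2 + (cmod D)\<^sup>2 + (cmod E)\<^sup>2 = 1 \<and> 0 < v \<and> mean_sq la c \<le> v"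
    and "admissible G1" "admissible G2" "admissible G3"
    and "\<And>w. w \<in> W \<Longrightarrow> integrable triple (psi w)" "\<And>w. w \<in> W \<Longrightarrow> (\<integral>x. psi w x \<partial>triple) = 0"
    and "\<And>w x. w \<in> W \<Longrightarrow> x \<in> space triple \<Longrightarrow> ln (G1 w x) + ln (G2 w x) + ln (G3 w x) =
      log_gain al b w x + psi w x + (\<Sum>((Z, D, E), c, v)\<leftarrow>fs. sq (0, 0, Z, D, E) w x - sq c w x / v) - N * L"
    and b: "0 < b" "(cmod al)\<^sup>2 + b\<^sup>2 = 1"
  shows "rate \<le> N * L"
proof -
  have "card W * rate \<le> card W * (N * L)"
    using log_bound[OF P la(1) assms(1-4) log_gain_integrable assms(5-7)] sum_log_gain[OF b] by simp
  then show ?thesis using card_W(2) by simp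
qed

lemma one_plus_pos: "0 \<le> x \<Longrightarrow> 0 < 1 + (x::real)"
  by simp

lemma rate_le_direct: "0 < direct_bound i s \<and> rate \<le> N * ln (direct_bound i s)"
proof -
  \<comment> \<open>\<open>e\<close> is the best coefficient for estimating
    \<open>gd * X2 + Z2\<close> from \<open>gc * X2 + Z1\<close>, and \<open>u\<close> bounds the
    mean square of the error. The product \<open>u * v\<close> is
    \<open>1 + s^2 + i^2\<close>.\<close>
  define v u e where "v = 1 + i\<^sup>2" and "u = 1 + s\<^sup>2 / (1 + i\<^sup>2)" and "e = gd * cnj gc * of_real (P / (1 + P * (cmod gc)\<^sup>2))"
  have pos: "0 < 1 + s\<^sup>2" "0 < v" "0 < u"
    by (simp_all add: v_def u_def one_plus_pos add_pos_nonneg)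
  have ln_bound: "ln (direct_bound i s) = 2 * ln (1 + s\<^sup>2) + ln u + ln v"
  proof -
    have "direct_bound i s = (1 + s\<^sup>2)\<^sup>2 * (u * v)"
      using pos(2) by (simp add: direct_bound_def u_def v_def field_simps)
    also have "ln \<dots> = ln ((1 + s\<^sup>2)\<^sup>2) + ln (u * v)"
      using pos by (intro ln_mult_pos) auto
    finally show ?thesis using pos by (simp add: ln_realpow ln_mult_pos)
  qed
  have "0 < direct_bound i s" unfolding direct_bound_def using pos by (intro mult_pos_pos add_pos_nonneg) auto
  moreover have "rate \<le> N * ln (direct_bound i s)"
    unfolding ln_bound
  proof (rule rate_bound[where al = 0 and b = 1 and psi = "\<lambda>_ _. 0" and ?G1.0 = "direct1 (1 + s\<^sup>2) gc" and ?G2.0 = "direct1 (1 + s\<^sup>2) gc"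
        and ?G3.0 = "direct2 u v e" and
      fs = "[((1, 0, 0), (gd, 0, 1, 0, 0), 1 + s\<^sup>2), ((1, 0, 0), (gd, 0, 1, 0, 0), 1 + s\<^sup>2),
             ((0, 1, 0), (0, gd - e * gc, - e, 1, 0), u), ((1, 0, 0), (0, gc, 1, 0, 0), v)]"])
    have "P * (cmod (gd - e * gc))\<^sup>2 + (cmod e)\<^sup>2 = s\<^sup>2 / (1 + i\<^sup>2)"
      using least_squares[OF P, of gd gc] by (simp add: e_def sq_gains mult.commute)
    then have m: "mean_sq la (gd, 0, 1, 0, 0) = 1 + s\<^sup>2" "mean_sq la (0, gd - e * gc, - e, 1, 0) = u" "mean_sq la (0, gc, 1, 0, 0) = v"
      by (simp_all add: mean_sq_def sq_gains u_def v_def)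
    show "(cmod Z)\<^sup>2 + (cmod D)\<^sup>2 + (cmod E)\<^sup>2 = 1 \<and> 0 < w \<and> mean_sq la c \<le> w"
      if "((Z, D, E), c, w) \<in> set [((1, 0, 0), (gd, 0, 1, 0, 0), 1 + s\<^sup>2), ((1, 0, 0), (gd, 0, 1, 0, 0), 1 + s\<^sup>2),
             ((0, 1, 0), (0, gd - e * gc, - e, 1, 0), u), ((1, 0, 0), (0, gc, 1, 0, 0), v)]" for Z D E c w
      using that pos m by auto
    show "ln (direct1 (1 + s\<^sup>2) gc w x) + ln (direct1 (1 + s\<^sup>2) gc w x) + ln (direct2 u v e w x) =
      log_gain 0 1 w x + 0 + (\<Sum>((Z, D, E), c, v)\<leftarrow>[((1, 0, 0), (gd, 0, 1, 0, 0), 1 + s\<^sup>2), ((1, 0, 0), (gd, 0, 1, 0, 0), 1 + s\<^sup>2),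
             ((0, 1, 0), (0, gd - e * gc, - e, 1, 0), u), ((1, 0, 0), (0, gc, 1, 0, 0), v)]. sq (0, 0, Z, D, E) w x - sq c w x / v) -
        N * (2 * ln (1 + s\<^sup>2) + ln u + ln v)" for w x
      unfolding ln_direct1[OF pos(1)] ln_direct2[OF pos(3,2)] log_gain_def by (simp add: algebra_simps)
  qed (use direct1_admissible[OF pos(1)] direct2_admissible[OF pos(3,2)] in auto)
  ultimately show ?thesis by simp
qed

text \<open>Estimation of Y1 from X2 and the scaled genie signal: the part of X1 explained by X2 is
  removed with \<open>la\<close>, the rest has power \<open>T\<close>, and
  \<open>least_squares\<close> supplies the coefficient \<open>c\<close> for it.\<close>

lemma relay_coefficient:
  fixes k :: complex
  defines "T \<equiv> (1 - r\<^sup>2) * P"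
  defines "c \<equiv> gd * cnj k * of_real (T / (1 + T * (cmod k)\<^sup>2))"
  shows "mean_sq la (gd - c * k, gc - (gc + la * (gd - c * k)), 1, - c, 0) = 1 + T * (cmod gd)\<^sup>2 / (1 + T * (cmod k)\<^sup>2)"
proof -
  have T: "0 \<le> T" unfolding T_def using sq_gains P by simp
  show ?thesis
    using least_squares[OF T, of gd k, folded c_def]
    by (subst mean_sq_residual') (simp_all add: T_def r_def)
qed

lemma rate_le_sum: "0 < sum_bound i s r \<and> rate \<le> N * ln (sum_bound i s r)"
proof -
  define T c where "T = (1 - r\<^sup>2) * P" and "c = gd * cnj gc * of_real (T / (1 + T * (cmod gc)\<^sup>2))"
  define v1 v3 v4 where "v1 = 1 + s\<^sup>2 + i\<^sup>2 + 2 * r * (s * i)"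
    and "v3 = 1 + (1 - r\<^sup>2) * s\<^sup>2 / (1 + (1 - r\<^sup>2) * i\<^sup>2)" and "v4 = 1 + (1 - r\<^sup>2) * s\<^sup>2"
  let ?d = "gc + la * (gd - c * gc)"
  have pos: "0 < v1" "0 < v3" "0 < v4"
    unfolding v1_def v3_def v4_def using sq_gains(4-8)
    by (auto intro!: add_pos_nonneg divide_nonneg_nonneg add_nonneg_nonneg mult_nonneg_nonneg)
  have ln_bound: "ln (sum_bound i s r) = ln v4 + ln v3 + ln v1"
    using pos by (simp add: sum_bound_def ln_mult_pos flip: v1_def v3_def v4_def)
  have "0 < sum_bound i s r" using pos by (simp add: sum_bound_def flip: v1_def v3_def v4_def)
  moreover have "rate \<le> N * ln (sum_bound i s r)"
    unfolding ln_bound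
  \<comment> \<open>With \<open>al = 0\<close>, \<open>b = 1\<close> the output Y2 is Q shifted by
    \<open>gd * X2\<close>. The density of Q given W2 occurs in \<open>relay1\<close> and inversely
    in \<open>relay2\<close> and cancels pointwise, hence \<open>psi = 0\<close>.\<close>
  proof (rule rate_bound[where al = 0 and b = 1 and psi = "\<lambda>_ _. 0" and ?G1.0 = "direct1 v4 (gc + la * gd)" and ?G2.0 = "relay1 v3 gc c ?d"
        and ?G3.0 = "relay2 v1" and
      fs = "[((1, 0, 0), (gd, gc - (gc + la * gd), 1, 0, 0), v4), ((1, 0, 0), (gd - c * gc, gc - ?d, 1, - c, 0), v3),
             ((0, 1, 0), (gc, gd, 0, 1, 0), v1)]"])
    have m: "mean_sq la (gd, gc - (gc + la * gd), 1, 0, 0) = v4"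
      by (subst mean_sq_residual') (simp_all add: v4_def sq_gains r_def)
    have m3: "mean_sq la (gd - c * gc, gc - ?d, 1, - c, 0) = v3"
      using relay_coefficient[of gc, folded T_def, folded c_def] by (simp add: v3_def T_def sq_gains mult_ac)
    have m1: "mean_sq la (gc, gd, 0, 1, 0) \<le> v1" unfolding v1_def by (rule mean_sq_output)
    show "(cmod Z)\<^sup>2 + (cmod D)\<^sup>2 + (cmod E)\<^sup>2 = 1 \<and> 0 < w \<and> mean_sq la q \<le> w"
      if "((Z, D, E), q, w) \<in> set [((1, 0, 0), (gd, gc - (gc + la * gd), 1, 0, 0), v4), ((1, 0, 0), (gd - c * gc, gc - ?d, 1, - c, 0), v3),
             ((0, 1, 0), (gc, gd, 0, 1, 0), v1)]" for Z D E q w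
    proof -
      have "(Z, D, E) = (1, 0, 0) \<or> (Z, D, E) = (0, 1, 0)" "0 < w \<and> mean_sq la q \<le> w"
        using that pos m m3 m1 by (auto simp del: diff_add_eq_diff_diff_swap)
      then show ?thesis by auto
    qed
    show "ln (direct1 v4 (gc + la * gd) w x) + ln (relay1 v3 gc c ?d w x) + ln (relay2 v1 w x) =
      log_gain 0 1 w x + 0 + (\<Sum>((Z, D, E), c, v)\<leftarrow>[((1, 0, 0), (gd, gc - (gc + la * gd), 1, 0, 0), v4), ((1, 0, 0), (gd - c * gc, gc - ?d, 1, - c, 0), v3),
             ((0, 1, 0), (gc, gd, 0, 1, 0), v1)]. sq (0, 0, Z, D, E) w x - sq c w x / v) - N * (ln v4 + ln v3 + ln v1)"
      if x: "x \<in> space triple" for w x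
      unfolding ln_direct1[OF pos(3)] ln_relay1[OF pos(2) x] ln_relay2[OF pos(1) x] log_gain_def by (simp add: distrib_left)
  qed (use direct1_admissible[OF pos(3)] relay1_admissible[OF pos(2)] relay2_admissible[OF pos(1)] in auto)
  ultimately show ?thesis by simp
qed

text \<open>\<open>c0\<close> is the correlation of Y2 with St, so \<open>e\<close> is the best
  linear coefficient. The phase of \<open>al\<close> is matched to that of
  \<open>gd * cnj gc\<close>, so the error depends on \<open>la\<close> only through
  \<open>r\<close> and \<open>x = Re (u * cnj la)\<close>. As \<open>al' * i <= s\<close>, it does
  not decrease with \<open>x\<close>, and the worst case is \<open>x = r\<close>.\<close>

lemma estimation_error:
  fixes al :: complex and b al' :: real and u :: complex
  assumes u: "gd * cnj gc = of_real (cmod gd * cmod gc) * u" "cmod u = 1" and al: "al = of_real al' * u" "0 \<le> al'" "al' * i \<le> s"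
    and b: "al'\<^sup>2 + b\<^sup>2 = 1"
  defines "c0 \<equiv> of_real P * (gd * cnj gc) + of_real (i\<^sup>2) * la + al"
  defines "e \<equiv> c0 / of_real (1 + i\<^sup>2)"
  shows "mean_sq la (gc, gd - e * gc, 0, of_real b, al - e) \<le>
    ((1 + s\<^sup>2 + i\<^sup>2 + 2 * r * (s * i)) * (1 + i\<^sup>2) - (s * i + r * i\<^sup>2 + al')\<^sup>2) / (1 + i\<^sup>2)"
proof -
  define x where "x = Re (u * cnj la)"
  have D: "0 < 1 + i\<^sup>2" by (simp add: add_pos_nonneg)
  have "mean_sq la (gc, gd - e * gc, 0, of_real b, al - e) =
      P * ((cmod gc)\<^sup>2 + (cmod gd)\<^sup>2 + 2 * Re (gc * cnj gd * la)) + b\<^sup>2 + (cmod al)\<^sup>2 +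
      ((cmod e)\<^sup>2 * (1 + P * (cmod gc)\<^sup>2) - 2 * Re (cnj e * (of_real P * (gd * cnj gc) + of_real (P * (cmod gc)\<^sup>2) * la + al)))"
    unfolding mean_sq_def prod.case cmod_power2 by (simp add: power2_eq_square algebra_simps)
  also have "\<dots> = P * ((cmod gc)\<^sup>2 + (cmod gd)\<^sup>2 + 2 * Re (gc * cnj gd * la)) + b\<^sup>2 + (cmod al)\<^sup>2 +
      ((cmod e)\<^sup>2 * (1 + i\<^sup>2) - 2 * Re (cnj e * c0))"
    unfolding c0_def sq_gains by (simp only: mult.commute[of P])
  also have "(cmod e)\<^sup>2 * (1 + i\<^sup>2) - 2 * Re (cnj e * c0) = - ((cmod c0)\<^sup>2 / (1 + i\<^sup>2))"
  proof -
    have "cnj e * c0 = of_real ((cmod c0)\<^sup>2 / (1 + i\<^sup>2))"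
      unfolding e_def of_real_divide complex_norm_square by (simp add: mult.commute)
    then have "Re (cnj e * c0) = (cmod c0)\<^sup>2 / (1 + i\<^sup>2)" by (simp only: Re_complex_of_real)
    moreover have "(cmod e)\<^sup>2 * (1 + i\<^sup>2) = (cmod c0)\<^sup>2 / (1 + i\<^sup>2)"
    proof -
      have "cmod e = cmod c0 / (1 + i\<^sup>2)" using D by (simp add: e_def norm_divide del: of_real_add)
      then show ?thesis using D by (simp add: power2_eq_square)
    qed
    ultimately show ?thesis by simp
  qed
  also have "P * ((cmod gc)\<^sup>2 + (cmod gd)\<^sup>2 + 2 * Re (gc * cnj gd * la)) = s\<^sup>2 + i\<^sup>2 + 2 * ((s * i) * x)"
  proof -
    have "Re (gc * cnj gd * la) = Re (gd * cnj gc * cnj la)" by (simp add: algebra_simps)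
    also have "\<dots> = cmod gd * cmod gc * x" unfolding u(1) x_def by (simp add: algebra_simps)
    finally show ?thesis by (simp only: sq_gains(1-3)) (simp add: algebra_simps)
  qed
  also have "(cmod al)\<^sup>2 = al'\<^sup>2" using al u by (simp add: norm_mult)
  also have "(cmod c0)\<^sup>2 = (s * i + al')\<^sup>2 + (i\<^sup>2)\<^sup>2 * r\<^sup>2 + 2 * (s * i + al') * i\<^sup>2 * x"
  proof -
    have c0: "c0 = of_real (s * i + al') * u + of_real (i\<^sup>2) * la"
      unfolding c0_def u(1) al(1) sq_gains(3) by (simp add: algebra_simps)
    have "(cmod (of_real p * u + of_real q * la))\<^sup>2 = p\<^sup>2 * (cmod u)\<^sup>2 + q\<^sup>2 * (cmod la)\<^sup>2 + 2 * p * q * x" for p q :: real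
      unfolding cmod_power2 x_def by (simp add: power2_eq_square algebra_simps)
    from this[of "s * i + al'" "i\<^sup>2"] show ?thesis unfolding c0 r_def using u(2) by simp
  qed
  finally have eq: "mean_sq la (gc, gd - e * gc, 0, of_real b, al - e) =
    (((1 + s\<^sup>2 + i\<^sup>2) + 2 * ((s * i) * x)) * (1 + i\<^sup>2) - ((s * i + al')\<^sup>2 + (i\<^sup>2)\<^sup>2 * r\<^sup>2 + 2 * (s * i + al') * i\<^sup>2 * x)) / (1 + i\<^sup>2)"
    using D b by (simp add: diff_divide_distrib)
  have "x \<le> r"
    unfolding x_def r_def using complex_Re_le_cmod[of "u * cnj la"] u(2) by (simp only: norm_mult complex_mod_cnj mult_1)
  \<comment> \<open>This product is the difference of the two numerators.\<close>
  then have "0 \<le> 2 * (r - x) * i * (s - al' * i)"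
    using al(3) sq_gains(5) by (intro mult_nonneg_nonneg) auto
  then have "((1 + s\<^sup>2 + i\<^sup>2) + 2 * ((s * i) * x)) * (1 + i\<^sup>2) - ((s * i + al')\<^sup>2 + (i\<^sup>2)\<^sup>2 * r\<^sup>2 + 2 * (s * i + al') * i\<^sup>2 * x) \<le>
    (1 + s\<^sup>2 + i\<^sup>2 + 2 * r * (s * i)) * (1 + i\<^sup>2) - (s * i + r * i\<^sup>2 + al')\<^sup>2"
    by (simp add: power2_eq_square algebra_simps)
  then show ?thesis unfolding eq using D by (simp add: divide_right_mono)
qed

lemma rate_le_genie:
  assumes al': "0 \<le> al'" "al' < 1" "al' * i \<le> s"
  shows "0 < genie_bound i s al' r \<and> rate \<le> N * ln (genie_bound i s al' r)"
proof -
  obtain u where u: "gd * cnj gc = of_real (cmod gd * cmod gc) * u" "cmod u = 1"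
  proof (cases "gd * cnj gc = 0")
    case True then show ?thesis by (intro that[of 1]) auto
  next
    case False
    then show ?thesis
      by (intro that[of "gd * cnj gc / of_real (cmod gd * cmod gc)"]) (simp_all add: norm_divide norm_mult)
  qed
  define b al k where "b = sqrt (1 - al'\<^sup>2)" and "al = of_real al' * u" and "k = gc / of_real b"
  have al'2: "al'\<^sup>2 < 1" using al' by (simp add: power_less_one_iff abs_less_iff power2_less_1_iff abs_square_less_1)
  have b: "0 < b" "b\<^sup>2 = 1 - al'\<^sup>2" "(cmod al)\<^sup>2 + b\<^sup>2 = 1" "al'\<^sup>2 + b\<^sup>2 = 1"
    using al'2 u(2) by (simp_all add: b_def al_def norm_mult)
  define T c where "T = (1 - r\<^sup>2) * P" and "c = gd * cnj k * of_real (T / (1 + T * (cmod k)\<^sup>2))"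
  let ?d = "gc + la * (gd - c * k)"
  define e where "e = (of_real P * (gd * cnj gc) + of_real (i\<^sup>2) * la + al) / of_real (1 + i\<^sup>2)"
  define v1 v3 v2 where "v1 = 1 + s\<^sup>2 + i\<^sup>2 + 2 * r * (s * i)"
    and "v3 = 1 + (1 - r\<^sup>2) * (1 - al'\<^sup>2) * s\<^sup>2 / ((1 - al'\<^sup>2) + (1 - r\<^sup>2) * i\<^sup>2)"
    and "v2 = (v1 * (1 + i\<^sup>2) - (s * i + r * i\<^sup>2 + al')\<^sup>2) / (1 + i\<^sup>2)"
  have m1: "mean_sq la (gd, gc, 1, 0, 0) \<le> v1" unfolding v1_def by (rule mean_sq_output)
  have m2: "mean_sq la (gc, gd - e * gc, 0, of_real b, al - e) \<le> v2"
    unfolding v2_def v1_def e_def by (rule estimation_error[OF u al_def al'(1,3) b(4)])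
  have m3: "mean_sq la (gd - c * k, gc - ?d, 1, - c, 0) = v3"
  proof -
    have kb: "(cmod k)\<^sup>2 * b\<^sup>2 = (cmod gc)\<^sup>2" using b(1) by (simp add: k_def norm_divide power_divide)
    have "T * (cmod gd)\<^sup>2 / (1 + T * (cmod k)\<^sup>2) = (T * (cmod gd)\<^sup>2) * b\<^sup>2 / ((1 + T * (cmod k)\<^sup>2) * b\<^sup>2)"
      using b(1) by simp
    also have "(1 + T * (cmod k)\<^sup>2) * b\<^sup>2 = b\<^sup>2 + T * (cmod gc)\<^sup>2" unfolding kb[symmetric] by (simp add: algebra_simps)
    finally show ?thesis
      using relay_coefficient[of k, folded T_def, folded c_def] by (simp add: v3_def T_def sq_gains b(2) mult_ac)
  qed
  have pos: "0 < v1" "0 < v3" "0 < v2"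
  proof -
    show "0 < v1" "0 < v3"
      unfolding v1_def v3_def using sq_gains(4-8) al'2
      by (auto intro!: add_pos_nonneg divide_nonneg_nonneg add_nonneg_nonneg mult_nonneg_nonneg)
    \<comment> \<open>The noise of variance \<open>b^2\<close> inside Y2 is never estimated away, so
      the mean square stays positive.\<close>
    have "0 < b\<^sup>2" using b(1) by simp
    also have "\<dots> \<le> (cmod 0)\<^sup>2 + (cmod (of_real b))\<^sup>2 + (cmod (al - e))\<^sup>2" by simp
    also have "\<dots> \<le> mean_sq la (gc, gd - e * gc, 0, of_real b, al - e)" by (rule noise_le_mean_sq[OF P la(2)])
    finally show "0 < v2" using m2 by linarith
  qed
  have bound: "genie_bound i s al' r = v1 * v3 * v2 / b\<^sup>2"
    by (simp add: genie_bound_def v1_def v2_def v3_def b(2))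
  have ln_bound: "ln (genie_bound i s al' r) = ln v1 + ln v3 + ln v2 - ln (b\<^sup>2)"
  proof -
    from bound show ?thesis using pos b(1) by (simp add: ln_divide_pos ln_mult_pos)
  qed
  \<comment> \<open>The log-densities of S in \<open>genie1\<close> and of its copy in
    \<open>genie2\<close> are taken at different points, so they cancel in the mean only. The
    density of Q still cancels pointwise.\<close>
  define psi where "psi w x = excess (obs (snd w) (fst x)) - excess (obs (snd w) (snd (snd x)))"
    for w :: "nat \<times> nat" and x :: "(nat \<Rightarrow> complex) \<times> (nat \<Rightarrow> complex) \<times> (nat \<Rightarrow> complex)"
  have psi_eq: "psi w x = sq (0, gc, 1, 0, 0) w x - ln (obs_dens (obs (snd w) (fst x))) -
      sq (0, gc, 0, 0, 1) w x + ln (obs_dens (obs (snd w) (snd (snd x))))" for w x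
    by (simp add: psi_def excess_def sq_def form_eq obs_app)
  have "0 < genie_bound i s al' r" unfolding bound using pos b(1) by simp
  moreover have "rate \<le> N * ln (genie_bound i s al' r)"
    unfolding ln_bound
  proof (rule rate_bound[where al = al and b = b and psi = psi and ?G1.0 = "genie1 v1" and ?G2.0 = "relay1 v3 k c ?d"
        and ?G3.0 = "genie2 v2 al b e" and
      fs = "[((1, 0, 0), (gd, gc, 1, 0, 0), v1), ((0, 1, 0), (gd - c * k, gc - ?d, 1, - c, 0), v3),
             ((0, 0, 1), (gc, gd - e * gc, 0, of_real b, al - e), v2)]"])
    show "(cmod Z)\<^sup>2 + (cmod D)\<^sup>2 + (cmod E)\<^sup>2 = 1 \<and> 0 < w \<and> mean_sq la q \<le> w"
      if "((Z, D, E), q, w) \<in> set [((1, 0, 0), (gd, gc, 1, 0, 0), v1), ((0, 1, 0), (gd - c * k, gc - ?d, 1, - c, 0), v3),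
             ((0, 0, 1), (gc, gd - e * gc, 0, of_real b, al - e), v2)]" for Z D E q w
    proof -
      have "(Z, D, E) = (1, 0, 0) \<or> (Z, D, E) = (0, 1, 0) \<or> (Z, D, E) = (0, 0, 1)" "0 < w \<and> mean_sq la q \<le> w"
        using that pos m1 m2 m3 by (auto simp del: diff_add_eq_diff_diff_swap)
      then show ?thesis by auto
    qed
    show "integrable triple (psi w)" "(\<integral>x. psi w x \<partial>triple) = 0" if "w \<in> W" for w
      using excess_triple[OF that] unfolding psi_def by auto
    show "ln (genie1 v1 w x) + ln (relay1 v3 k c ?d w x) + ln (genie2 v2 al b e w x) =
      log_gain al b w x + psi w x + (\<Sum>((Z, D, E), c, v)\<leftarrow>[((1, 0, 0), (gd, gc, 1, 0, 0), v1), ((0, 1, 0), (gd - c * k, gc - ?d, 1, - c, 0), v3),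
             ((0, 0, 1), (gc, gd - e * gc, 0, of_real b, al - e), v2)]. sq (0, 0, Z, D, E) w x - sq c w x / v) -
        N * (ln v1 + ln v3 + ln v2 - ln (b\<^sup>2))"
      if x: "x \<in> space triple" for w x
      unfolding ln_genie1[OF pos(1)] ln_relay1[OF pos(2) x] ln_genie2[OF pos(3) b(1) x] log_gain_def psi_eq k_def[symmetric]
      by (simp add: distrib_left right_diff_distrib)
  qed (use genie1_admissible[OF pos(1)] relay1_admissible[OF pos(2)] genie2_admissible[OF pos(3) b(1)] b in auto)
  ultimately show ?thesis by simp
qed

end

end

context feedback_code
begin

lemma exp_le_of_le_ln: "0 < n \<Longrightarrow> 0 < B \<and> x \<le> n * ln B \<Longrightarrow> exp (x / n) \<le> (B::real)"
  by (metis exp_le_cancel_iff exp_ln mult.commute pos_divide_le_eq)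

lemma exp_rate_le_rhs_term:
  assumes P: "0 \<le> P" and N: "0 < N"
  shows "\<exists>r. 0 \<le> r \<and> r \<le> 1 \<and> exp (rate / N) \<le> rhs_term (cmod gc * sqrt P) (cmod gd * sqrt P) r"
proof -
  from corr_eq[OF P] obtain la where la: "corr = of_real (real (card W * N) * P) * la" "cmod la \<le> 1" by auto
  have n: "0 < real N" using N by simp
  show ?thesis
  proof (rule exists_rhs_term_ge[where r = "cmod la"])
    show "exp (rate / N) \<le> genie_bound (cmod gc * sqrt P) (cmod gd * sqrt P) al (cmod la)"
      if "0 \<le> al" "al < 1" "al * (cmod gc * sqrt P) \<le> cmod gd * sqrt P" for al
      by (rule exp_le_of_le_ln[OF n rate_le_genie[OF P la that]])
  qed (use P la exp_le_of_le_ln[OF n rate_le_direct[OF P la]] exp_le_of_le_ln[OF n rate_le_sum[OF P la]] in auto)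
qed

lemma err_le_one: "err1 gd gc N R1 R2 C \<le> 1" "err2 gd gc N R1 R2 C \<le> 1"
proof -
  interpret chan: prob_space "chan_space N R1 R2" by (rule prob_space_chan_space)
  show "err1 gd gc N R1 R2 C \<le> 1" "err2 gd gc N R1 R2 C \<le> 1"
    unfolding err1_def err2_def by (rule chan.prob_le_1)+
qed

lemma ln_card_msgs: "real N * R * ln 2 \<le> ln (card (msgs N R))"
proof -
  have "ln (2 powr (real N * R)) \<le> ln (card (msgs N R))"
    using card_msgs[of R] by (intro ln_mono) auto
  then show ?thesis by (simp add: ln_powr)
qed

lemma rate_ge:
  "N * (2 * R1 * (1 - err1 gd gc N R1 R2 C) + R2 * (1 - err2 gd gc N R1 R2 C)) * ln 2 - 3 * ln 2 \<le> rate"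
  using mult_right_mono[OF ln_card_msgs[of R1], of "1 - err1 gd gc N R1 R2 C"]
    mult_right_mono[OF ln_card_msgs[of R2], of "1 - err2 gd gc N R1 R2 C"] err_le_one
  by (simp add: rate_def algebra_simps)

end

subsection \<open>The outer bound\<close>

text \<open>Positivity allows the three logarithms to be merged into one; the upper bounds are free
  of \<open>r\<close> and show that the supremum in the theorem is taken over a bounded set.\<close>

lemma rhs_term_factors:
  fixes i s r :: real
  assumes nn: "0 \<le> i" "0 \<le> s" "0 \<le> r" "r \<le> 1"
  shows "0 < 1 + (1 - r\<^sup>2) * s\<^sup>2 / (1 + (1 - r\<^sup>2) * i\<^sup>2)" "0 < 1 + s\<^sup>2 + i\<^sup>2 + 2 * r * (s * i)"
    "0 < 1 + i\<^sup>2 + (s\<^sup>2 - (1 + r\<^sup>2) * i\<^sup>2 + 2 * r * (s * i)) / (1 + i\<^sup>2)"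
    and "1 + (1 - r\<^sup>2) * s\<^sup>2 / (1 + (1 - r\<^sup>2) * i\<^sup>2) \<le> 1 + s\<^sup>2"
    "1 + s\<^sup>2 + i\<^sup>2 + 2 * r * (s * i) \<le> 1 + s\<^sup>2 + i\<^sup>2 + 2 * (s * i)"
    "1 + i\<^sup>2 + (s\<^sup>2 - (1 + r\<^sup>2) * i\<^sup>2 + 2 * r * (s * i)) / (1 + i\<^sup>2) \<le> 1 + s\<^sup>2 + i\<^sup>2 + 2 * (s * i)"
proof -
  have r2: "0 \<le> 1 - r\<^sup>2" "r\<^sup>2 \<le> 1" using nn by (simp_all add: power_le_one)
  have D: "0 < 1 + i\<^sup>2" by (simp add: add_pos_nonneg)
  have a: "0 \<le> (1 - r\<^sup>2) * s\<^sup>2" "1 \<le> 1 + (1 - r\<^sup>2) * i\<^sup>2" using r2 by auto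
  show "0 < 1 + (1 - r\<^sup>2) * s\<^sup>2 / (1 + (1 - r\<^sup>2) * i\<^sup>2)"
    using a by (intro add_pos_nonneg divide_nonneg_nonneg) auto
  show "0 < 1 + s\<^sup>2 + i\<^sup>2 + 2 * r * (s * i)"
    using nn by (intro add_pos_nonneg) auto
  have q: "0 \<le> r * (s * i)" "r * (s * i) \<le> s * i"
    using nn mult_right_mono[of r 1 "s * i"] by auto
  then show "1 + s\<^sup>2 + i\<^sup>2 + 2 * r * (s * i) \<le> 1 + s\<^sup>2 + i\<^sup>2 + 2 * (s * i)" by linarith
  have "(1 - r\<^sup>2) * s\<^sup>2 / (1 + (1 - r\<^sup>2) * i\<^sup>2) \<le> (1 - r\<^sup>2) * s\<^sup>2 / 1"
    using a by (intro divide_left_mono) auto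
  also have "\<dots> \<le> s\<^sup>2" using mult_right_mono[of "1 - r\<^sup>2" 1 "s\<^sup>2"] by simp
  finally show "1 + (1 - r\<^sup>2) * s\<^sup>2 / (1 + (1 - r\<^sup>2) * i\<^sup>2) \<le> 1 + s\<^sup>2" by simp
  have ri: "r\<^sup>2 * i\<^sup>2 \<le> i\<^sup>2" "0 \<le> r\<^sup>2 * i\<^sup>2" using mult_right_mono[OF r2(2), of "i\<^sup>2"] by auto
  have "0 < ((1 + i\<^sup>2)\<^sup>2 + (s\<^sup>2 - (1 + r\<^sup>2) * i\<^sup>2 + 2 * (r * (s * i)))) / (1 + i\<^sup>2)"
  proof (rule divide_pos_pos[OF _ D])
    have "(1 + i\<^sup>2)\<^sup>2 = 1 + 2 * i\<^sup>2 + (i\<^sup>2)\<^sup>2" by (simp add: power2_sum)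
    then show "0 < (1 + i\<^sup>2)\<^sup>2 + (s\<^sup>2 - (1 + r\<^sup>2) * i\<^sup>2 + 2 * (r * (s * i)))"
      using ri q zero_le_power2[of "i\<^sup>2"] zero_le_power2[of s] unfolding distrib_right mult_1 by linarith
  qed
  then show "0 < 1 + i\<^sup>2 + (s\<^sup>2 - (1 + r\<^sup>2) * i\<^sup>2 + 2 * r * (s * i)) / (1 + i\<^sup>2)"
    using D by (simp add: add_divide_distrib power2_eq_square[of "1 + i\<^sup>2"] mult.assoc)
  have "(s\<^sup>2 - (1 + r\<^sup>2) * i\<^sup>2 + 2 * r * (s * i)) / (1 + i\<^sup>2) \<le> (s\<^sup>2 + 2 * (s * i)) / (1 + i\<^sup>2)"
  proof (rule divide_right_mono)
    show "s\<^sup>2 - (1 + r\<^sup>2) * i\<^sup>2 + 2 * r * (s * i) \<le> s\<^sup>2 + 2 * (s * i)"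
      using ri q zero_le_power2[of i] unfolding distrib_right mult_1 mult.assoc by linarith
  qed (use D in simp)
  also have "\<dots> \<le> (s\<^sup>2 + 2 * (s * i)) / 1"
    using nn by (intro divide_left_mono) (auto intro!: mult_pos_pos D)
  finally show "1 + i\<^sup>2 + (s\<^sup>2 - (1 + r\<^sup>2) * i\<^sup>2 + 2 * r * (s * i)) / (1 + i\<^sup>2) \<le> 1 + s\<^sup>2 + i\<^sup>2 + 2 * (s * i)" by simp
qed

theorem theoremV3:
  fixes gd gc :: complex and P R1 R2 SNR INR :: real
  assumes "0 \<le> P"
    and "SNR = snr gd P" and "INR = inr gc P"
    and "(R1, R2) \<in> capacity_region gd gc P"
  shows "2 * R1 + R2 \<le>
    (SUP \<rho>\<in>{\<rho> :: complex. 0 \<le> cmod \<rho> \<and> cmod \<rho> \<le> 1}.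
       log 2 (1 + (1 - (cmod \<rho>)\<^sup>2) * SNR / (1 + (1 - (cmod \<rho>)\<^sup>2) * INR))
     + log 2 (1 + SNR + INR + 2 * cmod \<rho> * sqrt (SNR * INR))
     + log 2 (1 + INR + (SNR - (1 + (cmod \<rho>)\<^sup>2) * INR + 2 * cmod \<rho> * sqrt (SNR * INR)) / (1 + INR)))"
  (is "_ \<le> (SUP \<rho>\<in>?U. ?F \<rho>)")
proof -
  define s i where "s = cmod gd * sqrt P" and "i = cmod gc * sqrt P"
  have nn: "0 \<le> s" "0 \<le> i" using assms(1) by (simp_all add: s_def i_def)
  have S: "SNR = s\<^sup>2" and I: "INR = i\<^sup>2"
    using assms(1-3) by (simp_all add: s_def i_def snr_def inr_def power_mult_distrib)
  have q: "sqrt (SNR * INR) = s * i"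
    using nn by (simp add: S I real_sqrt_mult)
  have F: "?F \<rho> = log 2 (rhs_term i s (cmod \<rho>))" if "\<rho> \<in> ?U" for \<rho>
    using rhs_term_factors(1-3)[OF nn(2,1), of "cmod \<rho>"] that
    unfolding q unfolding S I rhs_term_def by (simp add: log_mult_pos)
  let ?B = "log 2 (1 + s\<^sup>2) + log 2 (1 + s\<^sup>2 + i\<^sup>2 + 2 * (s * i)) + log 2 (1 + s\<^sup>2 + i\<^sup>2 + 2 * (s * i))"
  have log_le: "log 2 x \<le> log 2 y" if "0 < x" "x \<le> y" for x y :: real
    using that by simp
  have "?F \<rho> \<le> ?B" if "\<rho> \<in> ?U" for \<rho>
  proof -
    note f = rhs_term_factors[OF nn(2,1) norm_ge_zero[of \<rho>]]
    have "cmod \<rho> \<le> 1" using that by simp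
    note f = f[OF this]
    show ?thesis
      unfolding q unfolding S I
      by (rule add_mono[OF add_mono[OF log_le[OF f(1,4)] log_le[OF f(2,5)]] log_le[OF f(3,6)]])
  qed
  then have bdd: "bdd_above (?F ` ?U)" by (intro bdd_aboveI2)
  define c where "c = (SUP \<rho>\<in>?U. ?F \<rho>)"
  have ach: "2 * R1 + R2 \<le> c" if ach: "achievable gd gc P R1 R2" for R1 R2
  proof -
    obtain C where valid: "\<forall>N. valid_code gd gc P N R1 R2 (C N)"
      and err: "(\<lambda>N. err1 gd gc N R1 R2 (C N)) \<longlonglongrightarrow> 0" "(\<lambda>N. err2 gd gc N R1 R2 (C N)) \<longlonglongrightarrow> 0"
      using ach unfolding achievable_def by auto
    \<comment> \<open>The term \<open>3 / N\<close> is the \<open>3 * ln 2\<close> of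
      \<open>rate\<close> after division by \<open>N * ln 2\<close>; it vanishes in the
      limit.\<close>
    let ?r = "\<lambda>N. 2 * R1 * (1 - err1 gd gc N R1 R2 (C N)) + R2 * (1 - err2 gd gc N R1 R2 (C N)) - 3 * (1 / real N)"
    have "?r N \<le> c" if N: "1 \<le> N" for N
    proof -
      interpret feedback_code gd gc P N R1 R2 "C N" by standard (rule valid[rule_format])
      from exp_rate_le_rhs_term[OF assms(1), folded s_def i_def] N obtain r
        where r: "0 \<le> r" "r \<le> 1" "exp (rate / N) \<le> rhs_term i s r" by auto
      have "(N * ?r N) * ln 2 \<le> rate"
        using rate_ge N by (simp add: algebra_simps)
      then have "?r N \<le> rate / N / ln 2" using N by (simp add: field_simps)
      also have "\<dots> = log 2 (exp (rate / N))" by (simp add: log_def)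
      also have "\<dots> \<le> log 2 (rhs_term i s r)" using r(3) by (intro log_mono) auto
      also have "\<dots> = ?F (of_real r)" using r F[of "of_real r"] by simp
      also have "\<dots> \<le> c" unfolding c_def using r by (intro cSUP_upper bdd) auto
      finally show ?thesis .
    qed
    moreover have "?r \<longlonglongrightarrow> 2 * R1 * (1 - 0) + R2 * (1 - 0) - 3 * 0"
      by (intro tendsto_intros err lim_1_over_n)
    ultimately have "2 * R1 * (1 - 0) + R2 * (1 - 0) - 3 * 0 \<le> c"
      by (intro LIMSEQ_le_const2) auto
    then show ?thesis by simp
  qed
  \<comment> \<open>The bound defines a closed half-plane, so it passes from achievable pairs to the
    capacity region.\<close>
  have "closed {p :: real \<times> real. 2 * fst p + snd p \<le> c}"
    by (intro closed_Collect_le continuous_intros)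
  then have "closure {(R1, R2). achievable gd gc P R1 R2} \<subseteq> {p. 2 * fst p + snd p \<le> c}"
    using ach by (intro closure_minimal) auto
  then show ?thesis
    using assms(4) unfolding capacity_region_def c_def by auto
qed

end
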